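(* Let $\mathcal C$ be an essentially algebraic category, equipped with its strong-epimorphism--monomorphism factorization system, and let $\mathcal V$ be a finitary many-sorted variety, equipped with its sortwise-surjective--sortwise-injective factorization system. Suppose that a functor $L:\mathcal C\to\mathcal V$ has a right adjoint and that (i) $L$ reflects isomorphisms; (ii) $L$ preserves monomorphisms; (iii) $L$ preserves pullbacks of two monomorphisms with a common codomain. Then $L$ is a transfer functor. The category $\mathcal C$ admits a noetherian form whose quotients are exactly its strong epimorphisms and whose embeddings are exactly its monomorphisms. Such a form can be chosen with complete algebraic modular fibres.
   Context: An essentially algebraic category is the category of set-based models of a small many-sorted essentially algebraic theory (partial operations whose domains are specified by equations, with a set bound on operation arities); equivalently, a locally presentable category. A finitary many-sorted variety has a set of sorts and consists of all set-based algebras for a finitary equational theory, empty carriers being allowed when the operations and equations permit them. A complete lattice is algebraic when each element is a join of compact elements. Conventions: categories are locally small; "set" is relative to a fixed universe. A conservative functor is one that reflects isomorphisms. A proper factorization system $(\mathcal E,\mathcal M)$ is an orthogonal factorization system with every morphism in $\mathcal E$ an epimorphism and every morphism in $\mathcal M$ a monomorphism. Transfer functors. Let $\mathcal C,\mathcal D$ have specified proper factorization systems $(\mathcal E_{\mathcal C},\mathcal M_{\mathcal C})$, $(\mathcal E_{\mathcal D},\mathcal M_{\mathcal D})$, and suppose both have pullbacks of two right-class morphisms with common codomain and pushouts of two left-class morphisms with common domain. A transfer functor $T:\mathcal C\to\mathcal D$ is a conservative functor with $T(\mathcal E_{\mathcal C})\subseteq\mathcal E_{\mathcal D}$, $T(\mathcal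 M_{\mathcal C})\subseteq\mathcal M_{\mathcal D}$, preserving pullbacks of two $\mathcal M_{\mathcal C}$-morphisms and pushouts of two $\mathcal E_{\mathcal C}$-morphisms. Forms. An (orean) form $\mathsf F$ on a category $\mathcal C$ assigns to each object $X$ a set-sized bounded lattice $\mathsf F(X)$ (the fibre over $X$; its elements are called clusters) and to each morphism $f:X\to Y$ monotone maps $f_!:\mathsf F(X)\to\mathsf F(Y)$ and $f^*:\mathsf F(Y)\to\mathsf F(X)$ with $f_!S\le T\iff S\le f^*T$, such that $(gf)_!=g_!f_!$, $(gf)^*=f^*g^*$, and identities act as identities. Put $\operatorname{Im}f=f_!\top_X$ and $\operatorname{Ker}f=f^*\bot_Y$. A cluster in $\mathsf F(X)$ is conormal if it is the image of some morphism of $\mathcal C$ with codomain $X$, and normal if it is the kernel of some morphism of $\mathcal C$ with domain $X$. An embedding of a conormal $S\in\mathsf F(X)$ is a morphism $\iota$ into $X$ with $\operatorname{Im}\iota=S$ such that every morphism $f$ into $X$ with $\operatorname{Im}f\le S$ factors as $f=\iota h$ for a unique $h$. A quotient of a normal $K\in\mathsf F(X)$ is a morphism $\pi$ out of $X$ with $\operatorname{Ker}\pi=K$ such that every morphism $g$ out of $X$ with $K\le\operatorname{Ker}g$ factors as $g=h\pi$ for a unique $h$. The form is noetherian if: (N1) $f^*f_!S=S\vee\operatorname{Ker}f$ and $f_!f^*T=T\wedge\operatorname{Im}f$ for all $f,S,T$; (N2) every morphism $f$ factors as $f=me$ with $e$ a quotient of $\operatorname{Ker}f$ and $m$ an embedding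 of $\operatorname{Im}f$; (N3) the join of two normal clusters (in the same fibre) is normal, and the meet of two conormal clusters is conormal. The quotients of the form are all quotients of normal clusters; the embeddings of the form are all embeddings of conormal clusters; these form a proper factorization system, the one induced by the form. *)

theory Defs
  imports
    "HOL-Algebra.Complete_Lattice"
    "HOL-Library.Equipollence"
    "HOL-Library.FuncSet"
begin

section \<open>The universe of sets\<close>

text \<open>
  The fixed universe of sets is represented by a type \<open>'u\<close> whose cardinality is strongly
  inaccessible. A ``set'' of the universe is, up to bijection, a subset of \<open>'u\<close> of strictly
  smaller cardinality than \<open>'u\<close>, and ``set-sized'' means \<open>small TYPE('u)\<close>.
\<close>

definition small :: "'u itself \<Rightarrow> 'a set \<Rightarrow> bool" where
  "small U A \<longleftrightarrow> A \<prec> (UNIV :: 'u set)"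

definition universe :: "'u itself \<Rightarrow> bool" where
  "universe U \<longleftrightarrow>
     (UNIV :: nat set) \<prec> (UNIV :: 'u set) \<and>
     (\<forall>A :: 'u set. small U A \<longrightarrow> small U (Pow A)) \<and>
     (\<forall>(A :: 'u set) (B :: 'u \<Rightarrow> 'u set).
        small U A \<longrightarrow> (\<forall>x\<in>A. small U (B x)) \<longrightarrow> small U (\<Union>x\<in>A. B x))"


section \<open>Categories\<close>

text \<open>\<open>Comp C g f\<close> is the composite \<open>gf\<close> (first \<open>f\<close>, then \<open>g\<close>).\<close>

record ('o, 'm) cat =
  Obj :: "'o set"
  Arr :: "'m set"
  Dom :: "'m \<Rightarrow> 'o"
  Cod :: "'m \<Rightarrow> 'o"
  Idn :: "'o \<Rightarrow> 'm"
  Comp :: "'m \<Rightarrow> 'm \<Rightarrow> 'm"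

definition Hom :: "('o, 'm) cat \<Rightarrow> 'o \<Rightarrow> 'o \<Rightarrow> 'm set" where
  "Hom C X Y = {f \<in> Arr C. Dom C f = X \<and> Cod C f = Y}"

definition category :: "('o, 'm) cat \<Rightarrow> bool" where
  "category C \<longleftrightarrow>
     (\<forall>f\<in>Arr C. Dom C f \<in> Obj C \<and> Cod C f \<in> Obj C) \<and>
     (\<forall>X\<in>Obj C. Idn C X \<in> Hom C X X) \<and>
     (\<forall>f\<in>Arr C. \<forall>g\<in>Arr C. Cod C f = Dom C g \<longrightarrow> Comp C g f \<in> Hom C (Dom C f) (Cod C g)) \<and>
     (\<forall>f\<in>Arr C. Comp C f (Idn C (Dom C f)) = f \<and> Comp C (Idn C (Cod C f)) f = f) \<and>
     (\<forall>f\<in>Arr C. \<forall>g\<in>Arr C. \<forall>h\<in>Arr C. Cod C f = Dom C g \<and> Cod C g = Dom C h \<longrightarrow>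
        Comp C h (Comp C g f) = Comp C (Comp C h g) f)"

definition is_iso :: "('o, 'm) cat \<Rightarrow> 'm \<Rightarrow> bool" where
  "is_iso C f \<longleftrightarrow> f \<in> Arr C \<and>
     (\<exists>g \<in> Hom C (Cod C f) (Dom C f).
        Comp C g f = Idn C (Dom C f) \<and> Comp C f g = Idn C (Cod C f))"

definition is_mono :: "('o, 'm) cat \<Rightarrow> 'm \<Rightarrow> bool" where
  "is_mono C m \<longleftrightarrow> m \<in> Arr C \<and>
     (\<forall>f\<in>Arr C. \<forall>g\<in>Arr C. Dom C f = Dom C g \<and> Cod C f = Dom C m \<and> Cod C g = Dom C m \<and>
        Comp C m f = Comp C m g \<longrightarrow> f = g)"

definition is_epi :: "('o, 'm) cat \<Rightarrow> 'm \<Rightarrow> bool" where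
  "is_epi C e \<longleftrightarrow> e \<in> Arr C \<and>
     (\<forall>f\<in>Arr C. \<forall>g\<in>Arr C. Cod C f = Cod C g \<and> Dom C f = Cod C e \<and> Dom C g = Cod C e \<and>
        Comp C f e = Comp C g e \<longrightarrow> f = g)"

text \<open>\<open>e \<bottom> m\<close>: every square \<open>mu = ve\<close> has a unique diagonal.\<close>

definition orthogonal :: "('o, 'm) cat \<Rightarrow> 'm \<Rightarrow> 'm \<Rightarrow> bool" where
  "orthogonal C e m \<longleftrightarrow>
     (\<forall>u \<in> Hom C (Dom C e) (Dom C m). \<forall>v \<in> Hom C (Cod C e) (Cod C m).
        Comp C m u = Comp C v e \<longrightarrow>
        (\<exists>!d. d \<in> Hom C (Cod C e) (Dom C m) \<and> Comp C d e = u \<and> Comp C m d = v))"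

definition mono_arrs :: "('o, 'm) cat \<Rightarrow> 'm set" where
  "mono_arrs C = {m. is_mono C m}"

definition strong_epis :: "('o, 'm) cat \<Rightarrow> 'm set" where
  "strong_epis C = {e. is_epi C e \<and> (\<forall>m \<in> mono_arrs C. orthogonal C e m)}"

definition proper_factorization_system :: "('o, 'm) cat \<Rightarrow> 'm set \<Rightarrow> 'm set \<Rightarrow> bool" where
  "proper_factorization_system C E M \<longleftrightarrow>
     {f. is_iso C f} \<subseteq> E \<and> {f. is_iso C f} \<subseteq> M \<and>
     (\<forall>f\<in>E. \<forall>g\<in>E. Cod C f = Dom C g \<longrightarrow> Comp C g f \<in> E) \<and>
     (\<forall>f\<in>M. \<forall>g\<in>M. Cod C f = Dom C g \<longrightarrow> Comp C g f \<in> M) \<and>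
     (\<forall>f\<in>Arr C. \<exists>e\<in>E. \<exists>m\<in>M. Cod C e = Dom C m \<and> f = Comp C m e) \<and>
     (\<forall>e\<in>E. \<forall>m\<in>M. orthogonal C e m) \<and>
     (\<forall>e\<in>E. is_epi C e) \<and> (\<forall>m\<in>M. is_mono C m)"

definition is_pullback :: "('o, 'm) cat \<Rightarrow> 'm \<Rightarrow> 'm \<Rightarrow> 'm \<Rightarrow> 'm \<Rightarrow> bool" where
  "is_pullback C f g p q \<longleftrightarrow>
     f \<in> Arr C \<and> g \<in> Arr C \<and> Cod C f = Cod C g \<and>
     p \<in> Arr C \<and> q \<in> Arr C \<and> Dom C p = Dom C q \<and> Cod C p = Dom C f \<and> Cod C q = Dom C g \<and>
     Comp C f p = Comp C g q \<and>
     (\<forall>a\<in>Arr C. \<forall>b\<in>Arr C. Dom C a = Dom C b \<and> Cod C a = Dom C f \<and> Cod C b = Dom C g \<and>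
        Comp C f a = Comp C g b \<longrightarrow>
        (\<exists>!h. h \<in> Hom C (Dom C a) (Dom C p) \<and> Comp C p h = a \<and> Comp C q h = b))"

definition is_pushout :: "('o, 'm) cat \<Rightarrow> 'm \<Rightarrow> 'm \<Rightarrow> 'm \<Rightarrow> 'm \<Rightarrow> bool" where
  "is_pushout C f g p q \<longleftrightarrow>
     f \<in> Arr C \<and> g \<in> Arr C \<and> Dom C f = Dom C g \<and>
     p \<in> Arr C \<and> q \<in> Arr C \<and> Cod C p = Cod C q \<and> Dom C p = Cod C f \<and> Dom C q = Cod C g \<and>
     Comp C p f = Comp C q g \<and>
     (\<forall>a\<in>Arr C. \<forall>b\<in>Arr C. Cod C a = Cod C b \<and> Dom C a = Cod C f \<and> Dom C b = Cod C g \<and>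
        Comp C a f = Comp C b g \<longrightarrow>
        (\<exists>!h. h \<in> Hom C (Cod C p) (Cod C a) \<and> Comp C h p = a \<and> Comp C h q = b))"


section \<open>Functors\<close>

record ('o, 'm, 'p, 'n) functr =
  FObj :: "'o \<Rightarrow> 'p"
  FArr :: "'m \<Rightarrow> 'n"

definition is_functor :: "('o, 'm) cat \<Rightarrow> ('p, 'n) cat \<Rightarrow> ('o, 'm, 'p, 'n) functr \<Rightarrow> bool" where
  "is_functor C D T \<longleftrightarrow>
     (\<forall>X\<in>Obj C. FObj T X \<in> Obj D) \<and>
     (\<forall>f\<in>Arr C. FArr T f \<in> Hom D (FObj T (Dom C f)) (FObj T (Cod C f))) \<and>
     (\<forall>X\<in>Obj C. FArr T (Idn C X) = Idn D (FObj T X)) \<and>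
     (\<forall>f\<in>Arr C. \<forall>g\<in>Arr C. Cod C f = Dom C g \<longrightarrow>
        FArr T (Comp C g f) = Comp D (FArr T g) (FArr T f))"

definition is_equivalence :: "('o, 'm) cat \<Rightarrow> ('p, 'n) cat \<Rightarrow> ('o, 'm, 'p, 'n) functr \<Rightarrow> bool" where
  "is_equivalence C D T \<longleftrightarrow> is_functor C D T \<and>
     (\<forall>X\<in>Obj C. \<forall>Y\<in>Obj C. bij_betw (FArr T) (Hom C X Y) (Hom D (FObj T X) (FObj T Y))) \<and>
     (\<forall>Z\<in>Obj D. \<exists>X\<in>Obj C. \<exists>i \<in> Hom D (FObj T X) Z. is_iso D i)"

text \<open>
  \<open>\<phi> X Y\<close> is the bijection from \<open>Hom(LX, Y)\<close> to \<open>Hom(X, RY)\<close>, natural in \<open>X\<close> and \<open>Y\<close>.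
\<close>

definition is_adjunction ::
  "('o, 'm) cat \<Rightarrow> ('p, 'n) cat \<Rightarrow> ('o, 'm, 'p, 'n) functr \<Rightarrow> ('p, 'n, 'o, 'm) functr \<Rightarrow>
   ('o \<Rightarrow> 'p \<Rightarrow> 'n \<Rightarrow> 'm) \<Rightarrow> bool" where
  "is_adjunction C D L R \<phi> \<longleftrightarrow> is_functor C D L \<and> is_functor D C R \<and>
     (\<forall>X\<in>Obj C. \<forall>Y\<in>Obj D. bij_betw (\<phi> X Y) (Hom D (FObj L X) Y) (Hom C X (FObj R Y))) \<and>
     (\<forall>X\<in>Obj C. \<forall>X'\<in>Obj C. \<forall>Y\<in>Obj D. \<forall>Y'\<in>Obj D.
        \<forall>f \<in> Hom C X' X. \<forall>g \<in> Hom D (FObj L X) Y. \<forall>k \<in> Hom D Y Y'.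
          \<phi> X' Y' (Comp D k (Comp D g (FArr L f))) =
          Comp C (FArr R k) (Comp C (\<phi> X Y g) f))"

definition has_right_adjoint ::
  "('o, 'm) cat \<Rightarrow> ('p, 'n) cat \<Rightarrow> ('o, 'm, 'p, 'n) functr \<Rightarrow> bool" where
  "has_right_adjoint C D L \<longleftrightarrow> (\<exists>R \<phi>. is_adjunction C D L R \<phi>)"

definition reflects_isos ::
  "('o, 'm) cat \<Rightarrow> ('p, 'n) cat \<Rightarrow> ('o, 'm, 'p, 'n) functr \<Rightarrow> bool" where
  "reflects_isos C D T \<longleftrightarrow> (\<forall>f\<in>Arr C. is_iso D (FArr T f) \<longrightarrow> is_iso C f)"

definition preserves_monos ::
  "('o, 'm) cat \<Rightarrow> ('p, 'n) cat \<Rightarrow> ('o, 'm, 'p, 'n) functr \<Rightarrow> bool" where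
  "preserves_monos C D T \<longleftrightarrow> (\<forall>f. is_mono C f \<longrightarrow> is_mono D (FArr T f))"

definition preserves_pullbacks_of ::
  "'m set \<Rightarrow> ('o, 'm) cat \<Rightarrow> ('p, 'n) cat \<Rightarrow> ('o, 'm, 'p, 'n) functr \<Rightarrow> bool" where
  "preserves_pullbacks_of M C D T \<longleftrightarrow>
     (\<forall>f\<in>M. \<forall>g\<in>M. \<forall>p q. is_pullback C f g p q \<longrightarrow>
        is_pullback D (FArr T f) (FArr T g) (FArr T p) (FArr T q))"

definition preserves_pushouts_of ::
  "'m set \<Rightarrow> ('o, 'm) cat \<Rightarrow> ('p, 'n) cat \<Rightarrow> ('o, 'm, 'p, 'n) functr \<Rightarrow> bool" where
  "preserves_pushouts_of E C D T \<longleftrightarrow>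
     (\<forall>f\<in>E. \<forall>g\<in>E. \<forall>p q. is_pushout C f g p q \<longrightarrow>
        is_pushout D (FArr T f) (FArr T g) (FArr T p) (FArr T q))"

definition transfer_setting :: "('o, 'm) cat \<Rightarrow> 'm set \<Rightarrow> 'm set \<Rightarrow> bool" where
  "transfer_setting C E M \<longleftrightarrow> category C \<and> proper_factorization_system C E M \<and>
     (\<forall>f\<in>M. \<forall>g\<in>M. Cod C f = Cod C g \<longrightarrow> (\<exists>p q. is_pullback C f g p q)) \<and>
     (\<forall>f\<in>E. \<forall>g\<in>E. Dom C f = Dom C g \<longrightarrow> (\<exists>p q. is_pushout C f g p q))"

definition transfer_functor ::
  "('o, 'm) cat \<Rightarrow> 'm set \<Rightarrow> 'm set \<Rightarrow> ('p, 'n) cat \<Rightarrow> 'n set \<Rightarrow> 'n set \<Rightarrow>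
   ('o, 'm, 'p, 'n) functr \<Rightarrow> bool" where
  "transfer_functor C EC MC D ED MD T \<longleftrightarrow>
     transfer_setting C EC MC \<and> transfer_setting D ED MD \<and>
     is_functor C D T \<and> reflects_isos C D T \<and>
     FArr T ` EC \<subseteq> ED \<and> FArr T ` MC \<subseteq> MD \<and>
     preserves_pullbacks_of MC C D T \<and> preserves_pushouts_of EC C D T"


section \<open>Essentially algebraic theories and their models\<close>

text \<open>
  Essentially algebraic theories in the sense of Adamek and Rosicky: the domain of a partial
  operation is the solution set of equations between terms in total operations only. An
  operation \<open>f\<close> has an arity set \<open>Arity T f\<close> of argument positions, position \<open>i\<close> being of sort
  \<open>ArgSort T f i\<close>. In \<open>App f ts\<close> only the values of \<open>ts\<close> at the positions of \<open>f\<close> matter.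

  As carriers may be empty, an equation \<open>(X, \<sigma>, l, r)\<close> carries its context: the set \<open>X\<close> of
  variables over which it is quantified, with their sorts \<open>\<sigma>\<close>. The domain equations of \<open>f\<close> are
  pairs of terms whose variables are the argument positions of \<open>f\<close>.
\<close>

datatype 'u tm = Var 'u | App 'u "'u \<Rightarrow> 'u tm"

type_synonym 'u equation = "'u set \<times> ('u \<Rightarrow> 'u) \<times> 'u tm \<times> 'u tm"

record 'u ea_theory =
  Sorts :: "'u set"
  Ops :: "'u set"
  Arity :: "'u \<Rightarrow> 'u set"
  ArgSort :: "'u \<Rightarrow> 'u \<Rightarrow> 'u"
  ResSort :: "'u \<Rightarrow> 'u"
  Eqs :: "'u equation set"
  Total :: "'u set"
  DomEqs :: "'u \<Rightarrow> ('u tm \<times> 'u tm) set"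

text \<open>\<open>has_sort T F X \<sigma> t s\<close>: \<open>t\<close> is a term of sort \<open>s\<close> in the context \<open>(X, \<sigma>)\<close> over the operations \<open>F\<close>.\<close>

inductive has_sort ::
  "'u ea_theory \<Rightarrow> 'u set \<Rightarrow> 'u set \<Rightarrow> ('u \<Rightarrow> 'u) \<Rightarrow> 'u tm \<Rightarrow> 'u \<Rightarrow> bool"
  for T F X \<sigma> where
  Var: "x \<in> X \<Longrightarrow> has_sort T F X \<sigma> (Var x) (\<sigma> x)"
| App: "f \<in> F \<Longrightarrow> (\<And>i. i \<in> Arity T f \<Longrightarrow> has_sort T F X \<sigma> (ts i) (ArgSort T f i)) \<Longrightarrow>
        has_sort T F X \<sigma> (App f ts) (ResSort T f)"

definition wf_theory :: "'u ea_theory \<Rightarrow> bool" where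
  "wf_theory T \<longleftrightarrow>
     small TYPE('u) (Sorts T) \<and> small TYPE('u) (Ops T) \<and>
     small TYPE('u) (Eqs T) \<and> Total T \<subseteq> Ops T \<and>
     (\<forall>f\<in>Ops T. small TYPE('u) (Arity T f) \<and>
        ArgSort T f ` Arity T f \<subseteq> Sorts T \<and> ResSort T f \<in> Sorts T) \<and>
     (\<forall>(X, \<sigma>, l, r) \<in> Eqs T. small TYPE('u) X \<and> \<sigma> ` X \<subseteq> Sorts T \<and>
        (\<exists>s. has_sort T (Ops T) X \<sigma> l s \<and> has_sort T (Ops T) X \<sigma> r s)) \<and>
     (\<forall>f \<in> Ops T - Total T. small TYPE('u) (DomEqs T f) \<and>
        (\<forall>(l, r) \<in> DomEqs T f. \<exists>s.
           has_sort T (Total T) (Arity T f) (ArgSort T f) l s \<and>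
           has_sort T (Total T) (Arity T f) (ArgSort T f) r s))"

record 'u model =
  Carr :: "'u \<Rightarrow> 'u set"
  Op :: "'u \<Rightarrow> ('u \<Rightarrow> 'u) \<Rightarrow> 'u option"

primrec eval :: "'u ea_theory \<Rightarrow> 'u model \<Rightarrow> ('u \<Rightarrow> 'u) \<Rightarrow> 'u tm \<Rightarrow> 'u option" where
  "eval T A v (Var x) = Some (v x)"
| "eval T A v (App f ts) =
     (if \<forall>i \<in> Arity T f. eval T A v (ts i) \<noteq> None
      then Op A f (\<lambda>i \<in> Arity T f. the (eval T A v (ts i)))
      else None)"

text \<open>The tuples of arguments of the sorts required by \<open>f\<close>.\<close>

definition args :: "'u ea_theory \<Rightarrow> 'u model \<Rightarrow> 'u \<Rightarrow> ('u \<Rightarrow> 'u) set" where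
  "args T A f = (\<Pi>\<^sub>E i \<in> Arity T f. Carr A (ArgSort T f i))"

text \<open>
  The equality of options in the last clause is Kleene equality: if one side of an equation is
  defined then so is the other, and the two values agree. The clauses on sorts outside \<open>Sorts T\<close>
  and on operations outside \<open>Ops T\<close> only fix irrelevant values.
\<close>

definition is_model :: "'u ea_theory \<Rightarrow> 'u model \<Rightarrow> bool" where
  "is_model T A \<longleftrightarrow>
     (\<forall>s \<in> Sorts T. small TYPE('u) (Carr A s)) \<and>
     (\<forall>s. s \<notin> Sorts T \<longrightarrow> Carr A s = {}) \<and>
     (\<forall>f. f \<notin> Ops T \<longrightarrow> (\<forall>a. Op A f a = None)) \<and>
     (\<forall>f\<in>Ops T. \<forall>a b. Op A f a = Some b \<longrightarrow> a \<in> args T A f \<and> b \<in> Carr A (ResSort T f)) \<and>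
     (\<forall>f\<in>Total T. \<forall>a \<in> args T A f. Op A f a \<noteq> None) \<and>
     (\<forall>f \<in> Ops T - Total T. \<forall>a \<in> args T A f.
        Op A f a \<noteq> None \<longleftrightarrow> (\<forall>(l, r) \<in> DomEqs T f. eval T A a l = eval T A a r)) \<and>
     (\<forall>(X, \<sigma>, l, r) \<in> Eqs T. \<forall>v \<in> (\<Pi>\<^sub>E x \<in> X. Carr A (\<sigma> x)). eval T A v l = eval T A v r)"

definition is_hom :: "'u ea_theory \<Rightarrow> 'u model \<Rightarrow> 'u model \<Rightarrow> ('u \<Rightarrow> 'u \<Rightarrow> 'u) \<Rightarrow> bool" where
  "is_hom T A B h \<longleftrightarrow>
     (\<forall>s. h s \<in> Carr A s \<rightarrow>\<^sub>E Carr B s) \<and>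
     (\<forall>f\<in>Ops T. \<forall>a b. Op A f a = Some b \<longrightarrow>
        Op B f (\<lambda>i \<in> Arity T f. h (ArgSort T f i) (a i)) = Some (h (ResSort T f) b))"

text \<open>An arrow of the category of models is a triple (domain, sorted family of maps, codomain).\<close>

type_synonym 'u model_arr = "'u model \<times> ('u \<Rightarrow> 'u \<Rightarrow> 'u) \<times> 'u model"

definition Mod :: "'u ea_theory \<Rightarrow> ('u model, 'u model_arr) cat" where
  "Mod T =
     \<lparr> Obj = {A. is_model T A},
       Arr = {(A, h, B). is_model T A \<and> is_model T B \<and> is_hom T A B h},
       Dom = (\<lambda>(A, h, B). A),
       Cod = (\<lambda>(A, h, B). B),
       Idn = (\<lambda>A. (A, (\<lambda>s. \<lambda>x \<in> Carr A s. x), A)),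
       Comp = (\<lambda>(B, k, D) (A, h, B'). (A, (\<lambda>s. compose (Carr A s) (k s) (h s)), D)) \<rparr>"

text \<open>
  A category counts as essentially algebraic if it is equivalent to some category of models, so
  that the notion agrees with local presentability.
\<close>

definition essentially_algebraic :: "'u itself \<Rightarrow> ('o, 'm) cat \<Rightarrow> bool" where
  "essentially_algebraic U C \<longleftrightarrow> category C \<and>
     (\<exists>(T :: 'u ea_theory) F. wf_theory T \<and> is_equivalence C (Mod T) F)"

text \<open>
  A finitary equational theory is an essentially algebraic one in which all operations are total
  and all arities and contexts are finite (\<open>DomEqs\<close> is then irrelevant); the variety is \<open>Mod T\<close>.
\<close>

definition finitary_equational_theory :: "'u ea_theory \<Rightarrow> bool" where
  "finitary_equational_theory T \<longleftrightarrow> wf_theory T \<and> Total T = Ops T \<and>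
     (\<forall>f\<in>Ops T. finite (Arity T f)) \<and> (\<forall>(X, \<sigma>, l, r) \<in> Eqs T. finite X)"

definition surjective_homs :: "'u ea_theory \<Rightarrow> 'u model_arr set" where
  "surjective_homs T = {(A, h, B) \<in> Arr (Mod T). \<forall>s \<in> Sorts T. h s ` Carr A s = Carr B s}"

definition injective_homs :: "'u ea_theory \<Rightarrow> 'u model_arr set" where
  "injective_homs T = {(A, h, B) \<in> Arr (Mod T). \<forall>s \<in> Sorts T. inj_on (h s) (Carr A s)}"


section \<open>Forms\<close>

text \<open>
  \<open>dir F f\<close> and \<open>inv F f\<close> are the maps \<open>f\<^sub>!\<close> and \<open>f\<^sup>*\<close>. The clusters are elements of the universe \<open>'u\<close>.
\<close>

record ('o, 'm, 'u) form =
  Fib :: "'o \<Rightarrow> 'u gorder"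
  dir :: "'m \<Rightarrow> 'u \<Rightarrow> 'u"
  inv :: "'m \<Rightarrow> 'u \<Rightarrow> 'u"

definition is_form :: "('o, 'm) cat \<Rightarrow> ('o, 'm, 'u) form \<Rightarrow> bool" where
  "is_form C F \<longleftrightarrow>
     (\<forall>X\<in>Obj C. bounded_lattice (Fib F X) \<and> small TYPE('u) (carrier (Fib F X))) \<and>
     (\<forall>f\<in>Arr C.
        dir F f \<in> carrier (Fib F (Dom C f)) \<rightarrow> carrier (Fib F (Cod C f)) \<and>
        inv F f \<in> carrier (Fib F (Cod C f)) \<rightarrow> carrier (Fib F (Dom C f)) \<and>
        isotone (Fib F (Dom C f)) (Fib F (Cod C f)) (dir F f) \<and>
        isotone (Fib F (Cod C f)) (Fib F (Dom C f)) (inv F f) \<and>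
        (\<forall>S \<in> carrier (Fib F (Dom C f)). \<forall>T \<in> carrier (Fib F (Cod C f)).
           dir F f S \<sqsubseteq>\<^bsub>Fib F (Cod C f)\<^esub> T \<longleftrightarrow> S \<sqsubseteq>\<^bsub>Fib F (Dom C f)\<^esub> inv F f T)) \<and>
     (\<forall>f\<in>Arr C. \<forall>g\<in>Arr C. Cod C f = Dom C g \<longrightarrow>
        (\<forall>S \<in> carrier (Fib F (Dom C f)). dir F (Comp C g f) S = dir F g (dir F f S)) \<and>
        (\<forall>T \<in> carrier (Fib F (Cod C g)). inv F (Comp C g f) T = inv F f (inv F g T))) \<and>
     (\<forall>X\<in>Obj C. \<forall>S \<in> carrier (Fib F X). dir F (Idn C X) S = S \<and> inv F (Idn C X) S = S)"

definition form_Im :: "('o, 'm) cat \<Rightarrow> ('o, 'm, 'u) form \<Rightarrow> 'm \<Rightarrow> 'u" where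
  "form_Im C F f = dir F f \<top>\<^bsub>Fib F (Dom C f)\<^esub>"

definition form_Ker :: "('o, 'm) cat \<Rightarrow> ('o, 'm, 'u) form \<Rightarrow> 'm \<Rightarrow> 'u" where
  "form_Ker C F f = inv F f \<bottom>\<^bsub>Fib F (Cod C f)\<^esub>"

definition conormal :: "('o, 'm) cat \<Rightarrow> ('o, 'm, 'u) form \<Rightarrow> 'o \<Rightarrow> 'u \<Rightarrow> bool" where
  "conormal C F X S \<longleftrightarrow> S \<in> carrier (Fib F X) \<and> (\<exists>f\<in>Arr C. Cod C f = X \<and> form_Im C F f = S)"

definition normal :: "('o, 'm) cat \<Rightarrow> ('o, 'm, 'u) form \<Rightarrow> 'o \<Rightarrow> 'u \<Rightarrow> bool" where
  "normal C F X K \<longleftrightarrow> K \<in> carrier (Fib F X) \<and> (\<exists>f\<in>Arr C. Dom C f = X \<and> form_Ker C F f = K)"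

definition embedding_of :: "('o, 'm) cat \<Rightarrow> ('o, 'm, 'u) form \<Rightarrow> 'o \<Rightarrow> 'u \<Rightarrow> 'm \<Rightarrow> bool" where
  "embedding_of C F X S \<iota> \<longleftrightarrow> conormal C F X S \<and>
     \<iota> \<in> Arr C \<and> Cod C \<iota> = X \<and> form_Im C F \<iota> = S \<and>
     (\<forall>f\<in>Arr C. Cod C f = X \<and> form_Im C F f \<sqsubseteq>\<^bsub>Fib F X\<^esub> S \<longrightarrow>
        (\<exists>!h. h \<in> Hom C (Dom C f) (Dom C \<iota>) \<and> f = Comp C \<iota> h))"

definition quotient_of :: "('o, 'm) cat \<Rightarrow> ('o, 'm, 'u) form \<Rightarrow> 'o \<Rightarrow> 'u \<Rightarrow> 'm \<Rightarrow> bool" where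
  "quotient_of C F X K \<pi> \<longleftrightarrow> normal C F X K \<and>
     \<pi> \<in> Arr C \<and> Dom C \<pi> = X \<and> form_Ker C F \<pi> = K \<and>
     (\<forall>g\<in>Arr C. Dom C g = X \<and> K \<sqsubseteq>\<^bsub>Fib F X\<^esub> form_Ker C F g \<longrightarrow>
        (\<exists>!h. h \<in> Hom C (Cod C \<pi>) (Cod C g) \<and> g = Comp C h \<pi>))"

definition noetherian_form :: "('o, 'm) cat \<Rightarrow> ('o, 'm, 'u) form \<Rightarrow> bool" where
  "noetherian_form C F \<longleftrightarrow> is_form C F \<and>
     (\<forall>f\<in>Arr C.
        (\<forall>S \<in> carrier (Fib F (Dom C f)).
           inv F f (dir F f S) = S \<squnion>\<^bsub>Fib F (Dom C f)\<^esub> form_Ker C F f) \<and>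
        (\<forall>T \<in> carrier (Fib F (Cod C f)).
           dir F f (inv F f T) = T \<sqinter>\<^bsub>Fib F (Cod C f)\<^esub> form_Im C F f)) \<and>
     (\<forall>f\<in>Arr C. \<exists>e\<in>Arr C. \<exists>m\<in>Arr C. Cod C e = Dom C m \<and> f = Comp C m e \<and>
        quotient_of C F (Dom C f) (form_Ker C F f) e \<and>
        embedding_of C F (Cod C f) (form_Im C F f) m) \<and>
     (\<forall>X\<in>Obj C.
        (\<forall>K K'. normal C F X K \<and> normal C F X K' \<longrightarrow> normal C F X (K \<squnion>\<^bsub>Fib F X\<^esub> K')) \<and>
        (\<forall>S S'. conormal C F X S \<and> conormal C F X S' \<longrightarrow> conormal C F X (S \<sqinter>\<^bsub>Fib F X\<^esub> S')))"

definition form_quotients :: "('o, 'm) cat \<Rightarrow> ('o, 'm, 'u) form \<Rightarrow> 'm set" where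
  "form_quotients C F = {\<pi>. \<exists>X\<in>Obj C. \<exists>K. quotient_of C F X K \<pi>}"

definition form_embeddings :: "('o, 'm) cat \<Rightarrow> ('o, 'm, 'u) form \<Rightarrow> 'm set" where
  "form_embeddings C F = {\<iota>. \<exists>X\<in>Obj C. \<exists>S. embedding_of C F X S \<iota>}"


section \<open>Algebraic and modular lattices\<close>

definition compact_element :: "'a gorder \<Rightarrow> 'a \<Rightarrow> bool" where
  "compact_element L k \<longleftrightarrow> k \<in> carrier L \<and>
     (\<forall>A \<subseteq> carrier L. k \<sqsubseteq>\<^bsub>L\<^esub> \<Squnion>\<^bsub>L\<^esub>A \<longrightarrow> (\<exists>B \<subseteq> A. finite B \<and> k \<sqsubseteq>\<^bsub>L\<^esub> \<Squnion>\<^bsub>L\<^esub>B))"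

definition algebraic_lattice :: "'a gorder \<Rightarrow> bool" where
  "algebraic_lattice L \<longleftrightarrow> complete_lattice L \<and>
     (\<forall>x \<in> carrier L. \<exists>A \<subseteq> {k. compact_element L k}. x = \<Squnion>\<^bsub>L\<^esub>A)"

definition modular_lattice :: "'a gorder \<Rightarrow> bool" where
  "modular_lattice L \<longleftrightarrow> lattice L \<and>
     (\<forall>x \<in> carrier L. \<forall>y \<in> carrier L. \<forall>z \<in> carrier L. x \<sqsubseteq>\<^bsub>L\<^esub> z \<longrightarrow>
        x \<squnion>\<^bsub>L\<^esub> (y \<sqinter>\<^bsub>L\<^esub> z) = (x \<squnion>\<^bsub>L\<^esub> y) \<sqinter>\<^bsub>L\<^esub> z)"

end

theory Submission
  imports Defs "HOL-Library.Poly_Mapping"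
begin

text \<open>
  Compose \<open>L\<close> with the functors sending an algebra to the disjoint union of its carriers and a set
  to the free abelian group on it, and let the fibre over \<open>X\<close> be the lattice of subgroups of the
  resulting group, with direct and inverse images of subgroups; these lattices are algebraic and
  modular, and (N1) is elementary. The image of \<open>f\<close> is the free group on the set-theoretic image,
  and its kernel is generated by the differences \<open>x - y\<close> with \<open>f x = f y\<close>, so inclusion of images
  and kernels is inclusion of subsets and equivalence relations.

  For monomorphisms, inclusion of images yields a factorization because \<open>L\<close> preserves the pullback
  and reflects isomorphisms; dually, for strong epimorphisms inclusion of kernels yields a
  factorization because \<open>L\<close>, a left adjoint, preserves the pushout. Joins of normal clusters are
  normal because in a finitary variety the kernel of the pushout of two surjections is the transitive
  closure of the union of their kernels.

  Pushouts in a category of models are obtained from the family of all cocones: the pushout is the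
  part of the product of their vertices generated by the two legs, which is small even though the
  product is not.
\<close>

section \<open>Small sets\<close>

text \<open>A form needs one lattice over each object that holds images and kernels together,
  although on elements images are subsets and kernels are equivalence relations. Linearizing turns
  both into subgroups, and among subgroups of abelian groups (N1) and modularity are automatic. No
  information is lost: a free subgroup remembers its generators, and
  \<open>frag_of x - frag_of y\<close> lies in a kernel exactly when \<open>x\<close> and
  \<open>y\<close> are identified. The join of two kernels is their sum, spanned by differences
  along chains of identifications. It matches the kernel of the pushout only if such chains already
  respect the operations, and this is where finite arities enter. In \<open>C\<close> itself nothing
  is computed on elements: it is only equivalent to a category of models with partial operations,
  where an image need not be closed under the operations. So \<open>C\<close> supplies abstract
  factorizations, pullbacks and pushouts, and elements are used only after applying
  \<open>L\<close>; reflection of isomorphisms brings the conclusions back.\<close>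

lemma small_lepoll: "A \<lesssim> B \<Longrightarrow> small U B \<Longrightarrow> small U A"
  unfolding small_def by (rule lesspoll_trans1)

lemma small_subset: "A \<subseteq> B \<Longrightarrow> small U B \<Longrightarrow> small U A"
  by (rule small_lepoll[OF subset_imp_lepoll])

lemma small_image: "small U A \<Longrightarrow> small U (f ` A)"
  by (rule small_lepoll[OF image_lepoll])

lemma small_inj: "inj_on f A \<Longrightarrow> small U (f ` A) \<Longrightarrow> small U A"
  by (rule small_lepoll) (auto simp: lepoll_def)

lemma small_obtain_inj:
  assumes "small TYPE('u) A"
  obtains f :: "'a \<Rightarrow> 'u" where "inj_on f A"
  using assms unfolding small_def lesspoll_def lepoll_def by blast

lemma universe_infinite: "universe TYPE('u) \<Longrightarrow> infinite (UNIV :: 'u set)"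
  unfolding universe_def using infinite_le_lepoll lesspoll_imp_lepoll by blast

lemma small_nat: "universe TYPE('u) \<Longrightarrow> small TYPE('u) (UNIV :: nat set)"
  by (simp add: universe_def small_def)

lemma small_countable: "universe TYPE('u) \<Longrightarrow> countable A \<Longrightarrow> small TYPE('u) A"
  by (metis countableE small_inj small_nat small_subset top_greatest)

lemma small_Pow:
  assumes U: "universe TYPE('u)" and A: "small TYPE('u) A"
  shows "small TYPE('u) (Pow A)"
proof -
  obtain f :: "_ \<Rightarrow> 'u" where f: "inj_on f A" using small_obtain_inj[OF A] .
  have "small TYPE('u) (Pow (f ` A))"
    using U small_image[OF A] unfolding universe_def by blast
  moreover have "Pow (f ` A) = image f ` Pow A"
    by (simp add: image_Pow_surj)
  moreover have "inj_on (image f) (Pow A)" using f by (rule inj_on_image_Pow)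
  ultimately show ?thesis using small_inj by metis
qed

lemma small_UN_universe:
  fixes A :: "'u set" and B :: "'u \<Rightarrow> 'u set"
  shows "universe TYPE('u) \<Longrightarrow> small TYPE('u) A \<Longrightarrow> (\<And>x. x \<in> A \<Longrightarrow> small TYPE('u) (B x)) \<Longrightarrow>
    small TYPE('u) (\<Union>x\<in>A. B x)"
  unfolding universe_def by blast

text \<open>Regularity of the universe speaks only of unions indexed by subsets of \<open>'u\<close>
  with members inside \<open>'u\<close>, so base and fibres are first moved there by injections. The
  pairing bijection \<open>h\<close>, available because \<open>'u\<close> is infinite, keeps the
  images of different fibres apart.\<close>

lemma small_Sigma:
  assumes U: "universe TYPE('u)" and A: "small TYPE('u) A"
    and B: "\<And>x. x \<in> A \<Longrightarrow> small TYPE('u) (B x)"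
  shows "small TYPE('u) (Sigma A B)"
proof -
  obtain f :: "_ \<Rightarrow> 'u" where f: "inj_on f A" using small_obtain_inj[OF A] .
  have "\<forall>x\<in>A. \<exists>g :: _ \<Rightarrow> 'u. inj_on g (B x)" using small_obtain_inj B by metis
  then obtain g :: "_ \<Rightarrow> _ \<Rightarrow> 'u" where g: "\<And>x. x \<in> A \<Longrightarrow> inj_on (g x) (B x)" by metis
  obtain h :: "'u \<times> 'u \<Rightarrow> 'u" where "bij_betw h (UNIV \<times> UNIV) UNIV"
    using card_of_Times_same_infinite[OF universe_infinite[OF U]]
    unfolding card_of_ordIso[symmetric] by blast
  then have h: "inj h" by (simp add: bij_betw_def)
  let ?i = "inv_into A f"
  have "small TYPE('u) (\<Union>y\<in>f ` A. (\<lambda>z. h (y, g (?i y) z)) ` B (?i y))"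
    by (rule small_UN_universe[OF U small_image[OF A]])
      (auto simp: f B small_image inv_into_f_f)
  then show ?thesis
  proof (rule small_lepoll[rotated])
    show "Sigma A B \<lesssim> (\<Union>y\<in>f ` A. (\<lambda>z. h (y, g (?i y) z)) ` B (?i y))"
      unfolding lepoll_def
    proof (intro exI conjI)
      show "inj_on (\<lambda>(x, z). h (f x, g x z)) (Sigma A B)"
      proof (rule inj_onI, clarify)
        fix x z x' z'
        assume *: "x \<in> A" "z \<in> B x" "x' \<in> A" "z' \<in> B x'" "h (f x, g x z) = h (f x', g x' z')"
        then have "f x = f x'" "g x z = g x' z'" using injD[OF h *(5)] by auto
        then show "x = x' \<and> z = z'" using * f g by (auto dest: inj_onD)
      qed
      show "(\<lambda>(x, z). h (f x, g x z)) ` Sigma A B \<subseteq> (\<Union>y\<in>f ` A. (\<lambda>z. h (y, g (?i y) z)) ` B (?i y))"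
        using f by (auto intro!: rev_bexI simp: inv_into_f_f)
    qed
  qed
qed

lemma small_UN:
  assumes "universe TYPE('u)" "small TYPE('u) A" "\<And>x. x \<in> A \<Longrightarrow> small TYPE('u) (B x)"
  shows "small TYPE('u) (\<Union>x\<in>A. B x)"
proof -
  have "small TYPE('u) (snd ` Sigma A B)" by (intro small_image small_Sigma assms)
  then show ?thesis by (simp add: snd_image_Sigma)
qed

lemma small_Times:
  "universe TYPE('u) \<Longrightarrow> small TYPE('u) A \<Longrightarrow> small TYPE('u) B \<Longrightarrow> small TYPE('u) (A \<times> B)"
  by (rule small_Sigma)

lemma small_Un:
  assumes "universe TYPE('u)" "small TYPE('u) A" "small TYPE('u) B"
  shows "small TYPE('u) (A \<union> B)"
proof -
  have "small TYPE('u) (\<Union>b\<in>UNIV. if b then A else B)"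
    by (rule small_UN) (use assms in \<open>auto intro: small_countable\<close>)
  then show ?thesis by (simp add: UNIV_bool Un_commute)
qed

text \<open>Needed for construction trees, whose paths are lists of argument positions.\<close>

lemma small_lists:
  assumes U: "universe TYPE('u)" and A: "small TYPE('u) A"
  shows "small TYPE('u) (lists A)"
proof -
  have "small TYPE('u) {xs \<in> lists A. length xs = n}" for n
  proof (induction n)
    case 0
    show ?case by (rule small_subset[of _ "{[]}"]) (auto simp: small_countable[OF U])
  next
    case (Suc n)
    show ?case
      by (rule small_subset[OF _ small_image[OF small_Times[OF U A Suc], of "\<lambda>(x, xs). x # xs"]])
        (force simp: length_Suc_conv)
  qed
  then have "small TYPE('u) (\<Union>n. {xs \<in> lists A. length xs = n})"
    by (intro small_UN U small_nat)
  then show ?thesis by (rule small_subset[rotated]) blast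
qed


section \<open>Categories, equivalences and adjunctions\<close>

locale category_on =
  fixes C :: "('o, 'm) cat"
  assumes category: "category C"
begin

lemma Dom_Obj [simp]: "f \<in> Arr C \<Longrightarrow> Dom C f \<in> Obj C"
  and Cod_Obj [simp]: "f \<in> Arr C \<Longrightarrow> Cod C f \<in> Obj C"
  and Idn_Arr [simp]: "X \<in> Obj C \<Longrightarrow> Idn C X \<in> Arr C"
  and Dom_Idn [simp]: "X \<in> Obj C \<Longrightarrow> Dom C (Idn C X) = X"
  and Cod_Idn [simp]: "X \<in> Obj C \<Longrightarrow> Cod C (Idn C X) = X"
  and Comp_Arr [simp]: "f \<in> Arr C \<Longrightarrow> g \<in> Arr C \<Longrightarrow> Cod C f = Dom C g \<Longrightarrow> Comp C g f \<in> Arr C"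
  and Dom_Comp [simp]: "f \<in> Arr C \<Longrightarrow> g \<in> Arr C \<Longrightarrow> Cod C f = Dom C g \<Longrightarrow> Dom C (Comp C g f) = Dom C f"
  and Cod_Comp [simp]: "f \<in> Arr C \<Longrightarrow> g \<in> Arr C \<Longrightarrow> Cod C f = Dom C g \<Longrightarrow> Cod C (Comp C g f) = Cod C g"
  and Comp_Idn [simp]: "f \<in> Arr C \<Longrightarrow> X = Dom C f \<Longrightarrow> Comp C f (Idn C X) = f"
  and Idn_Comp [simp]: "f \<in> Arr C \<Longrightarrow> X = Cod C f \<Longrightarrow> Comp C (Idn C X) f = f"
  using category by (auto simp: category_def Hom_def)

lemma Comp_assoc:
  "f \<in> Arr C \<Longrightarrow> g \<in> Arr C \<Longrightarrow> h \<in> Arr C \<Longrightarrow> Cod C f = Dom C g \<Longrightarrow> Cod C g = Dom C h \<Longrightarrow>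
    Comp C (Comp C h g) f = Comp C h (Comp C g f)"
  using category by (auto simp: category_def)

lemma is_isoE:
  assumes "is_iso C f"
  obtains g where "g \<in> Arr C" "Dom C g = Cod C f" "Cod C g = Dom C f"
    "Comp C g f = Idn C (Dom C f)" "Comp C f g = Idn C (Cod C f)" "f \<in> Arr C"
  using assms by (auto simp: is_iso_def Hom_def)

lemma is_isoI:
  "f \<in> Arr C \<Longrightarrow> g \<in> Arr C \<Longrightarrow> Dom C g = Cod C f \<Longrightarrow> Cod C g = Dom C f \<Longrightarrow>
    Comp C g f = Idn C (Dom C f) \<Longrightarrow> Comp C f g = Idn C (Cod C f) \<Longrightarrow> is_iso C f"
  by (auto simp: is_iso_def Hom_def)

lemma mono_cancel:
  "is_mono C m \<Longrightarrow> Comp C m f = Comp C m g \<Longrightarrow> f \<in> Arr C \<Longrightarrow> g \<in> Arr C \<Longrightarrow> Dom C f = Dom C g \<Longrightarrow>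
    Cod C f = Dom C m \<Longrightarrow> Cod C g = Dom C m \<Longrightarrow> f = g"
  by (auto simp: is_mono_def)

lemma epi_cancel:
  "is_epi C e \<Longrightarrow> Comp C f e = Comp C g e \<Longrightarrow> f \<in> Arr C \<Longrightarrow> g \<in> Arr C \<Longrightarrow> Cod C f = Cod C g \<Longrightarrow>
    Dom C f = Cod C e \<Longrightarrow> Dom C g = Cod C e \<Longrightarrow> f = g"
  by (auto simp: is_epi_def)

lemma is_mono_Arr: "is_mono C m \<Longrightarrow> m \<in> Arr C"
  and is_epi_Arr: "is_epi C m \<Longrightarrow> m \<in> Arr C"
  by (auto simp: is_mono_def is_epi_def)

lemma mono_cancel_iff:
  "is_mono C m \<Longrightarrow> f \<in> Arr C \<Longrightarrow> g \<in> Arr C \<Longrightarrow> Dom C f = Dom C g \<Longrightarrow>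
    Cod C f = Dom C m \<Longrightarrow> Cod C g = Dom C m \<Longrightarrow> Comp C m f = Comp C m g \<longleftrightarrow> f = g"
  using mono_cancel by blast

section \<open>Monomorphisms, epimorphisms and strong epimorphisms\<close>

lemma iso_mono: assumes "is_iso C i" shows "is_mono C i"
proof -
  obtain j where j: "j \<in> Arr C" "Dom C j = Cod C i" "Cod C j = Dom C i" "Comp C j i = Idn C (Dom C i)" "i \<in> Arr C"
    using assms by (rule is_isoE)
  show ?thesis
    unfolding is_mono_def
  proof (intro conjI ballI impI; (elim conjE)?)
    fix f g assume "f \<in> Arr C" "g \<in> Arr C" "Dom C f = Dom C g" "Cod C f = Dom C i" "Cod C g = Dom C i"
      "Comp C i f = Comp C i g"
    then show "f = g" using j by (metis Comp_assoc Idn_Comp)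
  qed (use j in simp)
qed

lemma iso_epi: assumes "is_iso C i" shows "is_epi C i"
proof -
  obtain j where j: "j \<in> Arr C" "Dom C j = Cod C i" "Cod C j = Dom C i" "Comp C i j = Idn C (Cod C i)" "i \<in> Arr C"
    using assms by (rule is_isoE)
  show ?thesis
    unfolding is_epi_def
  proof (intro conjI ballI impI; (elim conjE)?)
    fix f g assume "f \<in> Arr C" "g \<in> Arr C" "Cod C f = Cod C g" "Dom C f = Cod C i" "Dom C g = Cod C i"
      "Comp C f i = Comp C g i"
    then show "f = g" using j by (metis Comp_assoc Comp_Idn)
  qed (use j in simp)
qed

lemma mono_Comp:
  assumes "is_mono C m" "is_mono C n" "Cod C n = Dom C m"
  shows "is_mono C (Comp C m n)"
  unfolding is_mono_def
proof (intro conjI ballI impI; (elim conjE)?)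
  have A: "m \<in> Arr C" "n \<in> Arr C" using assms is_mono_Arr by auto
  then show "Comp C m n \<in> Arr C" using assms by simp
  fix f g assume "f \<in> Arr C" "g \<in> Arr C" "Dom C f = Dom C g" "Cod C f = Dom C (Comp C m n)"
    "Cod C g = Dom C (Comp C m n)" "Comp C (Comp C m n) f = Comp C (Comp C m n) g"
  with A assms show "f = g" by (simp add: Comp_assoc mono_cancel_iff)
qed

lemma epi_Comp:
  assumes "is_epi C e" "is_epi C d" "Cod C d = Dom C e"
  shows "is_epi C (Comp C e d)"
  unfolding is_epi_def
proof (intro conjI ballI impI; (elim conjE)?)
  have A: "e \<in> Arr C" "d \<in> Arr C" using assms is_epi_Arr by auto
  then show "Comp C e d \<in> Arr C" using assms by simp
  fix f g assume B: "f \<in> Arr C" "g \<in> Arr C" "Cod C f = Cod C g" "Dom C f = Cod C (Comp C e d)"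
    "Dom C g = Cod C (Comp C e d)" "Comp C f (Comp C e d) = Comp C g (Comp C e d)"
  then have "Comp C (Comp C f e) d = Comp C (Comp C g e) d" using A assms by (simp add: Comp_assoc)
  then have "Comp C f e = Comp C g e" using A B assms by - (rule epi_cancel[OF assms(2)], auto)
  then show "f = g" using A B assms by - (rule epi_cancel[OF assms(1)], auto)
qed

text \<open>Uniqueness of the diagonal is free once \<open>e\<close> is epi, so only its existence
  remains as a premise.\<close>

lemma orthogonalI:
  assumes "is_epi C e" "m \<in> Arr C"
    and "\<And>u v. u \<in> Arr C \<Longrightarrow> v \<in> Arr C \<Longrightarrow> Dom C u = Dom C e \<Longrightarrow> Cod C u = Dom C m \<Longrightarrow>
      Dom C v = Cod C e \<Longrightarrow> Cod C v = Cod C m \<Longrightarrow> Comp C m u = Comp C v e \<Longrightarrow>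
      \<exists>d\<in>Arr C. Dom C d = Cod C e \<and> Cod C d = Dom C m \<and> Comp C d e = u \<and> Comp C m d = v"
  shows "orthogonal C e m"
  unfolding orthogonal_def
proof (intro ballI impI)
  fix u v assume uv: "u \<in> Hom C (Dom C e) (Dom C m)" "v \<in> Hom C (Cod C e) (Cod C m)" "Comp C m u = Comp C v e"
  have "\<exists>d\<in>Arr C. Dom C d = Cod C e \<and> Cod C d = Dom C m \<and> Comp C d e = u \<and> Comp C m d = v"
    by (rule assms(3)) (use uv in \<open>auto simp: Hom_def\<close>)
  then obtain d where d: "d \<in> Arr C" "Dom C d = Cod C e" "Cod C d = Dom C m" "Comp C d e = u" "Comp C m d = v"
    by blast
  show "\<exists>!d. d \<in> Hom C (Cod C e) (Dom C m) \<and> Comp C d e = u \<and> Comp C m d = v"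
  proof (rule ex1I[of _ d])
    show "d \<in> Hom C (Cod C e) (Dom C m) \<and> Comp C d e = u \<and> Comp C m d = v"
      using d by (simp add: Hom_def)
    fix d' assume d': "d' \<in> Hom C (Cod C e) (Dom C m) \<and> Comp C d' e = u \<and> Comp C m d' = v"
    show "d' = d" by (rule epi_cancel[OF assms(1)]) (use d d' in \<open>auto simp: Hom_def\<close>)
  qed
qed

lemma orthogonalE:
  assumes "orthogonal C e m" "u \<in> Arr C" "v \<in> Arr C" "Dom C u = Dom C e" "Cod C u = Dom C m"
    "Dom C v = Cod C e" "Cod C v = Cod C m" "Comp C m u = Comp C v e"
  obtains d where "d \<in> Arr C" "Dom C d = Cod C e" "Cod C d = Dom C m" "Comp C d e = u" "Comp C m d = v"
  using assms unfolding orthogonal_def Hom_def by fast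

lemma strong_epis_epi: "e \<in> strong_epis C \<Longrightarrow> is_epi C e"
  and strong_epis_orthogonal: "e \<in> strong_epis C \<Longrightarrow> is_mono C m \<Longrightarrow> orthogonal C e m"
  and strong_epis_Arr: "e \<in> strong_epis C \<Longrightarrow> e \<in> Arr C"
  by (auto simp: strong_epis_def mono_arrs_def is_epi_def)

lemma iso_strong_epi:
  assumes "is_iso C i" shows "i \<in> strong_epis C"
proof -
  obtain j where j: "j \<in> Arr C" "Dom C j = Cod C i" "Cod C j = Dom C i" "Comp C j i = Idn C (Dom C i)"
     "Comp C i j = Idn C (Cod C i)" "i \<in> Arr C"
    using assms by (rule is_isoE)
  have "orthogonal C i m" if m: "is_mono C m" for m
  proof (rule orthogonalI)
    show "is_epi C i" "m \<in> Arr C" using assms iso_epi m is_mono_Arr by auto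
    fix u v assume uv: "u \<in> Arr C" "v \<in> Arr C" "Dom C u = Dom C i" "Cod C u = Dom C m"
      "Dom C v = Cod C i" "Cod C v = Cod C m" "Comp C m u = Comp C v i"
    have "Comp C (Comp C u j) i = u" using uv j by (simp add: Comp_assoc)
    moreover have "Comp C m (Comp C u j) = v"
      using uv j \<open>m \<in> Arr C\<close> by (simp add: Comp_assoc[symmetric]) (simp add: Comp_assoc)
    ultimately show "\<exists>d\<in>Arr C. Dom C d = Cod C i \<and> Cod C d = Dom C m \<and> Comp C d i = u \<and> Comp C m d = v"
      using uv j by (intro bexI[of _ "Comp C u j"]) auto
  qed
  then show ?thesis using iso_epi[OF assms] by (auto simp: strong_epis_def mono_arrs_def)
qed

lemma strong_epis_Comp:
  assumes e: "e \<in> strong_epis C" and d: "d \<in> strong_epis C" and c: "Cod C d = Dom C e"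
  shows "Comp C e d \<in> strong_epis C"
proof -
  note A = e[THEN strong_epis_Arr] d[THEN strong_epis_Arr] c
  have epi: "is_epi C (Comp C e d)" using assms strong_epis_epi by (intro epi_Comp)
  have "orthogonal C (Comp C e d) m" if m: "is_mono C m" for m
  proof (rule orthogonalI[OF epi is_mono_Arr[OF m]])
    fix u v assume uv: "u \<in> Arr C" "v \<in> Arr C" "Dom C u = Dom C (Comp C e d)" "Cod C u = Dom C m"
      "Dom C v = Cod C (Comp C e d)" "Cod C v = Cod C m" "Comp C m u = Comp C v (Comp C e d)"
    obtain s where s: "s \<in> Arr C" "Dom C s = Cod C d" "Cod C s = Dom C m" "Comp C s d = u" "Comp C m s = Comp C v e"
      by (rule orthogonalE[OF strong_epis_orthogonal[OF d m], of u "Comp C v e"])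
        (use A uv in \<open>auto simp: Comp_assoc\<close>)
    obtain t where t: "t \<in> Arr C" "Dom C t = Cod C e" "Cod C t = Dom C m" "Comp C t e = s" "Comp C m t = v"
      by (rule orthogonalE[OF strong_epis_orthogonal[OF e m], of s v])
        (use A uv s in auto)
    have "Comp C t (Comp C e d) = u" using s t A by (simp add: Comp_assoc[symmetric])
    then show "\<exists>d'\<in>Arr C. Dom C d' = Cod C (Comp C e d) \<and> Cod C d' = Dom C m \<and>
        Comp C d' (Comp C e d) = u \<and> Comp C m d' = v"
      using t A by auto
  qed
  then show ?thesis using epi by (auto simp: strong_epis_def mono_arrs_def)
qed

text \<open>In any category these two classes satisfy every axiom except the existence of
  factorizations, which is therefore the only premise.\<close>

lemma strong_epi_mono_proper:
  assumes "\<And>f. f \<in> Arr C \<Longrightarrow> \<exists>e\<in>strong_epis C. \<exists>m\<in>mono_arrs C. Cod C e = Dom C m \<and> f = Comp C m e"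
  shows "proper_factorization_system C (strong_epis C) (mono_arrs C)"
  unfolding proper_factorization_system_def
  using assms iso_strong_epi iso_mono strong_epis_Comp mono_Comp strong_epis_epi
  by (auto simp: mono_arrs_def strong_epis_orthogonal)

section \<open>Universal properties of pullbacks and pushouts\<close>

lemma is_pullbackE:
  assumes "is_pullback C f g p q" "a \<in> Arr C" "b \<in> Arr C" "Dom C a = Dom C b"
    "Cod C a = Dom C f" "Cod C b = Dom C g" "Comp C f a = Comp C g b"
  obtains h where "h \<in> Arr C" "Dom C h = Dom C a" "Cod C h = Dom C p" "Comp C p h = a" "Comp C q h = b"
  using assms unfolding is_pullback_def Hom_def by fast

text \<open>The projections are jointly monic because \<open>h\<close> and \<open>k\<close> both
  mediate the cone with legs \<open>Comp C p k\<close> and \<open>Comp C q k\<close>.\<close>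

lemma is_pullback_unique:
  assumes pb: "is_pullback C f g p q" and hk: "h \<in> Arr C" "k \<in> Arr C" "Dom C h = Dom C k"
    "Cod C h = Dom C p" "Cod C k = Dom C p" "Comp C p h = Comp C p k" "Comp C q h = Comp C q k"
  shows "h = k"
proof -
  have A: "f \<in> Arr C" "g \<in> Arr C" "Cod C f = Cod C g" "p \<in> Arr C" "q \<in> Arr C" "Dom C p = Dom C q"
    "Cod C p = Dom C f" "Cod C q = Dom C g" "Comp C f p = Comp C g q"
    using pb by (auto simp: is_pullback_def)
  have "Comp C f (Comp C p k) = Comp C g (Comp C q k)"
    using A hk by (simp flip: Comp_assoc)
  moreover have "Comp C p k \<in> Arr C" "Comp C q k \<in> Arr C" using A hk by auto
  ultimately have "\<exists>!h. h \<in> Hom C (Dom C (Comp C p k)) (Dom C p) \<and> Comp C p h = Comp C p k \<and> Comp C q h = Comp C q k"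
    using pb A hk unfolding is_pullback_def
    by (elim conjE) (drule bspec[of _ _ "Comp C p k"], assumption, drule bspec[of _ _ "Comp C q k"], simp_all)
  then show ?thesis using A hk by (auto simp: Hom_def)
qed

lemma is_pushoutE:
  assumes "is_pushout C f g p q" "a \<in> Arr C" "b \<in> Arr C" "Cod C a = Cod C b"
    "Dom C a = Cod C f" "Dom C b = Cod C g" "Comp C a f = Comp C b g"
  obtains h where "h \<in> Arr C" "Dom C h = Cod C p" "Cod C h = Cod C a" "Comp C h p = a" "Comp C h q = b"
  using assms unfolding is_pushout_def Hom_def by fast

end

section \<open>Duality through the opposite category\<close>

definition op_cat :: "('o, 'm) cat \<Rightarrow> ('o, 'm) cat" where
  "op_cat C = \<lparr>Obj = Obj C, Arr = Arr C, Dom = Cod C, Cod = Dom C, Idn = Idn C, Comp = (\<lambda>g f. Comp C f g)\<rparr>"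

lemma op_cat_sel [simp]:
  "Obj (op_cat C) = Obj C" "Arr (op_cat C) = Arr C" "Dom (op_cat C) = Cod C" "Cod (op_cat C) = Dom C"
  "Idn (op_cat C) = Idn C" "Comp (op_cat C) g f = Comp C f g" "Hom (op_cat C) X Y = Hom C Y X"
  by (auto simp: op_cat_def Hom_def)

lemma category_op_cat: assumes "category C" shows "category (op_cat C)"
proof -
  interpret category_on C using assms by unfold_locales
  show ?thesis unfolding category_def by (auto simp: Hom_def Comp_assoc)
qed

lemma (in category_on) pullback_of_mono:
  assumes m: "is_mono C m" and pb: "is_pullback C m n p q" shows "is_mono C q"
  unfolding is_mono_def
proof (intro conjI ballI impI; (elim conjE)?)
  have A: "m \<in> Arr C" "n \<in> Arr C" "Cod C m = Cod C n" "p \<in> Arr C" "q \<in> Arr C" "Dom C p = Dom C q"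
    "Cod C p = Dom C m" "Cod C q = Dom C n" "Comp C m p = Comp C n q"
    using pb by (auto simp: is_pullback_def)
  then show "q \<in> Arr C" by simp
  fix f g assume fg: "f \<in> Arr C" "g \<in> Arr C" "Dom C f = Dom C g" "Cod C f = Dom C q" "Cod C g = Dom C q"
    "Comp C q f = Comp C q g"
  have "Comp C m (Comp C p h) = Comp C n (Comp C q h)" if "h \<in> Arr C" "Cod C h = Dom C q" for h
    using that A by (simp flip: Comp_assoc)
  then have "Comp C m (Comp C p f) = Comp C m (Comp C p g)" using fg by simp
  then have "Comp C p f = Comp C p g"
    by (rule mono_cancel[OF m]) (use A(3-8) fg(1-5) in simp_all)
  then show "f = g"
    by (intro is_pullback_unique[OF pb, of f g]) (use A(6) fg in simp_all)
qed

lemma is_pullback_op_cat: "is_pullback (op_cat C) f g p q \<longleftrightarrow> is_pushout C f g p q"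
  by (simp add: is_pullback_def is_pushout_def)

lemma (in category_on) is_pushout_unique:
  assumes "is_pushout C f g p q" "h \<in> Arr C" "k \<in> Arr C" "Cod C h = Cod C k"
    "Dom C h = Cod C p" "Dom C k = Cod C p" "Comp C h p = Comp C k p" "Comp C h q = Comp C k q"
  shows "h = k"
proof -
  interpret op: category_on "op_cat C" using category_op_cat[OF category] by unfold_locales
  show ?thesis
    by (rule op.is_pullback_unique[of f g p q]) (use assms in \<open>auto simp: is_pullback_op_cat\<close>)
qed

lemma is_iso_op_cat: "is_iso (op_cat C) f \<longleftrightarrow> is_iso C f"
  by (auto simp: is_iso_def)

lemma is_mono_op_cat: "is_mono (op_cat C) f \<longleftrightarrow> is_epi C f"
  by (auto simp: is_mono_def is_epi_def)

lemma is_functor_op_cat: "is_functor C D F \<Longrightarrow> is_functor (op_cat C) (op_cat D) F"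
  by (auto simp: is_functor_def Hom_def)


section \<open>Functors and equivalences of categories\<close>

locale functor_on = C: category_on C + D: category_on D
  for C :: "('o, 'm) cat" and D :: "('p, 'n) cat" +
  fixes F :: "('o, 'm, 'p, 'n) functr"
  assumes functorial: "is_functor C D F"
begin

lemma FObj_Obj [simp]: "X \<in> Obj C \<Longrightarrow> FObj F X \<in> Obj D"
  and FArr_Arr [simp]: "f \<in> Arr C \<Longrightarrow> FArr F f \<in> Arr D"
  and Dom_FArr [simp]: "f \<in> Arr C \<Longrightarrow> Dom D (FArr F f) = FObj F (Dom C f)"
  and Cod_FArr [simp]: "f \<in> Arr C \<Longrightarrow> Cod D (FArr F f) = FObj F (Cod C f)"
  and FArr_Idn [simp]: "X \<in> Obj C \<Longrightarrow> FArr F (Idn C X) = Idn D (FObj F X)"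
  and FArr_Comp [simp]: "f \<in> Arr C \<Longrightarrow> g \<in> Arr C \<Longrightarrow> Cod C f = Dom C g \<Longrightarrow>
    FArr F (Comp C g f) = Comp D (FArr F g) (FArr F f)"
  using functorial by (auto simp: is_functor_def Hom_def)

end


locale equivalence_on = functor_on +
  assumes equivalence: "is_equivalence C D F"
begin

lemma full:
  assumes "X \<in> Obj C" "Y \<in> Obj C" "g \<in> Arr D" "Dom D g = FObj F X" "Cod D g = FObj F Y"
  obtains f where "f \<in> Arr C" "Dom C f = X" "Cod C f = Y" "FArr F f = g"
proof -
  have "bij_betw (FArr F) (Hom C X Y) (Hom D (FObj F X) (FObj F Y))"
    using equivalence assms by (auto simp: is_equivalence_def)
  then have "g \<in> FArr F ` Hom C X Y" using assms by (auto simp: bij_betw_def Hom_def)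
  then show ?thesis using that by (auto simp: Hom_def)
qed

lemma faithful:
  assumes "f \<in> Arr C" "g \<in> Arr C" "Dom C f = Dom C g" "Cod C f = Cod C g" "FArr F f = FArr F g"
  shows "f = g"
proof -
  have "bij_betw (FArr F) (Hom C (Dom C f) (Cod C f)) (Hom D (FObj F (Dom C f)) (FObj F (Cod C f)))"
    using equivalence assms by (auto simp: is_equivalence_def)
  then have "inj_on (FArr F) (Hom C (Dom C f) (Cod C f))" by (rule bij_betw_imp_inj_on)
  then show ?thesis using assms by (auto simp: inj_on_def Hom_def)
qed

lemma essentially_surjective:
  assumes "Z \<in> Obj D"
  obtains X i j where "X \<in> Obj C" "i \<in> Arr D" "Dom D i = FObj F X" "Cod D i = Z"
    "j \<in> Arr D" "Dom D j = Z" "Cod D j = FObj F X"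
    "Comp D j i = Idn D (FObj F X)" "Comp D i j = Idn D Z" "is_iso D i" "is_iso D j"
proof -
  obtain X i where X: "X \<in> Obj C" "i \<in> Arr D" "Dom D i = FObj F X" "Cod D i = Z" and i: "is_iso D i"
    using equivalence assms unfolding is_equivalence_def Hom_def by blast
  obtain j where j: "j \<in> Arr D" "Dom D j = Z" "Cod D j = FObj F X"
    "Comp D j i = Idn D (FObj F X)" "Comp D i j = Idn D Z"
    using i by (rule D.is_isoE) (simp add: X)
  have "is_iso D j" using X j by (intro D.is_isoI[of _ i]) auto
  then show thesis using that X i j by blast
qed

text \<open>Only essential surjectivity changes under duality: it then asks for an isomorphism in
  the other direction, which is why the inverse \<open>j\<close> is provided along with
  \<open>i\<close>.\<close>

lemma equivalence_op_cat: "equivalence_on (op_cat C) (op_cat D) F"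
proof
  show "category (op_cat C)" "category (op_cat D)"
    using C.category D.category category_op_cat by auto
  show F: "is_functor (op_cat C) (op_cat D) F" using functorial by (rule is_functor_op_cat)
  have "\<exists>X\<in>Obj C. \<exists>i\<in>Hom D Z (FObj F X). is_iso D i" if "Z \<in> Obj D" for Z
    using that by (rule essentially_surjective) (auto simp: Hom_def)
  then show "is_equivalence (op_cat C) (op_cat D) F"
    using F equivalence by (simp add: is_equivalence_def is_iso_op_cat)
qed

text \<open>Test arrows in \<open>D\<close> start at arbitrary objects. Precomposing with an
  isomorphism from an object \<open>FObj F X\<close> makes them liftable by fullness, and
  isomorphisms, being epi, can be cancelled afterwards.\<close>

lemma preserves_mono:
  assumes m: "is_mono C m" shows "is_mono D (FArr F m)"
  unfolding is_mono_def
proof (intro conjI ballI impI; (elim conjE)?)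
  have mA: "m \<in> Arr C" using m C.is_mono_Arr by auto
  then show "FArr F m \<in> Arr D" by simp
  fix f g assume fg: "f \<in> Arr D" "g \<in> Arr D" "Dom D f = Dom D g" "Cod D f = Dom D (FArr F m)"
    "Cod D g = Dom D (FArr F m)" "Comp D (FArr F m) f = Comp D (FArr F m) g"
  obtain X i j where X: "X \<in> Obj C" "i \<in> Arr D" "Dom D i = FObj F X" "Cod D i = Dom D f" "is_iso D i"
    by (rule essentially_surjective[of "Dom D f"]) (use fg(1) in auto)
  obtain f' where f': "f' \<in> Arr C" "Dom C f' = X" "Cod C f' = Dom C m" "FArr F f' = Comp D f i"
    by (rule full[of X "Dom C m" "Comp D f i"]) (use X fg mA in auto)
  obtain g' where g': "g' \<in> Arr C" "Dom C g' = X" "Cod C g' = Dom C m" "FArr F g' = Comp D g i"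
    by (rule full[of X "Dom C m" "Comp D g i"]) (use X fg mA in auto)
  have "Comp C m f' = Comp C m g'"
    by (rule faithful) (use f' g' mA X fg in \<open>auto simp flip: D.Comp_assoc\<close>)
  then have "f' = g'" by (rule C.mono_cancel[OF m]) (use f' g' in auto)
  then have "Comp D f i = Comp D g i" using f' g' by auto
  then show "f = g" by (rule D.epi_cancel[OF D.iso_epi[OF X(5)]]) (use X fg in auto)
qed

lemma reflects_mono:
  assumes "m \<in> Arr C" "is_mono D (FArr F m)" shows "is_mono C m"
  unfolding is_mono_def
proof (intro conjI ballI impI; (elim conjE)?)
  fix f g assume fg: "f \<in> Arr C" "g \<in> Arr C" "Dom C f = Dom C g" "Cod C f = Dom C m"
    "Cod C g = Dom C m" "Comp C m f = Comp C m g"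
  then have "FArr F f = FArr F g"
    using assms by - (rule D.mono_cancel[OF assms(2)], auto simp flip: FArr_Comp)
  then show "f = g" using fg by - (rule faithful, auto)
qed (use assms in simp)

lemma reflects_epi: "e \<in> Arr C \<Longrightarrow> is_epi D (FArr F e) \<Longrightarrow> is_epi C e"
  using equivalence_on.reflects_mono[OF equivalence_op_cat] by (simp add: is_mono_op_cat)

lemma reflects_strong_epi:
  assumes e: "e \<in> Arr C" "FArr F e \<in> strong_epis D" shows "e \<in> strong_epis C"
proof -
  have epi: "is_epi C e" using assms D.strong_epis_epi reflects_epi by blast
  have "orthogonal C e m" if m: "is_mono C m" for m
  proof (rule C.orthogonalI[OF epi C.is_mono_Arr[OF m]])
    fix u v assume uv: "u \<in> Arr C" "v \<in> Arr C" "Dom C u = Dom C e" "Cod C u = Dom C m"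
      "Dom C v = Cod C e" "Cod C v = Cod C m" "Comp C m u = Comp C v e"
    have mA: "m \<in> Arr C" using m C.is_mono_Arr by auto
    obtain d where d: "d \<in> Arr D" "Dom D d = Cod D (FArr F e)" "Cod D d = Dom D (FArr F m)"
      "Comp D d (FArr F e) = FArr F u" "Comp D (FArr F m) d = FArr F v"
      by (rule D.orthogonalE[OF D.strong_epis_orthogonal[OF e(2) preserves_mono[OF m]], of "FArr F u" "FArr F v"])
        (use uv e mA in \<open>auto simp flip: FArr_Comp\<close>)
    obtain d' where d': "d' \<in> Arr C" "Dom C d' = Cod C e" "Cod C d' = Dom C m" "FArr F d' = d"
      by (rule full[of "Cod C e" "Dom C m" d]) (use d e mA in auto)
    have "Comp C d' e = u" "Comp C m d' = v"
      by (rule faithful; use d d' e mA uv in simp)+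
    then show "\<exists>d\<in>Arr C. Dom C d = Cod C e \<and> Cod C d = Dom C m \<and> Comp C d e = u \<and> Comp C m d = v"
      using d' by auto
  qed
  then show ?thesis using epi by (auto simp: strong_epis_def mono_arrs_def)
qed

text \<open>The middle object of a factorization in \<open>D\<close> is only isomorphic to some
  \<open>FObj F X\<close>. The isomorphism is absorbed into the two factors, which become
  \<open>Comp D j e\<close> and \<open>Comp D m i\<close> and stay in their classes.\<close>

lemma reflects_factorization:
  assumes D: "\<And>f. f \<in> Arr D \<Longrightarrow> \<exists>e\<in>strong_epis D. \<exists>m\<in>mono_arrs D. Cod D e = Dom D m \<and> f = Comp D m e"
    and f: "f \<in> Arr C"
  shows "\<exists>e\<in>strong_epis C. \<exists>m\<in>mono_arrs C. Cod C e = Dom C m \<and> f = Comp C m e"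
proof -
  obtain e m where e: "e \<in> strong_epis D" and m: "is_mono D m" and em: "Cod D e = Dom D m" "FArr F f = Comp D m e"
    using D[of "FArr F f"] f by (auto simp: mono_arrs_def)
  have A: "e \<in> Arr D" "m \<in> Arr D" using e m D.strong_epis_Arr D.is_mono_Arr by auto
  then have "Dom D (FArr F f) = Dom D e" "Cod D (FArr F f) = Cod D m" using em by simp_all
  then have B: "Dom D e = FObj F (Dom C f)" "Cod D m = FObj F (Cod C f)" using f by auto
  obtain X i j where X: "X \<in> Obj C" "i \<in> Arr D" "Dom D i = FObj F X" "Cod D i = Dom D m"
    "j \<in> Arr D" "Dom D j = Dom D m" "Cod D j = FObj F X"
    "Comp D i j = Idn D (Dom D m)" "is_iso D i" "is_iso D j"
    by (rule essentially_surjective[of "Dom D m"]) (use A in auto)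
  obtain e' where e': "e' \<in> Arr C" "Dom C e' = Dom C f" "Cod C e' = X" "FArr F e' = Comp D j e"
    by (rule full[of "Dom C f" X "Comp D j e"]) (use A B X f em in auto)
  obtain m' where m': "m' \<in> Arr C" "Dom C m' = X" "Cod C m' = Cod C f" "FArr F m' = Comp D m i"
    by (rule full[of X "Cod C f" "Comp D m i"]) (use A B X f em in auto)
  have "Comp D (Comp D m i) (Comp D j e) = Comp D m (Comp D (Comp D i j) e)"
    using A X(2-7) em by (simp add: D.Comp_assoc)
  then have "Comp D (Comp D m i) (Comp D j e) = FArr F f" using A X em by simp
  then have "f = Comp C m' e'"
    by - (rule faithful, use e' m' f in auto)
  moreover have "e' \<in> strong_epis C"
    by (rule reflects_strong_epi)
      (use e' D.strong_epis_Comp[OF D.iso_strong_epi[OF X(10)] e] X(6) em in simp_all)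
  moreover have "is_mono C m'"
    by (rule reflects_mono) (use m' D.mono_Comp[OF m D.iso_mono[OF X(9)]] X(4) in simp_all)
  ultimately show ?thesis
    using e'(3) m'(2) by (intro bexI[of _ e'] bexI[of _ m']) (simp_all add: mono_arrs_def)
qed

text \<open>As for factorizations, the vertex is replaced by an isomorphic object in the image of
  \<open>F\<close>. Mediating arrows are then lifted by fullness; their uniqueness follows from the
  one in \<open>D\<close>, since \<open>i\<close> is mono and \<open>F\<close> is faithful.\<close>

lemma reflects_pullbacks:
  assumes fg: "f \<in> Arr C" "g \<in> Arr C" "Cod C f = Cod C g" and pb: "is_pullback D (FArr F f) (FArr F g) p q"
  shows "\<exists>p q. is_pullback C f g p q"
proof -
  have pq: "p \<in> Arr D" "q \<in> Arr D" "Dom D p = Dom D q" "Cod D p = FObj F (Dom C f)" "Cod D q = FObj F (Dom C g)"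
    "Comp D (FArr F f) p = Comp D (FArr F g) q"
    using pb fg by (auto simp: is_pullback_def)
  obtain X i j where X: "X \<in> Obj C" "i \<in> Arr D" "Dom D i = FObj F X" "Cod D i = Dom D p"
    "j \<in> Arr D" "Dom D j = Dom D p" "Cod D j = FObj F X"
    "Comp D i j = Idn D (Dom D p)" "is_iso D i"
    by (rule essentially_surjective[of "Dom D p"]) (use pq(1) in auto)
  obtain p' where p': "p' \<in> Arr C" "Dom C p' = X" "Cod C p' = Dom C f" "FArr F p' = Comp D p i"
    by (rule full[of X "Dom C f" "Comp D p i"]) (use X pq fg in auto)
  obtain q' where q': "q' \<in> Arr C" "Dom C q' = X" "Cod C q' = Dom C g" "FArr F q' = Comp D q i"
    by (rule full[of X "Dom C g" "Comp D q i"]) (use X pq fg in auto)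
  have comm: "Comp C f p' = Comp C g q'"
    by (rule faithful) (use p' q' X pq fg in \<open>auto simp flip: D.Comp_assoc\<close>)
  have "is_pullback C f g p' q'"
    unfolding is_pullback_def
  proof (intro conjI ballI impI; (elim conjE)?)
    fix a b assume ab: "a \<in> Arr C" "b \<in> Arr C" "Dom C a = Dom C b" "Cod C a = Dom C f" "Cod C b = Dom C g"
      "Comp C f a = Comp C g b"
    let ?P = "\<lambda>h. h \<in> Hom C (Dom C a) (Dom C p') \<and> Comp C p' h = a \<and> Comp C q' h = b"
    obtain h where h: "h \<in> Arr D" "Dom D h = FObj F (Dom C a)" "Cod D h = Dom D p" "Comp D p h = FArr F a" "Comp D q h = FArr F b"
      by (rule D.is_pullbackE[OF pb, of "FArr F a" "FArr F b"]) (use ab fg in \<open>auto simp flip: FArr_Comp\<close>)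
    obtain h' where h': "h' \<in> Arr C" "Dom C h' = Dom C a" "Cod C h' = X" "FArr F h' = Comp D j h"
      by (rule full[of "Dom C a" X "Comp D j h"]) (use X ab h in auto)
    have "Comp D i (FArr F h') = h"
      using X h h' by (simp add: D.Comp_assoc[symmetric])
    then have "FArr F (Comp C p' h') = FArr F a" "FArr F (Comp C q' h') = FArr F b"
      using p' q' h' h X pq by (auto simp: D.Comp_assoc)
    then have "Comp C p' h' = a" "Comp C q' h' = b"
      using p' q' h' ab by - (rule faithful; simp)+
    then have 1: "?P h'" using h' p' by (simp add: Hom_def)
    have "k = h'" if k: "?P k" for k
    proof -
      have kA: "k \<in> Arr C" "Dom C k = Dom C a" "Cod C k = X" "Comp C p' k = a" "Comp C q' k = b"
        using k p' by (auto simp: Hom_def)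
      have "Comp D p (Comp D i (FArr F k)) = FArr F a"
        using kA X pq p' by (simp flip: D.Comp_assoc) (metis FArr_Comp)
      moreover have "Comp D q (Comp D i (FArr F k)) = FArr F b"
        using kA X pq q' by (simp flip: D.Comp_assoc) (metis FArr_Comp)
      ultimately have "Comp D i (FArr F k) = h"
        by - (rule D.is_pullback_unique[OF pb], use kA X h in simp_all)
      then have "Comp D i (FArr F k) = Comp D i (FArr F h')" using \<open>Comp D i (FArr F h') = h\<close> by simp
      then have "FArr F k = FArr F h'"
        by (rule D.mono_cancel[OF D.iso_mono[OF X(9)]]) (use kA(1-3) h'(1-3) X(2-4) FArr_Arr[OF h'(1)] in simp_all)
      then show "k = h'" using kA h' by - (rule faithful, auto)
    qed
    with 1 show "\<exists>!h. ?P h" by (rule ex1I)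
  qed (use fg p' q' comm in auto)
  then show ?thesis by blast
qed

lemma reflects_pushouts:
  assumes "f \<in> Arr C" "g \<in> Arr C" "Dom C f = Dom C g" "is_pushout D (FArr F f) (FArr F g) p q"
  shows "\<exists>p q. is_pushout C f g p q"
  using equivalence_on.reflects_pullbacks[OF equivalence_op_cat, of f g p q] assms
  by (simp add: is_pullback_op_cat)

end


section \<open>Adjoint functors\<close>

locale adjunction_on = L: functor_on C D L + R: functor_on D C R
  for C :: "('o, 'm) cat" and D :: "('p, 'n) cat" and L R +
  fixes \<phi> :: "'o \<Rightarrow> 'p \<Rightarrow> 'n \<Rightarrow> 'm"
  assumes adjunction: "is_adjunction C D L R \<phi>"
begin

lemma transpose:
  assumes "X \<in> Obj C" "g \<in> Arr D" "Dom D g = FObj L X"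
  shows "\<phi> X (Cod D g) g \<in> Arr C" "Dom C (\<phi> X (Cod D g) g) = X" "Cod C (\<phi> X (Cod D g) g) = FObj R (Cod D g)"
proof -
  have "bij_betw (\<phi> X (Cod D g)) (Hom D (FObj L X) (Cod D g)) (Hom C X (FObj R (Cod D g)))"
    using adjunction assms by (auto simp: is_adjunction_def)
  then have "\<phi> X (Cod D g) g \<in> Hom C X (FObj R (Cod D g))"
    using assms by (auto simp: bij_betw_def Hom_def)
  then show "\<phi> X (Cod D g) g \<in> Arr C" "Dom C (\<phi> X (Cod D g) g) = X" "Cod C (\<phi> X (Cod D g) g) = FObj R (Cod D g)"
    by (auto simp: Hom_def)
qed

lemma transpose_inj:
  assumes "X \<in> Obj C" "g \<in> Arr D" "Dom D g = FObj L X" "g' \<in> Arr D" "Dom D g' = FObj L X" "Cod D g' = Cod D g"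
    "\<phi> X (Cod D g) g = \<phi> X (Cod D g) g'"
  shows "g = g'"
proof -
  have "bij_betw (\<phi> X (Cod D g)) (Hom D (FObj L X) (Cod D g)) (Hom C X (FObj R (Cod D g)))"
    using adjunction assms by (auto simp: is_adjunction_def)
  then have "inj_on (\<phi> X (Cod D g)) (Hom D (FObj L X) (Cod D g))" by (rule bij_betw_imp_inj_on)
  then show ?thesis using assms by (auto simp: inj_on_def Hom_def)
qed

lemma transpose_surj:
  assumes "f \<in> Arr C" "Y \<in> Obj D" "Cod C f = FObj R Y"
  obtains g where "g \<in> Arr D" "Dom D g = FObj L (Dom C f)" "Cod D g = Y" "\<phi> (Dom C f) Y g = f"
proof -
  have "bij_betw (\<phi> (Dom C f) Y) (Hom D (FObj L (Dom C f)) Y) (Hom C (Dom C f) (FObj R Y))"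
    using adjunction assms by (auto simp: is_adjunction_def)
  then have "f \<in> \<phi> (Dom C f) Y ` Hom D (FObj L (Dom C f)) Y"
    using assms by (auto simp: bij_betw_def Hom_def)
  then show ?thesis using that by (auto simp: Hom_def)
qed

lemma transpose_natural:
  assumes "f \<in> Arr C" "g \<in> Arr D" "k \<in> Arr D" "Dom D g = FObj L (Cod C f)" "Cod D g = Dom D k"
  shows "\<phi> (Dom C f) (Cod D k) (Comp D k (Comp D g (FArr L f))) =
    Comp C (FArr R k) (Comp C (\<phi> (Cod C f) (Dom D k) g) f)"
  using adjunction assms unfolding is_adjunction_def Hom_def by auto

lemma transpose_natural_left:
  assumes A: "f \<in> Arr C" "g \<in> Arr D" "Dom D g = FObj L (Cod C f)" and Y: "Y = Cod D g"
  shows "\<phi> (Dom C f) Y (Comp D g (FArr L f)) = Comp C (\<phi> (Cod C f) Y g) f"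
proof -
  have O: "Y \<in> Obj D" using A Y by simp
  have "\<phi> (Dom C f) (Cod D (Idn D Y)) (Comp D (Idn D Y) (Comp D g (FArr L f))) =
      Comp C (FArr R (Idn D Y)) (Comp C (\<phi> (Cod C f) (Dom D (Idn D Y)) g) f)"
    by (rule transpose_natural) (use A Y O in simp_all)
  moreover have "\<phi> (Cod C f) Y g \<in> Arr C" "Dom C (\<phi> (Cod C f) Y g) = Cod C f" "Cod C (\<phi> (Cod C f) Y g) = FObj R Y"
    unfolding Y by (rule transpose; use A in simp)+
  ultimately show ?thesis using A Y[symmetric] O by simp
qed

lemma transpose_natural_right:
  assumes A: "X \<in> Obj C" "g \<in> Arr D" "k \<in> Arr D" "Dom D g = FObj L X" "Cod D g = Dom D k" and Y: "Y = Cod D k"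
  shows "\<phi> X Y (Comp D k g) = Comp C (FArr R k) (\<phi> X (Dom D k) g)"
proof -
  have "\<phi> (Dom C (Idn C X)) (Cod D k) (Comp D k (Comp D g (FArr L (Idn C X)))) =
      Comp C (FArr R k) (Comp C (\<phi> (Cod C (Idn C X)) (Dom D k) g) (Idn C X))"
    by (rule transpose_natural) (use A in simp_all)
  moreover have "\<phi> X (Dom D k) g \<in> Arr C" "Dom C (\<phi> X (Dom D k) g) = X"
    unfolding A(5)[symmetric] by (rule transpose; use A in simp)+
  ultimately show ?thesis using A Y by simp
qed

lemma right_adjoint_preserves_mono:
  assumes m: "is_mono D m" shows "is_mono C (FArr R m)"
  unfolding is_mono_def
proof (intro conjI ballI impI; (elim conjE)?)
  have mA: "m \<in> Arr D" using m L.D.is_mono_Arr by auto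
  then show "FArr R m \<in> Arr C" by simp
  fix f g assume fg: "f \<in> Arr C" "g \<in> Arr C" "Dom C f = Dom C g" "Cod C f = Dom C (FArr R m)"
    "Cod C g = Dom C (FArr R m)" "Comp C (FArr R m) f = Comp C (FArr R m) g"
  obtain f' where f': "f' \<in> Arr D" "Dom D f' = FObj L (Dom C f)" "Cod D f' = Dom D m" "\<phi> (Dom C f) (Dom D m) f' = f"
    by (rule transpose_surj[of f "Dom D m"]) (use fg mA in auto)
  obtain g' where g': "g' \<in> Arr D" "Dom D g' = FObj L (Dom C f)" "Cod D g' = Dom D m" "\<phi> (Dom C f) (Dom D m) g' = g"
    by (rule transpose_surj[of g "Dom D m"]) (use fg mA in auto)
  have "Comp D m f' = Comp D m g'"
    by (rule transpose_inj[of "Dom C f"]) (use fg mA f' g' in \<open>simp_all add: transpose_natural_right\<close>)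
  then have "f' = g'" by (rule L.D.mono_cancel[OF m]) (use f' g' in auto)
  then show "f = g" using f' g' by auto
qed

lemma left_adjoint_preserves_epi:
  assumes e: "is_epi C e" shows "is_epi D (FArr L e)"
  unfolding is_epi_def
proof (intro conjI ballI impI; (elim conjE)?)
  have eA: "e \<in> Arr C" using e L.C.is_epi_Arr by auto
  then show "FArr L e \<in> Arr D" by simp
  fix f g assume fg: "f \<in> Arr D" "g \<in> Arr D" "Cod D f = Cod D g" "Dom D f = Cod D (FArr L e)"
    "Dom D g = Cod D (FArr L e)" "Comp D f (FArr L e) = Comp D g (FArr L e)"
  have "Comp C (\<phi> (Cod C e) (Cod D f) f) e = Comp C (\<phi> (Cod C e) (Cod D f) g) e"
    using fg eA by (simp flip: transpose_natural_left)
  then have "\<phi> (Cod C e) (Cod D f) f = \<phi> (Cod C e) (Cod D f) g"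
    using transpose[of "Cod C e" f] transpose[of "Cod C e" g] fg eA
    by - (rule L.C.epi_cancel[OF e], auto)
  then show "f = g" using fg eA by - (rule transpose_inj[of "Cod C e"], auto)
qed

text \<open>A square from \<open>FArr L e\<close> to a mono \<open>m\<close> transposes to a square
  from \<open>e\<close> to \<open>FArr R m\<close>, which is mono because right adjoints preserve
  monomorphisms. The diagonal found in \<open>C\<close> transposes back.\<close>

lemma left_adjoint_preserves_strong_epi:
  assumes e: "e \<in> strong_epis C" shows "FArr L e \<in> strong_epis D"
proof -
  have eA: "e \<in> Arr C" using e L.C.strong_epis_Arr by auto
  have epi: "is_epi D (FArr L e)" using e L.C.strong_epis_epi left_adjoint_preserves_epi by blast
  have "orthogonal D (FArr L e) m" if m: "is_mono D m" for m
  proof (rule L.D.orthogonalI[OF epi L.D.is_mono_Arr[OF m]])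
    fix u v assume uv: "u \<in> Arr D" "v \<in> Arr D" "Dom D u = Dom D (FArr L e)" "Cod D u = Dom D m"
      "Dom D v = Cod D (FArr L e)" "Cod D v = Cod D m" "Comp D m u = Comp D v (FArr L e)"
    have mA: "m \<in> Arr D" using m L.D.is_mono_Arr by auto
    let ?u = "\<phi> (Dom C e) (Cod D u) u" and ?v = "\<phi> (Cod C e) (Cod D v) v"
    have u: "?u \<in> Arr C" "Dom C ?u = Dom C e" "Cod C ?u = FObj R (Dom D m)"
      using transpose[of "Dom C e" u] uv eA by auto
    have v: "?v \<in> Arr C" "Dom C ?v = Cod C e" "Cod C ?v = FObj R (Cod D m)"
      using transpose[of "Cod C e" v] uv eA by auto
    have "Comp C (FArr R m) ?u = Comp C ?v e"
      using transpose_natural_right[of "Dom C e" u m "Cod D m"] transpose_natural_left[of e v "Cod D m"] uv eA mA by simp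
    then obtain d where d: "d \<in> Arr C" "Dom C d = Cod C e" "Cod C d = FObj R (Dom D m)"
      "Comp C d e = ?u" "Comp C (FArr R m) d = ?v"
      using L.C.orthogonalE[OF L.C.strong_epis_orthogonal[OF e right_adjoint_preserves_mono[OF m]], of ?u ?v] u v mA
      by auto
    obtain d' where d': "d' \<in> Arr D" "Dom D d' = FObj L (Cod C e)" "Cod D d' = Dom D m" "\<phi> (Cod C e) (Dom D m) d' = d"
      using transpose_surj[of d "Dom D m"] d mA by auto
    have "Comp D d' (FArr L e) = u"
      by (rule transpose_inj[of "Dom C e"]) (use d' d uv eA in \<open>simp_all add: transpose_natural_left\<close>)
    moreover have "Comp D m d' = v"
      by (rule transpose_inj[of "Cod C e"]) (use d' d uv eA mA in \<open>simp_all add: transpose_natural_right\<close>)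
    ultimately show "\<exists>d\<in>Arr D. Dom D d = Cod D (FArr L e) \<and> Cod D d = Dom D m \<and> Comp D d (FArr L e) = u \<and> Comp D m d = v"
      using d' eA by auto
  qed
  then show ?thesis using epi by (auto simp: strong_epis_def mono_arrs_def)
qed

text \<open>Cocones under the image of the span correspond by transposition to cocones under the
  span itself with vertex in the image of \<open>R\<close>, and mediating arrows correspond
  likewise.\<close>

lemma left_adjoint_preserves_pushout:
  assumes po: "is_pushout C f g p q"
  shows "is_pushout D (FArr L f) (FArr L g) (FArr L p) (FArr L q)"
proof -
  have A: "f \<in> Arr C" "g \<in> Arr C" "Dom C f = Dom C g" "p \<in> Arr C" "q \<in> Arr C" "Cod C p = Cod C q"
    "Dom C p = Cod C f" "Dom C q = Cod C g" "Comp C p f = Comp C q g"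
    using po by (auto simp: is_pushout_def)
  show ?thesis
    unfolding is_pushout_def
  proof (intro conjI ballI impI; (elim conjE)?)
    show "Comp D (FArr L p) (FArr L f) = Comp D (FArr L q) (FArr L g)"
      using A by (simp flip: L.FArr_Comp)
    fix a b assume ab: "a \<in> Arr D" "b \<in> Arr D" "Cod D a = Cod D b" "Dom D a = Cod D (FArr L f)"
      "Dom D b = Cod D (FArr L g)" "Comp D a (FArr L f) = Comp D b (FArr L g)"
    let ?P = "\<lambda>h. h \<in> Hom D (Cod D (FArr L p)) (Cod D a) \<and> Comp D h (FArr L p) = a \<and> Comp D h (FArr L q) = b"
    let ?a = "\<phi> (Cod C f) (Cod D a) a" and ?b = "\<phi> (Cod C g) (Cod D a) b"
    have a: "?a \<in> Arr C" "Dom C ?a = Cod C f" "Cod C ?a = FObj R (Cod D a)"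
      using transpose[of "Cod C f" a] ab A by auto
    have b: "?b \<in> Arr C" "Dom C ?b = Cod C g" "Cod C ?b = FObj R (Cod D a)"
      using transpose[of "Cod C g" b] ab A by auto
    have "Comp C ?a f = Comp C ?b g"
      using transpose_natural_left[of f a "Cod D a"] transpose_natural_left[of g b "Cod D a"] ab A by simp
    then obtain h where h: "h \<in> Arr C" "Dom C h = Cod C p" "Cod C h = FObj R (Cod D a)" "Comp C h p = ?a" "Comp C h q = ?b"
      by - (rule L.C.is_pushoutE[OF po, of ?a ?b], use a b in simp_all)
    obtain h' where h': "h' \<in> Arr D" "Dom D h' = FObj L (Cod C p)" "Cod D h' = Cod D a" "\<phi> (Cod C p) (Cod D a) h' = h"
      using transpose_surj[of h "Cod D a"] h ab by auto
    have "Comp D h' (FArr L p) = a"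
      by (rule transpose_inj[of "Cod C f"])
        (use h' h ab A transpose_natural_left[of p h' "Cod D a"] in simp_all)
    moreover have "Comp D h' (FArr L q) = b"
      by (rule transpose_inj[of "Cod C g"])
        (use h' h ab A transpose_natural_left[of q h' "Cod D a"] in simp_all)
    ultimately have 1: "?P h'" using h' A by (auto simp: Hom_def)
    have "k = h'" if k: "?P k" for k
    proof -
      have kA: "k \<in> Arr D" "Dom D k = FObj L (Cod C p)" "Cod D k = Cod D a"
        "Comp D k (FArr L p) = a" "Comp D k (FArr L q) = b"
        using k A by (auto simp: Hom_def)
      let ?k = "\<phi> (Cod C p) (Cod D a) k"
      have "?k \<in> Arr C" "Dom C ?k = Cod C p" "Cod C ?k = FObj R (Cod D a)"
        using transpose[of "Cod C p" k] kA A by auto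
      moreover have "Comp C ?k p = ?a" "Comp C ?k q = ?b"
        using transpose_natural_left[of p k "Cod D a"] transpose_natural_left[of q k "Cod D a"] kA A by simp_all
      ultimately have "?k = h" by - (rule L.C.is_pushout_unique[OF po], use h in simp_all)
      then show "k = h'" using h' kA A by - (rule transpose_inj[of "Cod C p"], auto)
    qed
    with 1 show "\<exists>!h. ?P h" by (rule ex1I)
  qed (use A in auto)
qed

end


section \<open>Models of essentially algebraic theories\<close>

lemma Mod_simps [simp]:
  "Obj (Mod T) = {A. is_model T A}"
  "(A, h, B) \<in> Arr (Mod T) \<longleftrightarrow> is_model T A \<and> is_model T B \<and> is_hom T A B h"
  "Dom (Mod T) (A, h, B) = A" "Cod (Mod T) (A, h, B) = B"
  "Idn (Mod T) A = (A, (\<lambda>s. \<lambda>x \<in> Carr A s. x), A)"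
  "Comp (Mod T) (B', k, D) (A, h, B) = (A, (\<lambda>s. compose (Carr A s) (k s) (h s)), D)"
  by (auto simp: Mod_def)

abbreviation map_args :: "'u ea_theory \<Rightarrow> ('u \<Rightarrow> 'u \<Rightarrow> 'u) \<Rightarrow> 'u \<Rightarrow> ('u \<Rightarrow> 'u) \<Rightarrow> 'u \<Rightarrow> 'u" where
  "map_args T h f a \<equiv> (\<lambda>i \<in> Arity T f. h (ArgSort T f i) (a i))"

section \<open>Homomorphisms and evaluation of terms\<close>

lemma is_homD:
  assumes "is_hom T A B h"
  shows is_hom_funcset: "h s \<in> Carr A s \<rightarrow>\<^sub>E Carr B s"
    and is_hom_mem: "x \<in> Carr A s \<Longrightarrow> h s x \<in> Carr B s"
    and is_hom_Op: "f \<in> Ops T \<Longrightarrow> Op A f a = Some b \<Longrightarrow> Op B f (map_args T h f a) = Some (h (ResSort T f) b)"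
  using assms by (auto simp: is_hom_def PiE_iff)

lemma is_hom_eqI:
  assumes "is_hom T A B h" "is_hom T A B k" "\<And>s x. x \<in> Carr A s \<Longrightarrow> h s x = k s x"
  shows "h = k"
  by (rule ext) (rule PiE_ext[OF is_hom_funcset[OF assms(1)] is_hom_funcset[OF assms(2)] assms(3)])

lemma is_modelD:
  assumes "is_model T A"
  shows model_small: "s \<in> Sorts T \<Longrightarrow> small TYPE('u) (Carr (A :: 'u model) s)"
    and model_sort: "x \<in> Carr A s \<Longrightarrow> s \<in> Sorts T"
    and model_args: "f \<in> Ops T \<Longrightarrow> Op A f a = Some b \<Longrightarrow> a \<in> args T A f"
    and model_result: "f \<in> Ops T \<Longrightarrow> Op A f a = Some b \<Longrightarrow> b \<in> Carr A (ResSort T f)"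
    and model_total: "f \<in> Total T \<Longrightarrow> a \<in> args T A f \<Longrightarrow> Op A f a \<noteq> None"
    and model_partial: "f \<in> Ops T \<Longrightarrow> f \<notin> Total T \<Longrightarrow> a \<in> args T A f \<Longrightarrow>
      Op A f a \<noteq> None \<longleftrightarrow> (\<forall>(l, r) \<in> DomEqs T f. eval T A a l = eval T A a r)"
    and model_equation: "(X, \<sigma>, l, r) \<in> Eqs T \<Longrightarrow> v \<in> (\<Pi>\<^sub>E x \<in> X. Carr A (\<sigma> x)) \<Longrightarrow> eval T A v l = eval T A v r"
  using assms unfolding is_model_def by (auto | fast)+

lemma wf_theoryD:
  assumes "wf_theory (T :: 'u ea_theory)"
  shows "small TYPE('u) (Sorts T)" "small TYPE('u) (Ops T)" "Total T \<subseteq> Ops T"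
    "f \<in> Ops T \<Longrightarrow> small TYPE('u) (Arity T f)"
    "f \<in> Ops T \<Longrightarrow> ResSort T f \<in> Sorts T"
    "f \<in> Ops T \<Longrightarrow> i \<in> Arity T f \<Longrightarrow> ArgSort T f i \<in> Sorts T"
    "(X, \<sigma>, l, r) \<in> Eqs T \<Longrightarrow> \<exists>s. has_sort T (Ops T) X \<sigma> l s \<and> has_sort T (Ops T) X \<sigma> r s"
    "f \<in> Ops T \<Longrightarrow> f \<notin> Total T \<Longrightarrow> (l, r) \<in> DomEqs T f \<Longrightarrow> \<exists>s.
           has_sort T (Total T) (Arity T f) (ArgSort T f) l s \<and>
           has_sort T (Total T) (Arity T f) (ArgSort T f) r s"
  using assms unfolding wf_theory_def by (auto simp: image_subset_iff | fast)+

lemma map_args_mem: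
  assumes "\<And>s x. x \<in> Carr A s \<Longrightarrow> h s x \<in> Carr B s" "a \<in> args T A f"
  shows "map_args T h f a \<in> args T B f"
  using assms by (auto simp: args_def PiE_iff)

lemma eval_cong:
  "has_sort T F X \<sigma> t s \<Longrightarrow> (\<And>x. x \<in> X \<Longrightarrow> v x = w x) \<Longrightarrow> eval T A v t = eval T A w t"
proof (induction rule: has_sort.induct)
  case (App f ts)
  then have "eval T A v (ts i) = eval T A w (ts i)" if "i \<in> Arity T f" for i using that by blast
  then show ?case by (auto intro!: arg_cong[of _ _ "Op A f"] restrict_ext)
qed auto

lemma eval_total:
  "has_sort T (Total T) X \<sigma> t s \<Longrightarrow> wf_theory T \<Longrightarrow> is_model T A \<Longrightarrow> (\<And>x. x \<in> X \<Longrightarrow> v x \<in> Carr A (\<sigma> x)) \<Longrightarrow>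
    \<exists>b\<in>Carr A s. eval T A v t = Some b"
proof (induction rule: has_sort.induct)
  case (App f ts)
  then have IH: "\<exists>b\<in>Carr A (ArgSort T f i). eval T A v (ts i) = Some b" if "i \<in> Arity T f" for i
    using that by blast
  then have "(\<lambda>i \<in> Arity T f. the (eval T A v (ts i))) \<in> args T A f"
    by (force simp: args_def)
  then obtain b where "Op A f (\<lambda>i \<in> Arity T f. the (eval T A v (ts i))) = Some b"
    using model_total[OF App.prems(2) App.hyps(1)] by blast
  moreover have "f \<in> Ops T" using App wf_theoryD(3) by blast
  ultimately have "b \<in> Carr A (ResSort T f)" using App by (blast dest: model_result)
  moreover have "\<forall>i\<in>Arity T f. eval T A v (ts i) \<noteq> None" using IH by fastforce
  ultimately show ?case
    using \<open>Op A f _ = Some b\<close> by simp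
qed auto

text \<open>Definedness travels only from \<open>A\<close> to \<open>B\<close>: a partial operation
  may be defined on the images of arguments on which it was undefined.\<close>

lemma hom_eval:
  "has_sort T F X \<sigma> t s \<Longrightarrow> F \<subseteq> Ops T \<Longrightarrow> is_hom T A B h \<Longrightarrow>
    eval T A v t = Some b \<Longrightarrow> eval T B (\<lambda>x. h (\<sigma> x) (v x)) t = Some (h s b)"
proof (induction arbitrary: b rule: has_sort.induct)
  case (App f ts)
  let ?a = "\<lambda>i. the (eval T A v (ts i))"
  have d: "\<forall>i\<in>Arity T f. eval T A v (ts i) \<noteq> None" and b: "Op A f (restrict ?a (Arity T f)) = Some b"
    using App.prems by (auto split: if_splits)
  have e: "eval T B (\<lambda>x. h (\<sigma> x) (v x)) (ts i) = Some (h (ArgSort T f i) (?a i))" if "i \<in> Arity T f" for i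
    using that d App by auto
  have "Op B f (map_args T h f (restrict ?a (Arity T f))) = Some (h (ResSort T f) b)"
    using is_hom_Op[OF App.prems(2) _ b] App by blast
  moreover have "map_args T h f (restrict ?a (Arity T f)) =
      (\<lambda>i \<in> Arity T f. the (eval T B (\<lambda>x. h (\<sigma> x) (v x)) (ts i)))"
    using e by (auto intro!: restrict_ext)
  ultimately show ?case using e by auto
qed auto

text \<open>The domain of a partial operation is cut out by equations between terms in total
  operations. Both sides of such an equation have values in \<open>A\<close>, and an injective
  homomorphism reflects their equality. This is the substitute for totality in all later arguments
  about partial operations and injective maps.\<close>

lemma inj_hom_reflects_defined:
  assumes T: "wf_theory T" and A: "is_model T A" and B: "is_model T B" and h: "is_hom T A B h"
    and inj: "\<And>s. inj_on (h s) (Carr A s)"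
    and f: "f \<in> Ops T" "a \<in> args T A f" "Op B f (map_args T h f a) \<noteq> None"
  shows "Op A f a \<noteq> None"
proof (cases "f \<in> Total T")
  case True
  then show ?thesis by (rule model_total[OF A _ f(2)])
next
  case False
  have ha: "map_args T h f a \<in> args T B f" using f is_hom_mem[OF h] by (intro map_args_mem)
  have mem: "a i \<in> Carr A (ArgSort T f i)" if "i \<in> Arity T f" for i using f that by (auto simp: args_def)
  have "eval T A a l = eval T A a r" if lr: "(l, r) \<in> DomEqs T f" for l r
  proof -
    obtain s where l: "has_sort T (Total T) (Arity T f) (ArgSort T f) l s"
        and r: "has_sort T (Total T) (Arity T f) (ArgSort T f) r s"
      using wf_theoryD(8)[OF T f(1) False lr] by blast
    obtain x where x: "x \<in> Carr A s" "eval T A a l = Some x" using eval_total[OF l T A mem] by blast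
    obtain y where y: "y \<in> Carr A s" "eval T A a r = Some y" using eval_total[OF r T A mem] by blast
    have "eval T B (map_args T h f a) l = eval T B (map_args T h f a) r"
      using model_partial[OF B f(1) False ha] f(3) lr by blast
    moreover have "eval T B (map_args T h f a) l = eval T B (\<lambda>i. h (ArgSort T f i) (a i)) l"
      by (rule eval_cong[OF l]) auto
    moreover have "eval T B (map_args T h f a) r = eval T B (\<lambda>i. h (ArgSort T f i) (a i)) r"
      by (rule eval_cong[OF r]) auto
    ultimately have "h s x = h s y"
      using hom_eval[OF l wf_theoryD(3)[OF T] h x(2)] hom_eval[OF r wf_theoryD(3)[OF T] h y(2)] by simp
    then show ?thesis using x y inj by (metis inj_onD)
  qed
  then show ?thesis using model_partial[OF A f(1) False f(2)] by blast
qed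

lemma is_hom_Idn: "is_model T A \<Longrightarrow> is_hom T A A (\<lambda>s. \<lambda>x \<in> Carr A s. x)"
  unfolding is_hom_def
proof (intro conjI allI ballI impI)
  fix f a b assume A: "is_model T A" "f \<in> Ops T" "Op A f a = Some b"
  then have "a \<in> args T A f" "b \<in> Carr A (ResSort T f)"
    using model_args model_result by metis+
  moreover from this have "map_args T (\<lambda>s. \<lambda>x \<in> Carr A s. x) f a = a"
    by (auto simp: args_def PiE_iff extensional_def fun_eq_iff)
  ultimately show "Op A f (map_args T (\<lambda>s. \<lambda>x \<in> Carr A s. x) f a) = Some ((\<lambda>x \<in> Carr A (ResSort T f). x) b)"
    using A by simp
qed auto

lemma is_hom_compose:
  assumes A: "is_model T A" and h: "is_hom T A B h" and k: "is_hom T B D k"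
  shows "is_hom T A D (\<lambda>s. compose (Carr A s) (k s) (h s))"
  unfolding is_hom_def
proof (intro conjI allI ballI impI)
  show "compose (Carr A s) (k s) (h s) \<in> Carr A s \<rightarrow>\<^sub>E Carr D s" for s
    using is_hom_mem[OF h] is_hom_mem[OF k] by (auto simp: compose_def)
  fix f a b assume f: "f \<in> Ops T" "Op A f a = Some b"
  then have a: "a \<in> args T A f" "b \<in> Carr A (ResSort T f)"
    using model_args[OF A] model_result[OF A] by auto
  have "Op D f (map_args T k f (map_args T h f a)) = Some (k (ResSort T f) (h (ResSort T f) b))"
    using is_hom_Op[OF k f(1) is_hom_Op[OF h f]] .
  moreover have "map_args T k f (map_args T h f a) = map_args T (\<lambda>s. compose (Carr A s) (k s) (h s)) f a"
    using a by (auto intro!: restrict_ext simp: args_def compose_eq PiE_iff)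
  ultimately show "Op D f (map_args T (\<lambda>s. compose (Carr A s) (k s) (h s)) f a) =
      Some (compose (Carr A (ResSort T f)) (k (ResSort T f)) (h (ResSort T f)) b)"
    using a by (simp add: compose_eq)
qed

lemma category_Mod: "category (Mod T)"
proof -
  have 1: "compose (Carr A s) (h s) (\<lambda>x \<in> Carr A s. x) = h s"
      "compose (Carr A s) (\<lambda>x \<in> Carr B s. x) (h s) = h s" if "is_hom T A B h" for A B h s
    using is_hom_funcset[OF that, of s] by (auto simp: compose_def PiE_iff extensional_def fun_eq_iff)
  have 2: "compose (Carr A s) (l s) (compose (Carr A s) (k s) (h s)) =
      compose (Carr A s) (compose (Carr B s) (l s) (k s)) (h s)" if "is_hom T A B h" for A B h k l s
    using is_hom_mem[OF that] by (auto simp: compose_def fun_eq_iff)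
  show ?thesis
    unfolding category_def Hom_def
    by (auto simp: is_hom_Idn is_hom_compose 1 2)
qed

interpretation Mod: category_on "Mod T" for T
  by unfold_locales (rule category_Mod)

text \<open>
  The model structure on the sets \<open>Car s\<close> induced by a jointly injective family of maps into
  models: an operation is defined when it is defined in every component, and its value is the
  element with the prescribed components.
\<close>

locale initial_lift =
  fixes T :: "'u ea_theory" and I :: "'i set" and P :: "'i \<Rightarrow> 'u model"
    and Car :: "'u \<Rightarrow> 'u set" and p :: "'i \<Rightarrow> 'u \<Rightarrow> 'u \<Rightarrow> 'u"
  assumes wf: "wf_theory T"
    and P: "i \<in> I \<Longrightarrow> is_model T (P i)"
    and Car_small: "s \<in> Sorts T \<Longrightarrow> small TYPE('u) (Car s)"
    and Car_sort: "x \<in> Car s \<Longrightarrow> s \<in> Sorts T"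
    and p: "i \<in> I \<Longrightarrow> p i s \<in> Car s \<rightarrow>\<^sub>E Carr (P i) s"
    and joint: "x \<in> Car s \<Longrightarrow> y \<in> Car s \<Longrightarrow> (\<And>i. i \<in> I \<Longrightarrow> p i s x = p i s y) \<Longrightarrow> x = y"
    and Car_closed: "f \<in> Ops T \<Longrightarrow> a \<in> (\<Pi>\<^sub>E k \<in> Arity T f. Car (ArgSort T f k)) \<Longrightarrow>
      (\<And>i. i \<in> I \<Longrightarrow> Op (P i) f (map_args T (p i) f a) \<noteq> None) \<Longrightarrow>
      \<exists>b\<in>Car (ResSort T f). \<forall>i\<in>I. Op (P i) f (map_args T (p i) f a) = Some (p i (ResSort T f) b)"
begin

definition is_value :: "'u \<Rightarrow> ('u \<Rightarrow> 'u) \<Rightarrow> 'u \<Rightarrow> bool" where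
  "is_value f a b \<longleftrightarrow> f \<in> Ops T \<and> a \<in> (\<Pi>\<^sub>E k \<in> Arity T f. Car (ArgSort T f k)) \<and> b \<in> Car (ResSort T f) \<and>
    (\<forall>i\<in>I. Op (P i) f (map_args T (p i) f a) = Some (p i (ResSort T f) b))"

definition lift_model :: "'u model" where
  "lift_model = \<lparr>Carr = Car, Op = (\<lambda>f a. if \<exists>b. is_value f a b then Some (THE b. is_value f a b) else None)\<rparr>"

lemma Carr_lift_model [simp]: "Carr lift_model = Car"
  by (simp add: lift_model_def)

lemma args_lift_model: "args T lift_model f = (\<Pi>\<^sub>E k \<in> Arity T f. Car (ArgSort T f k))"
  by (simp add: args_def)

lemma is_value_unique: "is_value f a b \<Longrightarrow> is_value f a c \<Longrightarrow> b = c"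
  by (rule joint) (auto simp: is_value_def)

lemma Op_lift_model: "Op lift_model f a = Some b \<longleftrightarrow> is_value f a b"
  using is_value_unique by (auto simp: lift_model_def intro: theI2 the_equality)

lemma Op_lift_model_defined:
  "f \<in> Ops T \<Longrightarrow> a \<in> args T lift_model f \<Longrightarrow> (\<And>i. i \<in> I \<Longrightarrow> Op (P i) f (map_args T (p i) f a) \<noteq> None) \<Longrightarrow>
    Op lift_model f a \<noteq> None"
  using Car_closed[of f a] Op_lift_model[of f a] unfolding is_value_def args_lift_model by blast

lemma p_mem: "i \<in> I \<Longrightarrow> x \<in> Car s \<Longrightarrow> p i s x \<in> Carr (P i) s"
  using p by (auto simp: PiE_iff)

lemma is_hom_p: "i \<in> I \<Longrightarrow> is_hom T lift_model (P i) (p i)"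
  unfolding is_hom_def by (auto simp: p Op_lift_model is_value_def p_mem PiE_iff intro: p[unfolded PiE_iff, THEN conjunct2])

text \<open>Converse, for a whole jointly injective family, to preservation of definedness by one
  homomorphism: subterms have values by induction, and the root operation is defined because it is
  defined in every component.\<close>

lemma eval_lift_model_defined:
  "has_sort T (Ops T) X \<sigma> t s \<Longrightarrow> (\<And>x. x \<in> X \<Longrightarrow> v x \<in> Car (\<sigma> x)) \<Longrightarrow>
    (\<And>i. i \<in> I \<Longrightarrow> eval T (P i) (\<lambda>x. p i (\<sigma> x) (v x)) t \<noteq> None) \<Longrightarrow> \<exists>b\<in>Car s. eval T lift_model v t = Some b"
proof (induction rule: has_sort.induct)
  case (App f ts)
  have "eval T (P i) (\<lambda>x. p i (\<sigma> x) (v x)) (ts k) \<noteq> None" if "k \<in> Arity T f" "i \<in> I" for k i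
    using App.prems(2)[OF that(2)] that(1) by (auto split: if_splits)
  then have IH: "\<exists>b\<in>Car (ArgSort T f k). eval T lift_model v (ts k) = Some b" if "k \<in> Arity T f" for k
    using App that by blast
  let ?a = "\<lambda>k\<in>Arity T f. the (eval T lift_model v (ts k))"
  have a: "?a \<in> args T lift_model f"
    using IH by (force simp: args_lift_model)
  have "Op lift_model f ?a \<noteq> None"
  proof (rule Op_lift_model_defined[OF App(1) a])
    fix i assume i: "i \<in> I"
    have "eval T (P i) (\<lambda>x. p i (\<sigma> x) (v x)) (ts k) = Some (p i (ArgSort T f k) (?a k))" if "k \<in> Arity T f" for k
      using hom_eval[OF App(2)[OF that] order_refl is_hom_p[OF i]] IH[OF that] that by auto
    then have "map_args T (p i) f ?a = (\<lambda>k\<in>Arity T f. the (eval T (P i) (\<lambda>x. p i (\<sigma> x) (v x)) (ts k)))"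
      by (auto intro!: restrict_ext)
    then show "Op (P i) f (map_args T (p i) f ?a) \<noteq> None"
      using App.prems(2)[OF i] by (auto split: if_splits)
  qed
  then obtain b where b: "Op lift_model f ?a = Some b" by blast
  then have "b \<in> Car (ResSort T f)" by (auto simp: Op_lift_model is_value_def)
  then show ?case using b IH by force
qed auto

text \<open>One half of a Kleene equality: a value of \<open>l\<close> is sent to every component,
  turned there into a value of \<open>r\<close>, and the component values are assembled again. Joint
  injectivity identifies the result with \<open>x\<close>.\<close>

lemma eval_lift_model_eq:
  assumes l: "has_sort T (Ops T) X \<sigma> l s" and r: "has_sort T (Ops T) X \<sigma> r s"
    and v: "\<And>x. x \<in> X \<Longrightarrow> v x \<in> Car (\<sigma> x)"
    and eq: "\<And>i. i \<in> I \<Longrightarrow> eval T (P i) (\<lambda>x. p i (\<sigma> x) (v x)) l = eval T (P i) (\<lambda>x. p i (\<sigma> x) (v x)) r"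
    and x: "eval T lift_model v l = Some x" "x \<in> Car s"
  shows "eval T lift_model v r = Some x"
proof -
  have l': "eval T (P i) (\<lambda>x. p i (\<sigma> x) (v x)) l = Some (p i s x)" if "i \<in> I" for i
    using hom_eval[OF l order_refl is_hom_p[OF that] x(1)] .
  then obtain y where y: "y \<in> Car s" "eval T lift_model v r = Some y"
    using eval_lift_model_defined[OF r v] eq by fastforce
  have "p i s x = p i s y" if "i \<in> I" for i
    using hom_eval[OF r order_refl is_hom_p[OF that] y(2)] l' eq that by force
  then show ?thesis using joint x y by auto
qed

lemma is_model_lift_model: "is_model T lift_model"
  unfolding is_model_def
proof (intro conjI ballI allI impI)
  show "small TYPE('u) (Carr lift_model s)" if "s \<in> Sorts T" for s using that Car_small by simp
  show "Carr lift_model s = {}" if "s \<notin> Sorts T" for s using that Car_sort by auto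
  show "Op lift_model f a = None" if "f \<notin> Ops T" for f a using that by (auto simp: lift_model_def is_value_def)
  show "a \<in> args T lift_model f" "b \<in> Carr lift_model (ResSort T f)"
    if "f \<in> Ops T" "Op lift_model f a = Some b" for f a b
    using that by (auto simp: Op_lift_model is_value_def args_lift_model)
  show "Op lift_model f a \<noteq> None" if f: "f \<in> Total T" "a \<in> args T lift_model f" for f a
  proof (rule Op_lift_model_defined)
    fix i assume i: "i \<in> I"
    show "Op (P i) f (map_args T (p i) f a) \<noteq> None"
      by (rule model_total[OF P[OF i] f(1) map_args_mem[OF _ f(2)]]) (simp add: p_mem i)
  qed (use f wf wf_theoryD(3) in auto)
  show "(Op lift_model f a \<noteq> None) = (\<forall>(l, r)\<in>DomEqs T f. eval T lift_model a l = eval T lift_model a r)"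
    if f: "f \<in> Ops T - Total T" and a: "a \<in> args T lift_model f" for f a
  proof -
    have pa: "map_args T (p i) f a \<in> args T (P i) f" if "i \<in> I" for i
      by (rule map_args_mem[OF _ a]) (simp add: p_mem that)
    have a': "a k \<in> Car (ArgSort T f k)" if "k \<in> Arity T f" for k
      using a that by (auto simp: args_lift_model)
    have pa': "p i (ArgSort T f k) (a k) \<in> Carr (P i) (ArgSort T f k)" if "k \<in> Arity T f" "i \<in> I" for i k
      using a' p_mem that by blast
    have "Op lift_model f a \<noteq> None \<longleftrightarrow> (\<forall>i\<in>I. Op (P i) f (map_args T (p i) f a) \<noteq> None)"
      using Op_lift_model_defined[OF _ a] f by (auto simp: Op_lift_model is_value_def)
    also have "\<dots> \<longleftrightarrow> (\<forall>i\<in>I. \<forall>(l, r)\<in>DomEqs T f.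
        eval T (P i) (map_args T (p i) f a) l = eval T (P i) (map_args T (p i) f a) r)"
      using model_partial[OF P _ _ pa] f by (intro ball_cong) auto
    also have "\<dots> \<longleftrightarrow> (\<forall>(l, r)\<in>DomEqs T f. \<forall>i\<in>I.
        eval T (P i) (map_args T (p i) f a) l = eval T (P i) (map_args T (p i) f a) r)"
      by blast
    also have "\<dots> \<longleftrightarrow> (\<forall>(l, r)\<in>DomEqs T f. eval T lift_model a l = eval T lift_model a r)"
    proof (intro ball_cong refl, clarify)
      fix l r assume lr: "(l, r) \<in> DomEqs T f"
      obtain s where l: "has_sort T (Total T) (Arity T f) (ArgSort T f) l s"
          and r: "has_sort T (Total T) (Arity T f) (ArgSort T f) r s"
        using wf_theoryD(8)[OF wf _ _ lr] f by blast
      note sub = wf_theoryD(3)[OF wf]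
      have mono: "has_sort T (Ops T) X \<sigma> t s'" if "has_sort T (Total T) X \<sigma> t s'" for X \<sigma> t s'
        using that by (induction rule: has_sort.induct) (use sub in \<open>auto intro: has_sort.intros\<close>)
      have c: "eval T (P i) (map_args T (p i) f a) t = eval T (P i) (\<lambda>k. p i (ArgSort T f k) (a k)) t"
        if "has_sort T (Total T) (Arity T f) (ArgSort T f) t s" for i t
        by (rule eval_cong[OF that]) auto
      \<comment> \<open>Domain equations involve total operations only, so both sides always have
        values and joint injectivity alone decides whether they agree.\<close>
      have "\<exists>x\<in>Car s. eval T lift_model a t = Some x"
        if t: "has_sort T (Total T) (Arity T f) (ArgSort T f) t s" for t
      proof (rule eval_lift_model_defined[OF mono[OF t] a'])
        fix i assume "i \<in> I"
        then show "eval T (P i) (\<lambda>k. p i (ArgSort T f k) (a k)) t \<noteq> None"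
          using eval_total[OF t wf P pa'] by force
      qed
      then obtain x y where x: "x \<in> Car s" "eval T lift_model a l = Some x"
          and y: "y \<in> Car s" "eval T lift_model a r = Some y"
        using l r by meson
      have "eval T (P i) (map_args T (p i) f a) l = Some (p i s x)"
        "eval T (P i) (map_args T (p i) f a) r = Some (p i s y)" if "i \<in> I" for i
        using hom_eval[OF l sub is_hom_p[OF that] x(2)] hom_eval[OF r sub is_hom_p[OF that] y(2)] c l r by simp_all
      then show "(\<forall>i\<in>I. eval T (P i) (map_args T (p i) f a) l = eval T (P i) (map_args T (p i) f a) r) =
          (eval T lift_model a l = eval T lift_model a r)"
        using x y joint by auto
    qed
    finally show ?thesis .
  qed
  show "case e of (X, \<sigma>, l, r) \<Rightarrow> \<forall>v\<in>\<Pi>\<^sub>E x\<in>X. Carr lift_model (\<sigma> x). eval T lift_model v l = eval T lift_model v r"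
    if e: "e \<in> Eqs T" for e
  proof (clarify)
    fix X \<sigma> l r v assume e': "e = (X, \<sigma>, l, r)" and v: "v \<in> (\<Pi>\<^sub>E x\<in>X. Carr lift_model (\<sigma> x))"
    obtain s where l: "has_sort T (Ops T) X \<sigma> l s" and r: "has_sort T (Ops T) X \<sigma> r s"
      using wf_theoryD(7)[OF wf] e e' by blast
    have v': "v x \<in> Car (\<sigma> x)" if "x \<in> X" for x using v that by auto
    have eq: "eval T (P i) (\<lambda>x. p i (\<sigma> x) (v x)) l = eval T (P i) (\<lambda>x. p i (\<sigma> x) (v x)) r" if i: "i \<in> I" for i
    proof -
      have "eval T (P i) (\<lambda>x\<in>X. p i (\<sigma> x) (v x)) l = eval T (P i) (\<lambda>x\<in>X. p i (\<sigma> x) (v x)) r"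
        by (rule model_equation[OF P[OF i]]) (use e e' v' p_mem i in auto)
      moreover have "eval T (P i) (\<lambda>x\<in>X. p i (\<sigma> x) (v x)) t = eval T (P i) (\<lambda>x. p i (\<sigma> x) (v x)) t"
        if "has_sort T (Ops T) X \<sigma> t s" for t by (rule eval_cong[OF that]) auto
      ultimately show ?thesis using l r by simp
    qed
    have mem: "x \<in> Car s" if "eval T lift_model v t = Some x" "has_sort T (Ops T) X \<sigma> t s" for t x
      using that eval_lift_model_defined[OF that(2) v'] hom_eval[OF that(2) order_refl is_hom_p that(1)] by force
    show "eval T lift_model v l = eval T lift_model v r"
    proof (cases "eval T lift_model v l")
      case None
      show ?thesis
      proof (cases "eval T lift_model v r")
        case (Some x)
        then show ?thesis
          using eval_lift_model_eq[OF r l v' eq[symmetric] Some mem[OF Some r]] by simp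
      qed (simp add: None)
    next
      case (Some x)
      then show ?thesis
        using eval_lift_model_eq[OF l r v' eq Some mem[OF Some l]] by simp
    qed
  qed
qed

text \<open>Initiality of the lifted structure: the value demanded of an operation is checked in
  each component, which is exactly what \<open>is_value\<close> asks for.\<close>

lemma is_hom_into_lift_model:
  assumes B: "is_model T B" and h: "\<And>s. h s \<in> Carr B s \<rightarrow>\<^sub>E Car s"
    and ph: "\<And>i. i \<in> I \<Longrightarrow> is_hom T B (P i) (\<lambda>s. compose (Carr B s) (p i s) (h s))"
  shows "is_hom T B lift_model h"
  unfolding is_hom_def
proof (intro conjI allI ballI impI)
  show "h s \<in> Carr B s \<rightarrow>\<^sub>E Carr lift_model s" for s using h by simp
  fix f a b assume f: "f \<in> Ops T" "Op B f a = Some b"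
  have a: "a k \<in> Carr B (ArgSort T f k)" if "k \<in> Arity T f" for k
    using model_args[OF B f] that by (auto simp: args_def)
  have b: "b \<in> Carr B (ResSort T f)" using model_result[OF B f] .
  have "is_value f (map_args T h f a) (h (ResSort T f) b)"
    unfolding is_value_def
  proof (intro conjI ballI)
    show "map_args T h f a \<in> (\<Pi>\<^sub>E k\<in>Arity T f. Car (ArgSort T f k))"
      using a h by (auto simp: PiE_iff)
    show "h (ResSort T f) b \<in> Car (ResSort T f)" using b h by (auto simp: PiE_iff)
    fix i assume i: "i \<in> I"
    have "Op (P i) f (map_args T (\<lambda>s. compose (Carr B s) (p i s) (h s)) f a) = Some (p i (ResSort T f) (h (ResSort T f) b))"
      using is_hom_Op[OF ph[OF i] f] b by (simp add: compose_eq)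
    moreover have "map_args T (\<lambda>s. compose (Carr B s) (p i s) (h s)) f a = map_args T (p i) f (map_args T h f a)"
      using a by (auto intro!: restrict_ext simp: compose_eq)
    ultimately show "Op (P i) f (map_args T (p i) f (map_args T h f a)) = Some (p i (ResSort T f) (h (ResSort T f) b))"
      by simp
  qed (rule f)
  then show "Op lift_model f (map_args T h f a) = Some (h (ResSort T f) b)"
    by (simp add: Op_lift_model)
qed

end


section \<open>Limits and factorizations of models\<close>

text \<open>Closure is demanded for a partial operation wherever \<open>B\<close> defines it, so
  that the submodel loses none of the definedness of \<open>B\<close> on its own elements.\<close>

definition closed_family :: "'u ea_theory \<Rightarrow> 'u model \<Rightarrow> ('u \<Rightarrow> 'u set) \<Rightarrow> bool" where
  "closed_family T B Z \<longleftrightarrow> (\<forall>s. Z s \<subseteq> Carr B s) \<and>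
     (\<forall>f\<in>Ops T. \<forall>a b. Op B f a = Some b \<longrightarrow> (\<forall>k\<in>Arity T f. a k \<in> Z (ArgSort T f k)) \<longrightarrow> b \<in> Z (ResSort T f))"

text \<open>The initial lift along a single map, the inclusion into \<open>B\<close>; hence the
  one-element index set.\<close>

lemma submodel:
  assumes T: "wf_theory T" and B: "is_model T B" and Z: "closed_family T B Z"
  obtains S where "is_model T S" "Carr S = Z" "is_hom T S B (\<lambda>s. \<lambda>x\<in>Z s. x)"
    "\<And>A h. is_model T A \<Longrightarrow> is_hom T A B h \<Longrightarrow> (\<And>s x. x \<in> Carr A s \<Longrightarrow> h s x \<in> Z s) \<Longrightarrow> is_hom T A S h"
proof -
  have sub: "Z s \<subseteq> Carr B s" for s using Z by (simp add: closed_family_def)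
  have cl: "b \<in> Z (ResSort T f)"
    if "f \<in> Ops T" "Op B f a = Some b" "\<And>k. k \<in> Arity T f \<Longrightarrow> a k \<in> Z (ArgSort T f k)" for f a b
    using Z that by (simp add: closed_family_def)
  interpret initial_lift T "{()}" "\<lambda>_. B" Z "\<lambda>_ s. \<lambda>x\<in>Z s. x"
  proof
    show "small TYPE('a) (Z s)" if "s \<in> Sorts T" for s
      using small_subset[OF sub model_small[OF B that]] .
    show "x \<in> Z s \<Longrightarrow> s \<in> Sorts T" for x s using sub model_sort[OF B] by blast
    fix f a assume f: "f \<in> Ops T" and a: "a \<in> (\<Pi>\<^sub>E k\<in>Arity T f. Z (ArgSort T f k))"
      and def: "\<And>i. i \<in> {()} \<Longrightarrow> Op B f (\<lambda>i\<in>Arity T f. restrict (\<lambda>x. x) (Z (ArgSort T f i)) (a i)) \<noteq> None"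
    have eq: "(\<lambda>i\<in>Arity T f. restrict (\<lambda>x. x) (Z (ArgSort T f i)) (a i)) = a"
      using a by (auto simp: PiE_iff extensional_def fun_eq_iff)
    obtain b where b: "Op B f a = Some b" using def eq by auto
    moreover have "b \<in> Z (ResSort T f)" using cl[OF f b] a by auto
    ultimately show "\<exists>b\<in>Z (ResSort T f). \<forall>i\<in>{()}. Op B f (\<lambda>i\<in>Arity T f. restrict (\<lambda>x. x) (Z (ArgSort T f i)) (a i)) =
        Some (restrict (\<lambda>x. x) (Z (ResSort T f)) b)"
      using eq by auto
  qed (use T B sub in auto)
  show thesis
  proof (rule that[OF is_model_lift_model Carr_lift_model])
    show "is_hom T lift_model B (\<lambda>s. \<lambda>x\<in>Z s. x)" using is_hom_p by simp
    fix A h assume A: "is_model T A" and h: "is_hom T A B h" and hZ: "\<And>s x. x \<in> Carr A s \<Longrightarrow> h s x \<in> Z s"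
    have "compose (Carr A s) (\<lambda>x\<in>Z s. x) (h s) = h s" for s
      using hZ is_hom_funcset[OF h, of s] by (auto simp: compose_def PiE_iff extensional_def fun_eq_iff)
    then show "is_hom T A lift_model h"
      using hZ is_hom_funcset[OF h] h by (intro is_hom_into_lift_model[OF A]) (auto simp: PiE_iff)
  qed
qed

text \<open>The initial lift of the set-level fibre product along its two projections, indexed by
  the booleans. Pairs are coded by \<open>enc\<close> because carriers consist of elements of
  \<open>'u\<close>. The second conclusion exposes the elements over compatible pairs, which the
  universal property does not display.\<close>

lemma pullback_Mod:
  assumes U: "universe TYPE('u)" and T: "wf_theory (T :: 'u ea_theory)"
    and A: "is_model T A" and B: "is_model T B" and D: "is_model T D"
    and h: "is_hom T A D h" and k: "is_hom T B D k"
  obtains P p q where "is_pullback (Mod T) (A, h, D) (B, k, D) (P, p, A) (P, q, B)"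
    "\<And>s x y. x \<in> Carr A s \<Longrightarrow> y \<in> Carr B s \<Longrightarrow> h s x = k s y \<Longrightarrow> \<exists>z\<in>Carr P s. p s z = x \<and> q s z = y"
proof -
  define R where "R s = {(x, y) \<in> Carr A s \<times> Carr B s. h s x = k s y}" for s
  have "\<exists>f :: 'u \<times> 'u \<Rightarrow> 'u. inj f"
    using card_of_Times_same_infinite[OF universe_infinite[OF U]]
    unfolding card_of_ordIso[symmetric] by (auto simp: bij_betw_def)
  then obtain enc :: "'u \<times> 'u \<Rightarrow> 'u" where enc: "inj enc" by blast
  let ?dec = "Hilbert_Choice.inv enc"
  have dec [simp]: "?dec (enc z) = z" for z using enc by simp
  define Car where "Car s = enc ` R s" for s
  define pr where "pr b s = (\<lambda>z\<in>Car s. (if b then fst else snd) (?dec z))" for b s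
  have pr_simps: "pr True s (enc (x, y)) = x" "pr False s (enc (x, y)) = y" if "(x, y) \<in> R s" for s x y
    using that by (auto simp: pr_def Car_def)
  interpret initial_lift T "UNIV :: bool set" "\<lambda>b. if b then A else B" Car pr
  proof
    show "small TYPE('u) (Car s)" if "s \<in> Sorts T" for s
      unfolding Car_def
      by (rule small_image, rule small_subset[OF _ small_Times[OF U model_small[OF A that] model_small[OF B that]]])
        (auto simp: R_def)
    show "x \<in> Car s \<Longrightarrow> s \<in> Sorts T" for x s using model_sort[OF A] by (auto simp: Car_def R_def)
    show "pr b s \<in> Car s \<rightarrow>\<^sub>E Carr (if b then A else B) s" for b s
      by (auto simp: Car_def pr_def R_def)
    show "x = y" if x: "x \<in> Car s" "y \<in> Car s" and "\<And>i. i \<in> UNIV \<Longrightarrow> pr i s x = pr i s y" for x y s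
    proof -
      have "pr True s x = pr True s y" "pr False s x = pr False s y" using that(3) by auto
      then show ?thesis using x by (auto simp: Car_def pr_simps)
    qed
    fix f a assume f: "f \<in> Ops T" and a: "a \<in> (\<Pi>\<^sub>E k\<in>Arity T f. Car (ArgSort T f k))"
      and def: "\<And>i. i \<in> UNIV \<Longrightarrow> Op (if i then A else B) f (map_args T (pr i) f a) \<noteq> None"
    obtain x where x: "Op A f (map_args T (pr True) f a) = Some x" using def[of True] by auto
    obtain y where y: "Op B f (map_args T (pr False) f a) = Some y" using def[of False] by auto
    have "h (ArgSort T f i) (pr True (ArgSort T f i) (a i)) = k (ArgSort T f i) (pr False (ArgSort T f i) (a i))"
      if "i \<in> Arity T f" for i
    proof -
      have "a i \<in> Car (ArgSort T f i)" using a that by auto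
      then show ?thesis by (auto simp: Car_def pr_simps) (auto simp: R_def)
    qed
    then have "map_args T h f (map_args T (pr True) f a) = map_args T k f (map_args T (pr False) f a)"
      by (auto intro!: restrict_ext)
    then have "h (ResSort T f) x = k (ResSort T f) y"
      using is_hom_Op[OF h f x] is_hom_Op[OF k f y] by simp
    then have xy: "(x, y) \<in> R (ResSort T f)"
      using model_result[OF A f x] model_result[OF B f y] by (simp add: R_def)
    show "\<exists>b\<in>Car (ResSort T f). \<forall>i\<in>UNIV. Op (if i then A else B) f (map_args T (pr i) f a) = Some (pr i (ResSort T f) b)"
    proof (intro bexI ballI)
      show "Op (if i then A else B) f (map_args T (pr i) f a) = Some (pr i (ResSort T f) (enc (x, y)))" for i
        using x y xy by (cases i) (simp_all add: pr_simps)
      show "enc (x, y) \<in> Car (ResSort T f)" using xy by (simp add: Car_def)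
    qed
  qed (use T A B in auto)
  have prA: "is_hom T lift_model A (pr True)" and prB: "is_hom T lift_model B (pr False)"
    using is_hom_p[of True] is_hom_p[of False] by simp_all
  have "is_pullback (Mod T) (A, h, D) (B, k, D) (lift_model, pr True, A) (lift_model, pr False, B)"
    unfolding is_pullback_def
  proof (intro conjI ballI impI; (elim conjE)?)
    have "compose (Car s) (h s) (pr True s) = compose (Car s) (k s) (pr False s)" for s
      by (auto simp: compose_def fun_eq_iff Car_def pr_simps) (auto simp: R_def)
    then show "Comp (Mod T) (A, h, D) (lift_model, pr True, A) = Comp (Mod T) (B, k, D) (lift_model, pr False, B)"
      by simp
    fix a b
    assume ab: "a \<in> Arr (Mod T)" "b \<in> Arr (Mod T)" "Dom (Mod T) a = Dom (Mod T) b"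
      "Cod (Mod T) a = Dom (Mod T) (A, h, D)" "Cod (Mod T) b = Dom (Mod T) (B, k, D)"
      "Comp (Mod T) (A, h, D) a = Comp (Mod T) (B, k, D) b"
    obtain X a' A' where a': "a = (X, a', A')" by (cases a)
    obtain X' b' B' where b': "b = (X', b', B')" by (cases b)
    have eqs: "X' = X" "A' = A" "B' = B" using ab a' b' by auto
    have X: "is_model T X" and ha: "is_hom T X A a'" and hb: "is_hom T X B b'"
      using ab a' b' eqs by auto
    have "compose (Carr X s) (h s) (a' s) = compose (Carr X s) (k s) (b' s)" for s
      using ab(6) by (simp add: a' b' eqs fun_eq_iff)
    then have "h s (a' s x) = k s (b' s x)" if "x \<in> Carr X s" for s x
      using that by (metis compose_eq)
    then have R: "(a' s x, b' s x) \<in> R s" if "x \<in> Carr X s" for s x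
      using that is_hom_mem[OF ha] is_hom_mem[OF hb] by (auto simp: R_def)
    define u where "u s = (\<lambda>x\<in>Carr X s. enc (a' s x, b' s x))" for s
    have ua: "compose (Carr X s) (pr True s) (u s) = a' s" and ub: "compose (Carr X s) (pr False s) (u s) = b' s" for s
      using is_hom_funcset[OF ha, of s] is_hom_funcset[OF hb, of s]
      by (auto simp: u_def compose_def fun_eq_iff pr_simps R PiE_iff extensional_def)
    have u: "is_hom T X lift_model u"
    proof (rule is_hom_into_lift_model[OF X])
      show "u s \<in> Carr X s \<rightarrow>\<^sub>E Car s" for s using R by (auto simp: u_def Car_def)
      show "is_hom T X (if i then A else B) (\<lambda>s. compose (Carr X s) (pr i s) (u s))" for i
        using ha hb by (cases i) (simp_all add: ua ub)
    qed
    show "\<exists>!v. v \<in> Hom (Mod T) (Dom (Mod T) a) (Dom (Mod T) (lift_model, pr True, A)) \<and>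
          Comp (Mod T) (lift_model, pr True, A) v = a \<and> Comp (Mod T) (lift_model, pr False, B) v = b"
    proof (rule ex1I[of _ "(X, u, lift_model)"])
      show "(X, u, lift_model) \<in> Hom (Mod T) (Dom (Mod T) a) (Dom (Mod T) (lift_model, pr True, A)) \<and>
          Comp (Mod T) (lift_model, pr True, A) (X, u, lift_model) = a \<and>
          Comp (Mod T) (lift_model, pr False, B) (X, u, lift_model) = b"
        using u X is_model_lift_model by (simp add: Hom_def a' b' eqs ua ub)
      fix v assume v: "v \<in> Hom (Mod T) (Dom (Mod T) a) (Dom (Mod T) (lift_model, pr True, A)) \<and>
          Comp (Mod T) (lift_model, pr True, A) v = a \<and> Comp (Mod T) (lift_model, pr False, B) v = b"
      then obtain w where w: "v = (X, w, lift_model)" "is_hom T X lift_model w"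
        by (cases v) (auto simp: Hom_def a')
      have wa: "\<And>s. compose (Carr X s) (pr True s) (w s) = a' s" and wb: "\<And>s. compose (Carr X s) (pr False s) (w s) = b' s"
        using v w by (auto simp: a' b' eqs)
      have "w = u"
      proof (rule is_hom_eqI[OF w(2) u])
        fix s x assume x: "x \<in> Carr X s"
        show "w s x = u s x"
        proof (rule joint)
          show "w s x \<in> Car s" "u s x \<in> Car s"
            using is_hom_mem[OF w(2) x] is_hom_mem[OF u x] by simp_all
          show "pr i s (w s x) = pr i s (u s x)" for i
            using fun_cong[OF wa, of s x] fun_cong[OF wb, of s x] fun_cong[OF ua, of s x] fun_cong[OF ub, of s x] x
            by (cases i) (simp_all add: compose_eq)
        qed
      qed
      then show "v = (X, u, lift_model)" using w by simp
    qed
  qed (use A B D h k prA prB is_model_lift_model in simp_all)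
  then show thesis
  proof (rule that)
    fix s x y assume "x \<in> Carr A s" "y \<in> Carr B s" "h s x = k s y"
    then show "\<exists>z\<in>Carr lift_model s. pr True s z = x \<and> pr False s z = y"
      by (intro bexI[of _ "enc (x, y)"]) (auto simp: Car_def pr_simps R_def)
  qed
qed

section \<open>Monomorphisms, isomorphisms and factorizations of models\<close>

text \<open>For the forward direction, the two projections of the kernel pair of a mono coincide,
  while every pair of identified elements occurs in the explicit kernel pair.\<close>

lemma is_mono_Mod_iff:
  assumes U: "universe TYPE('u)" and T: "wf_theory (T :: 'u ea_theory)"
  shows "is_mono (Mod T) (A, h, B) \<longleftrightarrow>
    is_model T A \<and> is_model T B \<and> is_hom T A B h \<and> (\<forall>s. inj_on (h s) (Carr A s))"
proof (intro iffI)
  assume m: "is_mono (Mod T) (A, h, B)"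
  then have A: "is_model T A" and B: "is_model T B" and h: "is_hom T A B h"
    by (auto simp: is_mono_def)
  obtain P p q where pb: "is_pullback (Mod T) (A, h, B) (A, h, B) (P, p, A) (P, q, A)"
    and pq: "\<And>s x y. x \<in> Carr A s \<Longrightarrow> y \<in> Carr A s \<Longrightarrow> h s x = h s y \<Longrightarrow> \<exists>z\<in>Carr P s. p s z = x \<and> q s z = y"
    by (rule pullback_Mod[OF U T A A B h h], rule that)
  have "(P, p, A) = (P, q, A)"
    by (rule Mod.mono_cancel[OF m]) (use pb in \<open>auto simp: is_pullback_def\<close>)
  then have "inj_on (h s) (Carr A s)" for s using pq by (intro inj_onI) fastforce
  then show "is_model T A \<and> is_model T B \<and> is_hom T A B h \<and> (\<forall>s. inj_on (h s) (Carr A s))"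
    using A B h by simp
next
  assume *: "is_model T A \<and> is_model T B \<and> is_hom T A B h \<and> (\<forall>s. inj_on (h s) (Carr A s))"
  show "is_mono (Mod T) (A, h, B)"
    unfolding is_mono_def
  proof (intro conjI ballI impI; (elim conjE)?)
    fix f g assume fg: "f \<in> Arr (Mod T)" "g \<in> Arr (Mod T)" "Dom (Mod T) f = Dom (Mod T) g"
      "Cod (Mod T) f = Dom (Mod T) (A, h, B)" "Cod (Mod T) g = Dom (Mod T) (A, h, B)"
      "Comp (Mod T) (A, h, B) f = Comp (Mod T) (A, h, B) g"
    obtain X f' where f': "f = (X, f', A)" "is_hom T X A f'" using fg by (cases f) auto
    obtain g' where g': "g = (X, g', A)" "is_hom T X A g'" using fg f' by (cases g) auto
    have "f' = g'"
    proof (rule is_hom_eqI[OF f'(2) g'(2)])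
      fix s x assume x: "x \<in> Carr X s"
      have "compose (Carr X s) (h s) (f' s) = compose (Carr X s) (h s) (g' s)"
        using fg(6) f' g' by (simp add: fun_eq_iff)
      then have "h s (f' s x) = h s (g' s x)" using x by (metis compose_eq)
      then show "f' s x = g' s x"
        using * is_hom_mem[OF f'(2) x] is_hom_mem[OF g'(2) x] by (auto dest: inj_onD)
    qed
    then show "f = g" using f' g' by simp
  qed (use * in simp)
qed

text \<open>For partial operations it is not automatic that the inverse map is a homomorphism; it is
  one because injective homomorphisms reflect definedness.\<close>

lemma bij_hom_iso:
  assumes T: "wf_theory T" and A: "is_model T A" and B: "is_model T B" and h: "is_hom T A B h"
    and bij: "\<And>s. bij_betw (h s) (Carr A s) (Carr B s)"
  shows "is_iso (Mod T) (A, h, B)"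
proof -
  define k where "k s = (\<lambda>y\<in>Carr B s. inv_into (Carr A s) (h s) y)" for s
  have inj: "inj_on (h s) (Carr A s)" and surj: "h s ` Carr A s = Carr B s" for s
    using bij by (auto simp: bij_betw_def)
  have k_mem: "k s y \<in> Carr A s" and hk: "h s (k s y) = y" if "y \<in> Carr B s" for s y
    using that surj by (auto simp: k_def inv_into_into f_inv_into_f)
  have kh: "k s (h s x) = x" if "x \<in> Carr A s" for s x
    using that inj is_hom_mem[OF h that] by (simp add: k_def)
  have k: "is_hom T B A k"
    unfolding is_hom_def
  proof (intro conjI allI ballI impI)
    show "k s \<in> Carr B s \<rightarrow>\<^sub>E Carr A s" for s using k_mem by (auto simp: PiE_iff k_def)
    fix f a b assume f: "f \<in> Ops T" "Op B f a = Some b"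
    have a: "a \<in> args T B f" using model_args[OF B f] .
    then have ka: "map_args T k f a \<in> args T A f" using k_mem by (intro map_args_mem)
    have hka: "map_args T h f (map_args T k f a) = a"
      using a hk by (auto simp: args_def PiE_iff extensional_def fun_eq_iff)
    then obtain c where c: "Op A f (map_args T k f a) = Some c"
      using inj_hom_reflects_defined[OF T A B h inj f(1) ka] f by auto
    then have "h (ResSort T f) c = b" using is_hom_Op[OF h f(1) c] hka f by simp
    then show "Op A f (map_args T k f a) = Some (k (ResSort T f) b)"
      using c kh[OF model_result[OF A f(1) c]] by auto
  qed
  show ?thesis
    by (rule Mod.is_isoI[of _ _ "(B, k, A)"])
      (use A B h k in \<open>auto simp: compose_def fun_eq_iff hk kh\<close>)
qed

text \<open>The set-theoretic image need not be closed under the operations, so the middle object is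
  the least closed family \<open>Z\<close> containing it. Both the cancellation property of
  \<open>?e\<close> and the lifting property follow from minimality: the elements on which two
  arrows agree, or to which a diagonal extends, form a closed family containing the image.\<close>

lemma factorization_Mod:
  assumes U: "universe TYPE('u)" and T: "wf_theory (T :: 'u ea_theory)" and f: "f \<in> Arr (Mod T)"
  shows "\<exists>e\<in>strong_epis (Mod T). \<exists>m\<in>mono_arrs (Mod T). Cod (Mod T) e = Dom (Mod T) m \<and> f = Comp (Mod T) m e"
proof -
  obtain A h B where fh: "f = (A, h, B)" by (cases f)
  then have A: "is_model T A" and B: "is_model T B" and h: "is_hom T A B h" using f by auto
  define Z where "Z s = \<Inter>{Z' s |Z'. closed_family T B Z' \<and> (\<forall>s x. x \<in> Carr A s \<longrightarrow> h s x \<in> Z' s)}" for s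
  have Z_least: "Z s \<subseteq> Z' s" if "closed_family T B Z'" "\<And>s x. x \<in> Carr A s \<Longrightarrow> h s x \<in> Z' s" for Z' s
    using that unfolding Z_def by blast
  have hZ: "h s x \<in> Z s" if "x \<in> Carr A s" for s x using that unfolding Z_def by blast
  have "closed_family T B (Carr B)" using model_result[OF B] by (auto simp: closed_family_def)
  then have ZB: "Z s \<subseteq> Carr B s" for s using Z_least is_hom_mem[OF h] by blast
  have Z: "closed_family T B Z"
    unfolding closed_family_def
  proof (intro conjI allI ballI impI ZB)
    fix f a b assume f: "f \<in> Ops T" "Op B f a = Some b" "\<forall>k\<in>Arity T f. a k \<in> Z (ArgSort T f k)"
    show "b \<in> Z (ResSort T f)"
      unfolding Z_def
    proof (clarify)
      fix Z' assume Z': "closed_family T B Z'" "\<forall>s x. x \<in> Carr A s \<longrightarrow> h s x \<in> Z' s"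
      then have "\<forall>k\<in>Arity T f. a k \<in> Z' (ArgSort T f k)" using f Z_least by blast
      then show "b \<in> Z' (ResSort T f)" using Z' f by (auto simp: closed_family_def)
    qed
  qed
  obtain S where S: "is_model T S" "Carr S = Z" and incl: "is_hom T S B (\<lambda>s. \<lambda>x\<in>Z s. x)"
    and lift: "\<And>A h. is_model T A \<Longrightarrow> is_hom T A B h \<Longrightarrow> (\<And>s x. x \<in> Carr A s \<Longrightarrow> h s x \<in> Z s) \<Longrightarrow> is_hom T A S h"
    using submodel[OF T B Z] by metis
  have hS: "is_hom T A S h" using lift[OF A h hZ] .
  let ?m = "(S, \<lambda>s. \<lambda>x\<in>Z s. x, B)" and ?e = "(A, h, S)"
  have opS: "Op B f a = Some b" if "f \<in> Ops T" "Op S f a = Some b" for f a b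
  proof -
    have "a \<in> args T S f" "b \<in> Carr S (ResSort T f)" using model_args[OF S(1) that] model_result[OF S(1) that] .
    moreover from this have "map_args T (\<lambda>s. \<lambda>x\<in>Z s. x) f a = a"
      by (auto simp: args_def S PiE_iff extensional_def fun_eq_iff)
    ultimately show ?thesis using is_hom_Op[OF incl that] S by simp
  qed
  have defS: "Op S f a = Some b" if "f \<in> Ops T" "Op B f a = Some b" "\<And>k. k \<in> Arity T f \<Longrightarrow> a k \<in> Z (ArgSort T f k)" for f a b
  proof -
    have a: "a \<in> args T S f" using model_args[OF B that(1,2)] that(3) by (auto simp: args_def S PiE_iff)
    moreover have "map_args T (\<lambda>s. \<lambda>x\<in>Z s. x) f a = a"
      using a by (auto simp: args_def S PiE_iff extensional_def fun_eq_iff)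
    ultimately have "Op S f a \<noteq> None"
      using inj_hom_reflects_defined[OF T S(1) B incl _ that(1) a] that(2) S by (auto simp: inj_on_def)
    then show ?thesis using opS[OF that(1)] that(2) by fastforce
  qed
  have m: "is_mono (Mod T) ?m"
    unfolding is_mono_Mod_iff[OF U T] using S B incl by (auto simp: inj_on_def)
  have epi: "is_epi (Mod T) ?e"
    unfolding is_epi_def
  proof (intro conjI ballI impI; (elim conjE)?)
    show "?e \<in> Arr (Mod T)" using A S hS by simp
    fix u v assume uv: "u \<in> Arr (Mod T)" "v \<in> Arr (Mod T)" "Cod (Mod T) u = Cod (Mod T) v"
      "Dom (Mod T) u = Cod (Mod T) ?e" "Dom (Mod T) v = Cod (Mod T) ?e" "Comp (Mod T) u ?e = Comp (Mod T) v ?e"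
    obtain D u' where u': "u = (S, u', D)" "is_hom T S D u'" using uv by (cases u) auto
    obtain v' where v': "v = (S, v', D)" "is_hom T S D v'" using uv u' by (cases v) auto
    let ?E = "\<lambda>s. {z \<in> Z s. u' s z = v' s z}"
    have "closed_family T B ?E"
      unfolding closed_family_def
    proof (intro conjI allI ballI impI)
      show "?E s \<subseteq> Carr B s" for s using ZB by auto
      fix f a b assume f: "f \<in> Ops T" "Op B f a = Some b" "\<forall>k\<in>Arity T f. a k \<in> ?E (ArgSort T f k)"
      have b: "Op S f a = Some b" using defS f by auto
      have "map_args T u' f a = map_args T v' f a" using f by (auto intro!: restrict_ext)
      then have "u' (ResSort T f) b = v' (ResSort T f) b"
        using is_hom_Op[OF u'(2) f(1) b] is_hom_Op[OF v'(2) f(1) b] by simp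
      then show "b \<in> ?E (ResSort T f)" using model_result[OF S(1) f(1) b] S by simp
    qed
    moreover have "h s x \<in> ?E s" if "x \<in> Carr A s" for s x
    proof -
      have "compose (Carr A s) (u' s) (h s) = compose (Carr A s) (v' s) (h s)"
        using uv(6) u' v' by (simp add: fun_eq_iff)
      then show ?thesis using that hZ by (simp add: compose_def fun_eq_iff) metis
    qed
    ultimately have "Z s \<subseteq> ?E s" for s by (rule Z_least)
    then have "u' = v'" using S by (intro is_hom_eqI[OF u'(2) v'(2)]) auto
    then show "u = v" using u' v' by simp
  qed
  have "orthogonal (Mod T) ?e n" if n: "is_mono (Mod T) n" for n
  proof (rule Mod.orthogonalI[OF epi Mod.is_mono_Arr[OF n]])
    fix u v assume uv: "u \<in> Arr (Mod T)" "v \<in> Arr (Mod T)" "Dom (Mod T) u = Dom (Mod T) ?e"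
      "Cod (Mod T) u = Dom (Mod T) n" "Dom (Mod T) v = Cod (Mod T) ?e" "Cod (Mod T) v = Cod (Mod T) n"
      "Comp (Mod T) n u = Comp (Mod T) v ?e"
    obtain X n' Y where n': "n = (X, n', Y)" by (cases n)
    have X: "is_model T X" "is_model T Y" "is_hom T X Y n'" and inj: "inj_on (n' s) (Carr X s)" for s
      using n unfolding n' is_mono_Mod_iff[OF U T] by auto
    obtain u' where u': "u = (A, u', X)" "is_hom T A X u'" using uv n' by (cases u) auto
    obtain v' where v': "v = (S, v', Y)" "is_hom T S Y v'" using uv n' by (cases v) auto
    have nu: "n' s (u' s x) = v' s (h s x)" if "x \<in> Carr A s" for s x
    proof -
      have "compose (Carr A s) (n' s) (u' s) = compose (Carr A s) (v' s) (h s)"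
        using uv(7) u' v' n' by (simp add: fun_eq_iff)
      then show ?thesis using that by (metis compose_eq)
    qed
    \<comment> \<open>The diagonal is forced, as \<open>n'\<close> is injective: it must choose
      preimages of the values of \<open>v'\<close>. Such preimages are known only on
      \<open>?E\<close> until minimality of \<open>Z\<close> shows that \<open>?E\<close> is
      everything.\<close>
    define d where "d s = (\<lambda>z\<in>Z s. inv_into (Carr X s) (n' s) (v' s z))" for s
    let ?E = "\<lambda>s. {z \<in> Z s. v' s z \<in> n' s ` Carr X s}"
    have nd: "n' s (d s z) = v' s z" and d_mem: "d s z \<in> Carr X s" if "z \<in> ?E s" for s z
      using that by (auto simp: d_def f_inv_into_f inv_into_into)
    have step: "\<exists>c. Op X f (map_args T d f a) = Some c \<and> n' (ResSort T f) c = v' (ResSort T f) b"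
      if f: "f \<in> Ops T" "Op S f a = Some b" "\<forall>k\<in>Arity T f. a k \<in> ?E (ArgSort T f k)" for f a b
    proof -
      have da: "map_args T d f a \<in> args T X f" using d_mem f by (auto simp: args_def)
      have "map_args T n' f (map_args T d f a) = map_args T v' f a"
        using f nd by (auto intro!: restrict_ext)
      moreover have vb: "Op Y f (map_args T v' f a) = Some (v' (ResSort T f) b)"
        using is_hom_Op[OF v'(2) f(1,2)] .
      ultimately obtain c where c: "Op X f (map_args T d f a) = Some c"
        using inj_hom_reflects_defined[OF T X inj f(1) da] by auto
      show ?thesis
        using c is_hom_Op[OF X(3) f(1) c] vb \<open>map_args T n' f (map_args T d f a) = map_args T v' f a\<close> by simp
    qed
    have "closed_family T B ?E"
      unfolding closed_family_def
    proof (intro conjI allI ballI impI)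
      show "?E s \<subseteq> Carr B s" for s using ZB by auto
      fix f a b assume f: "f \<in> Ops T" "Op B f a = Some b" "\<forall>k\<in>Arity T f. a k \<in> ?E (ArgSort T f k)"
      have b: "Op S f a = Some b" using defS f by auto
      obtain c where "Op X f (map_args T d f a) = Some c" "n' (ResSort T f) c = v' (ResSort T f) b"
        using step[OF f(1) b f(3)] by blast
      then have "v' (ResSort T f) b \<in> n' (ResSort T f) ` Carr X (ResSort T f)"
        using model_result[OF X(1) f(1)] by (metis imageI)
      then show "b \<in> ?E (ResSort T f)" using model_result[OF S(1) f(1) b] S by simp
    qed
    moreover have "h s x \<in> ?E s" if "x \<in> Carr A s" for s x
      using that hZ nu[OF that] is_hom_mem[OF u'(2) that] by (metis (mono_tags, lifting) image_eqI mem_Collect_eq)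
    ultimately have "Z s \<subseteq> ?E s" for s by (rule Z_least)
    then have E: "z \<in> ?E s" if "z \<in> Z s" for s z using that by blast
    have d: "is_hom T S X d"
      unfolding is_hom_def
    proof (intro conjI allI ballI impI)
      show "d s \<in> Carr S s \<rightarrow>\<^sub>E Carr X s" for s
        using d_mem[OF E] by (auto simp: S PiE_iff extensional_def d_def)
      fix f a b assume f: "f \<in> Ops T" "Op S f a = Some b"
      have a: "\<forall>k\<in>Arity T f. a k \<in> ?E (ArgSort T f k)"
        using model_args[OF S(1) f] E by (auto simp: args_def S)
      obtain c where c: "Op X f (map_args T d f a) = Some c" "n' (ResSort T f) c = v' (ResSort T f) b"
        using step[OF f a] by blast
      have "b \<in> Z (ResSort T f)" using model_result[OF S(1) f] S by simp
      from nd[OF E[OF this]] d_mem[OF E[OF this]] have "c = d (ResSort T f) b"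
        by (intro inj_onD[OF inj _ model_result[OF X(1) f(1) c(1)]]) (simp_all add: c(2))
      then show "Op X f (map_args T d f a) = Some (d (ResSort T f) b)" using c by simp
    qed
    have "d s (h s x) = u' s x" if "x \<in> Carr A s" for s x
      using nd[OF E[OF hZ[OF that]]] d_mem[OF E[OF hZ[OF that]]] nu[OF that] inj is_hom_mem[OF u'(2) that] by (metis inj_onD)
    then have "compose (Carr A s) (d s) (h s) = u' s" for s
      using is_hom_funcset[OF u'(2), of s] by (auto simp: compose_def fun_eq_iff PiE_iff extensional_def)
    moreover have "compose (Z s) (n' s) (d s) = v' s" for s
      using is_hom_funcset[OF v'(2), of s] nd[OF E] S by (auto simp: compose_def fun_eq_iff PiE_iff extensional_def)
    ultimately show "\<exists>d\<in>Arr (Mod T). Dom (Mod T) d = Cod (Mod T) ?e \<and> Cod (Mod T) d = Dom (Mod T) n \<and>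
        Comp (Mod T) d ?e = u \<and> Comp (Mod T) n d = v"
      using d S X by (intro bexI[of _ "(S, d, X)"]) (simp_all add: n' u' v')
  qed
  then have "?e \<in> strong_epis (Mod T)" using epi by (auto simp: strong_epis_def mono_arrs_def)
  moreover have "f = Comp (Mod T) ?m ?e"
    using hZ is_hom_funcset[OF h] by (auto simp: fh compose_def fun_eq_iff PiE_iff extensional_def)
  ultimately show ?thesis using m by (intro bexI[of _ ?e] bexI[of _ ?m]) (simp_all add: mono_arrs_def)
qed

section \<open>Size of a generated family of functions\<close>

text \<open>An operation applies only where it is defined in every component, which is its domain in
  the product. The product is handled as a set of bare functions because it may be too large to be a
  model; \<open>extensional\<close> makes a function determined by its components.\<close>

inductive generated ::
  "'u ea_theory \<Rightarrow> 'i set \<Rightarrow> ('i \<Rightarrow> 'u model) \<Rightarrow> ('u \<Rightarrow> ('i \<Rightarrow> 'u) set) \<Rightarrow> 'u \<Rightarrow> ('i \<Rightarrow> 'u) \<Rightarrow> bool"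
  for T I P G where
  base: "z \<in> G s \<Longrightarrow> generated T I P G s z"
| op: "f \<in> Ops T \<Longrightarrow> (\<And>k. k \<in> Arity T f \<Longrightarrow> generated T I P G (ArgSort T f k) (z k)) \<Longrightarrow>
    (\<And>i. i \<in> I \<Longrightarrow> Op (P i) f (\<lambda>k\<in>Arity T f. z k i) = Some (w i)) \<Longrightarrow> w \<in> extensional I \<Longrightarrow>
    generated T I P G (ResSort T f) w"

text \<open>
  An element of the generated family is coded by a construction tree, given as the set of pairs
  (path from the root, label of the node reached). There are only few codes, which bounds the
  family although the index set \<open>I\<close> may be large.
\<close>

inductive coded ::
  "'u ea_theory \<Rightarrow> 'i set \<Rightarrow> ('i \<Rightarrow> 'u model) \<Rightarrow> ('u \<Rightarrow> ('i \<Rightarrow> 'u) set) \<Rightarrow> 'u \<Rightarrow> ('i \<Rightarrow> 'u) \<Rightarrow>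
   ('u list \<times> ('u \<times> ('i \<Rightarrow> 'u) + 'u)) set \<Rightarrow> bool"
  for T I P G where
  base: "z \<in> G s \<Longrightarrow> coded T I P G s z {([], Inl (s, z))}"
| op: "f \<in> Ops T \<Longrightarrow> (\<And>k. k \<in> Arity T f \<Longrightarrow> coded T I P G (ArgSort T f k) (z k) (c k)) \<Longrightarrow>
    (\<And>i. i \<in> I \<Longrightarrow> Op (P i) f (\<lambda>k\<in>Arity T f. z k i) = Some (w i)) \<Longrightarrow> w \<in> extensional I \<Longrightarrow>
    coded T I P G (ResSort T f) w (insert ([], Inr f) {(k # q, l) |k q l. k \<in> Arity T f \<and> (q, l) \<in> c k})"

lemma generated_coded: "generated T I P G s z \<Longrightarrow> \<exists>c. coded T I P G s z c"
proof (induction rule: generated.induct)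
  case (op f z w)
  then obtain c where "\<And>k. k \<in> Arity T f \<Longrightarrow> coded T I P G (ArgSort T f k) (z k) (c k)" by metis
  then show ?case using coded.op[OF op.hyps(1) _ op.hyps(3,4)] by blast
qed (blast intro: coded.base)

lemma coded_subset:
  "coded T I P G s z c \<Longrightarrow>
    c \<subseteq> lists (\<Union>f\<in>Ops T. Arity T f) \<times> (Inl ` {(s, z). z \<in> G s} \<union> Inr ` Ops T)"
proof (induction rule: coded.induct)
  case (op f z c w)
  show ?case
  proof (intro insert_subsetI subsetI)
    show "([], Inr f) \<in> lists (\<Union>f\<in>Ops T. Arity T f) \<times> (Inl ` {(s, z). z \<in> G s} \<union> Inr ` Ops T)"
      using op by simp
    fix x assume "x \<in> {(k # q, l) |k q l. k \<in> Arity T f \<and> (q, l) \<in> c k}"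
    then obtain k q l where x: "x = (k # q, l)" "k \<in> Arity T f" "(q, l) \<in> c k" by blast
    then have "(q, l) \<in> lists (\<Union>f\<in>Ops T. Arity T f) \<times> (Inl ` {(s, z). z \<in> G s} \<union> Inr ` Ops T)"
      using op.IH by blast
    then show "x \<in> lists (\<Union>f\<in>Ops T. Arity T f) \<times> (Inl ` {(s, z). z \<in> G s} \<union> Inr ` Ops T)"
      using x op.hyps(1) by auto
  qed
qed simp

text \<open>The label at the empty path reveals the last rule applied, and cutting the first entry
  off the remaining paths recovers the code of each argument. Since operations are single-valued,
  the coded element is determined.\<close>

lemma coded_unique:
  "coded T I P G s z c \<Longrightarrow> coded T I P G s' z' c \<Longrightarrow> s = s' \<and> z = z'"
proof (induction arbitrary: s' z' rule: coded.induct)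
  case (base z s)
  from base(2) show ?case by cases auto
next
  case (op f z c w)
  from op.prems show ?case
  proof cases
    case (op f' y d)
    have "([], Inr f') \<in> insert ([], Inr f) {(k # q, l) |k q l. k \<in> Arity T f \<and> (q, l) \<in> c k}"
      unfolding op(2) by simp
    then have f: "f' = f" by simp
    \<comment> \<open>The subcode at \<open>k\<close> consists of the paths that begin with
      \<open>k\<close>, so it can be read off the whole code.\<close>
    have "d k = c k" if "k \<in> Arity T f" for k
    proof -
      have "(q, l) \<in> d k \<longleftrightarrow> (q, l) \<in> c k" for q l
        using op(2) that f by (auto simp: set_eq_iff dest!: spec[of _ "k # q"] spec[of _ l])
      then show ?thesis by auto
    qed
    then have "y k = z k" if "k \<in> Arity T f" for k using op(4)[of k] op.IH f that by metis
    then have "(\<lambda>k\<in>Arity T f. y k i) = (\<lambda>k\<in>Arity T f. z k i)" for i by (auto intro!: restrict_ext)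
    then have "z' i = w i" if "i \<in> I" for i
      using op(5)[OF that] op.hyps(3)[OF that] f by (metis option.inject)
    then show ?thesis using op f op.hyps(4) by (auto intro: extensionalityI)
  qed auto
qed

text \<open>Codes are subsets of \<open>?L\<close> and each determines its element, so the family is
  bounded by \<open>Pow ?L\<close>. The index set enters \<open>?L\<close> only through the
  generators.\<close>

lemma small_generated:
  assumes U: "universe TYPE('u)" and T: "wf_theory (T :: 'u ea_theory)"
    and G: "small TYPE('u) {(s, z). z \<in> G s}"
  shows "small TYPE('u) {z. \<exists>s. generated T I P G s z}"
proof -
  let ?L = "lists (\<Union>f\<in>Ops T. Arity T f) \<times> (Inl ` {(s, z). z \<in> G s} \<union> Inr ` Ops T)"
  have "small TYPE('u) ?L"
    by (intro small_Times small_lists small_Un small_image small_UN U wf_theoryD(2,4)[OF T] G)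
  then have L: "small TYPE('u) (Pow ?L)" by (rule small_Pow[OF U])
  show ?thesis
  proof (rule small_lepoll[OF lepoll_relational_full L])
    fix z assume "z \<in> {z. \<exists>s. generated T I P G s z}"
    then obtain s where "generated T I P G s z" by blast
    from generated_coded[OF this] obtain c where "coded T I P G s z c" ..
    then show "\<exists>c. c \<in> Pow ?L \<and> (\<exists>s. coded T I P G s z c)"
      using coded_subset[OF \<open>coded T I P G s z c\<close>] by (intro exI[of _ c] exI[of _ s] conjI PowI)
  next
    fix c z z' assume "\<exists>s. coded T I P G s z c" "\<exists>s. coded T I P G s z' c"
    then show "z = z'" by (elim exE) (drule (1) coded_unique, simp)
  qed
qed


section \<open>Pushouts of models\<close>

lemma pushout_Mod:
  assumes U: "universe TYPE('u)" and T: "wf_theory (T :: 'u ea_theory)"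
    and f0: "f0 \<in> Arr (Mod T)" and g0: "g0 \<in> Arr (Mod T)" and fg0: "Dom (Mod T) f0 = Dom (Mod T) g0"
  shows "\<exists>p q. is_pushout (Mod T) f0 g0 p q"
proof -
  obtain A f B where f0': "f0 = (A, f, B)" by (cases f0)
  obtain g B' where g0': "g0 = (A, g, B')" using fg0 f0' by (cases g0) auto
  have A: "is_model T A" and B: "is_model T B" and B': "is_model T B'"
    and f: "is_hom T A B f" and g: "is_hom T A B' g"
    using f0 g0 by (auto simp: f0' g0')
  \<comment> \<open>One index for each cocone, legs included, so that the mediating arrow to a
    cocone is simply the projection at its own index.\<close>
  define I where "I = {(D, b, c). is_model T D \<and> is_hom T B D b \<and> is_hom T B' D c \<and>
    (\<forall>s x. x \<in> Carr A s \<longrightarrow> b s (f s x) = c s (g s x))}"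
  define P :: "'u model \<times> ('u \<Rightarrow> 'u \<Rightarrow> 'u) \<times> ('u \<Rightarrow> 'u \<Rightarrow> 'u) \<Rightarrow> 'u model" where "P = fst"
  define l where "l s y = (\<lambda>i\<in>I. fst (snd i) s y)" for s y
  define r where "r s y = (\<lambda>i\<in>I. snd (snd i) s y)" for s y
  define G where "G s = l s ` Carr B s \<union> r s ` Carr B' s" for s
  let ?gen = "generated T I P G"
  have P: "is_model T (P i)" and hl: "is_hom T B (P i) (fst (snd i))" and hr: "is_hom T B' (P i) (snd (snd i))"
    and hlr: "x \<in> Carr A s \<Longrightarrow> fst (snd i) s (f s x) = snd (snd i) s (g s x)" if "i \<in> I" for i s x
    using that by (auto simp: I_def P_def)
  have "{(s, z). z \<in> G s} \<subseteq> (\<lambda>(s, y). (s, l s y)) ` Sigma (Sorts T) (Carr B) \<union> (\<lambda>(s, y). (s, r s y)) ` Sigma (Sorts T) (Carr B')"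
    using model_sort[OF B] model_sort[OF B'] by (fastforce simp: G_def)
  then have "small TYPE('u) {(s, z). z \<in> G s}"
    by (rule small_subset)
      (intro small_Un small_image small_Sigma U wf_theoryD(1)[OF T] model_small[OF B] model_small[OF B'])
  then have "small TYPE('u) {z. \<exists>s. ?gen s z}" by (rule small_generated[OF U T])
  \<comment> \<open>Smallness enters here: it allows the generated functions to be renamed as
    elements of \<open>'u\<close>, as the carriers of a model must be.\<close>
  then obtain enc :: "_ \<Rightarrow> 'u" where enc: "inj_on enc {z. \<exists>s. ?gen s z}" by (rule small_obtain_inj)
  define dec where "dec = inv_into {z. \<exists>s. ?gen s z} enc"
  have dec [simp]: "dec (enc z) = z" if "?gen s z" for s z
    using enc that by (auto simp: dec_def intro!: inv_into_f_f)
  have gen_mem: "\<forall>i\<in>I. z i \<in> Carr (P i) s" if "?gen s z" for s z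
    using that
  proof (induction rule: generated.induct)
    case (base z s)
    then show ?case using is_hom_mem[OF hl] is_hom_mem[OF hr] by (auto simp: G_def l_def r_def)
  next
    case (op f z w)
    then show ?case using model_result[OF P] by blast
  qed
  have gen_ext: "z \<in> extensional I" if "?gen s z" for s z
    using that by (induction rule: generated.induct) (auto simp: G_def l_def r_def)
  have gen_sort: "s \<in> Sorts T" if "?gen s z" for s z
    using that model_sort[OF B] model_sort[OF B'] wf_theoryD(5)[OF T]
    by (induction rule: generated.induct) (auto simp: G_def)
  define Car where "Car s = enc ` {z. ?gen s z}" for s
  define p where "p i s = (\<lambda>u\<in>Car s. dec u i)" for i s
  have p_enc: "p i s (enc z) = z i" if "?gen s z" for i s z
    using that by (auto simp: p_def Car_def)
  have enc_Car: "enc z \<in> Car s" if "?gen s z" for s z using that by (simp add: Car_def)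
  interpret initial_lift T I P Car p
  proof
    show "small TYPE('u) (Car s)" for s
      unfolding Car_def by (rule small_image, rule small_subset[OF _ \<open>small TYPE('u) {z. \<exists>s. ?gen s z}\<close>]) auto
    show "x \<in> Car s \<Longrightarrow> s \<in> Sorts T" for x s using gen_sort by (auto simp: Car_def)
    show "p i s \<in> Car s \<rightarrow>\<^sub>E Carr (P i) s" if "i \<in> I" for i s
      using gen_mem that by (auto simp: Car_def p_def)
    show "x = y" if xy: "x \<in> Car s" "y \<in> Car s" and pi: "\<And>i. i \<in> I \<Longrightarrow> p i s x = p i s y" for x y s
    proof -
      obtain z w where zw: "x = enc z" "?gen s z" "y = enc w" "?gen s w" using xy by (auto simp: Car_def)
      have "z i = w i" if "i \<in> I" for i using pi[OF that] zw by (simp add: p_enc)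
      then have "z = w" using gen_ext zw(2,4) by (intro extensionalityI)
      then show "x = y" using zw by simp
    qed
    fix f a assume f: "f \<in> Ops T" and a: "a \<in> (\<Pi>\<^sub>E k\<in>Arity T f. Car (ArgSort T f k))"
      and def: "\<And>i. i \<in> I \<Longrightarrow> Op (P i) f (map_args T (p i) f a) \<noteq> None"
    define w where "w = (\<lambda>i\<in>I. the (Op (P i) f (map_args T (p i) f a)))"
    have z: "?gen (ArgSort T f k) (dec (a k))" "enc (dec (a k)) = a k" if "k \<in> Arity T f" for k
    proof -
      have "a k \<in> Car (ArgSort T f k)" using a that by auto
      then show "?gen (ArgSort T f k) (dec (a k))" "enc (dec (a k)) = a k" by (auto simp: Car_def)
    qed
    have w: "Op (P i) f (map_args T (p i) f a) = Some (w i)" if "i \<in> I" for i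
      using def[OF that] that by (auto simp: w_def)
    have "map_args T (p i) f a = (\<lambda>k\<in>Arity T f. dec (a k) i)" for i
      by (rule restrict_ext) (metis z p_enc)
    then have gw: "?gen (ResSort T f) w"
      using z w by (intro generated.op[OF f, of I P G "\<lambda>k. dec (a k)"]) (auto simp: w_def)
    show "\<exists>b\<in>Car (ResSort T f). \<forall>i\<in>I. Op (P i) f (map_args T (p i) f a) = Some (p i (ResSort T f) b)"
      by (rule bexI[OF _ enc_Car[OF gw]]) (simp add: w p_enc[OF gw])
  qed (use T P in auto)
  define L where "L s = (\<lambda>y\<in>Carr B s. enc (l s y))" for s
  define R where "R s = (\<lambda>y\<in>Carr B' s. enc (r s y))" for s
  have gl: "?gen s (l s y)" if "y \<in> Carr B s" for s y by (rule generated.base) (simp add: G_def that)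
  have gr: "?gen s (r s y)" if "y \<in> Carr B' s" for s y by (rule generated.base) (simp add: G_def that)
  have l_apply: "l s y i = fst (snd i) s y" and r_apply: "r s y i = snd (snd i) s y" if "i \<in> I" for i s y
    using that by (simp_all add: l_def r_def)
  have pL: "compose (Carr B s) (p i s) (L s) = fst (snd i) s" if "i \<in> I" for i s
    using that is_hom_funcset[OF hl[OF that], of s]
    by (auto simp: L_def compose_def fun_eq_iff p_enc[OF gl] l_apply PiE_iff extensional_def)
  have pR: "compose (Carr B' s) (p i s) (R s) = snd (snd i) s" if "i \<in> I" for i s
    using that is_hom_funcset[OF hr[OF that], of s]
    by (auto simp: R_def compose_def fun_eq_iff p_enc[OF gr] r_apply PiE_iff extensional_def)
  have L: "is_hom T B lift_model L"
  proof (rule is_hom_into_lift_model[OF B])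
    show "L s \<in> Carr B s \<rightarrow>\<^sub>E Car s" for s by (simp add: L_def enc_Car gl)
    show "is_hom T B (P i) (\<lambda>s. compose (Carr B s) (p i s) (L s))" if "i \<in> I" for i
      using hl[OF that] by (simp only: pL[OF that])
  qed
  have R: "is_hom T B' lift_model R"
  proof (rule is_hom_into_lift_model[OF B'])
    show "R s \<in> Carr B' s \<rightarrow>\<^sub>E Car s" for s by (simp add: R_def enc_Car gr)
    show "is_hom T B' (P i) (\<lambda>s. compose (Carr B' s) (p i s) (R s))" if "i \<in> I" for i
      using hr[OF that] by (simp only: pR[OF that])
  qed
  have "is_pushout (Mod T) f0 g0 (B, L, lift_model) (B', R, lift_model)"
    unfolding is_pushout_def
  proof (intro conjI ballI impI; (elim conjE)?)
    have "l s (f s x) = r s (g s x)" if "x \<in> Carr A s" for s x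
      using hlr that by (auto simp: l_def r_def intro!: restrict_ext)
    then show "Comp (Mod T) (B, L, lift_model) f0 = Comp (Mod T) (B', R, lift_model) g0"
      using is_hom_mem[OF f] is_hom_mem[OF g] by (auto simp: f0' g0' compose_def L_def R_def intro!: ext)
    fix a b assume ab: "a \<in> Arr (Mod T)" "b \<in> Arr (Mod T)" "Cod (Mod T) a = Cod (Mod T) b"
      "Dom (Mod T) a = Cod (Mod T) f0" "Dom (Mod T) b = Cod (Mod T) g0" "Comp (Mod T) a f0 = Comp (Mod T) b g0"
    obtain a' D where a': "a = (B, a', D)" using ab f0' by (cases a) auto
    obtain b' where b': "b = (B', b', D)" using ab g0' a' by (cases b) auto
    let ?i = "(D, a', b')"
    have "a' s (f s x) = b' s (g s x)" if "x \<in> Carr A s" for s x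
    proof -
      have "compose (Carr A s) (a' s) (f s) = compose (Carr A s) (b' s) (g s)"
        using ab(6) by (simp add: a' b' f0' g0' fun_eq_iff)
      then show ?thesis using that by (metis compose_eq)
    qed
    then have i: "?i \<in> I" using ab by (auto simp: I_def a' b')
    have D: "is_model T D" using ab by (simp add: a')
    have pD: "is_hom T lift_model D (p ?i)" using is_hom_p[OF i] by (simp add: P_def)
    show "\<exists>!h. h \<in> Hom (Mod T) (Cod (Mod T) (B, L, lift_model)) (Cod (Mod T) a) \<and>
        Comp (Mod T) h (B, L, lift_model) = a \<and> Comp (Mod T) h (B', R, lift_model) = b"
    proof (rule ex1I[of _ "(lift_model, p ?i, D)"])
      show "(lift_model, p ?i, D) \<in> Hom (Mod T) (Cod (Mod T) (B, L, lift_model)) (Cod (Mod T) a) \<and>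
        Comp (Mod T) (lift_model, p ?i, D) (B, L, lift_model) = a \<and>
        Comp (Mod T) (lift_model, p ?i, D) (B', R, lift_model) = b"
        using pD D is_model_lift_model pL[OF i] pR[OF i] by (simp add: Hom_def a' b')
      fix h assume h: "h \<in> Hom (Mod T) (Cod (Mod T) (B, L, lift_model)) (Cod (Mod T) a) \<and>
        Comp (Mod T) h (B, L, lift_model) = a \<and> Comp (Mod T) h (B', R, lift_model) = b"
      then obtain h' where h': "h = (lift_model, h', D)" "is_hom T lift_model D h'"
        by (cases h) (auto simp: Hom_def a')
      have hL: "compose (Carr B s) (h' s) (L s) = a' s" and hR: "compose (Carr B' s) (h' s) (R s) = b' s" for s
        using h by (auto simp: h' a' b')
      \<comment> \<open>Uniqueness of the mediating arrow by induction over generation: on the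
        generators it is forced by the two triangles, and homomorphisms propagate it along the
        operations.\<close>
      have "h' s (enc z) = z ?i" if "?gen s z" for s z
        using that
      proof (induction rule: generated.induct)
        case (base z s)
        have "h' s (enc (l s x)) = a' s x" if "x \<in> Carr B s" for x
          using fun_cong[OF hL, of s x] that by (simp add: compose_eq L_def)
        moreover have "h' s (enc (r s x)) = b' s x" if "x \<in> Carr B' s" for x
          using fun_cong[OF hR, of s x] that by (simp add: compose_eq R_def)
        ultimately show ?case
          using base i by (auto simp: G_def l_apply r_apply)
      next
        case (op f z w)
        let ?a = "\<lambda>k\<in>Arity T f. enc (z k)"
        have w: "?gen (ResSort T f) w" by (rule generated.op[OF op.hyps(1)]) (use op.hyps in blast)+
        have "map_args T (p i) f ?a = (\<lambda>k\<in>Arity T f. z k i)" for i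
          using op.hyps(2) by (auto intro!: restrict_ext simp: p_enc)
        then have "is_value f ?a (enc w)"
          using op.hyps by (auto simp: is_value_def enc_Car w p_enc[OF w])
        then have "Op D f (map_args T h' f ?a) = Some (h' (ResSort T f) (enc w))"
          by (intro is_hom_Op[OF h'(2) op.hyps(1)]) (simp only: Op_lift_model)
        moreover have "map_args T h' f ?a = (\<lambda>k\<in>Arity T f. z k ?i)"
          using op.IH by (auto intro!: restrict_ext)
        moreover have "Op D f (\<lambda>k\<in>Arity T f. z k ?i) = Some (w ?i)"
          using op.hyps(3)[OF i] by (simp add: P_def)
        ultimately show ?case by simp
      qed
      then have "h' = p ?i"
        by (intro is_hom_eqI[OF h'(2) pD]) (auto simp: Car_def p_enc)
      then show "h = (lift_model, p ?i, D)" using h' by simp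
    qed
  qed (use f0 g0 A B B' f g L R is_model_lift_model in \<open>simp_all add: f0' g0'\<close>)
  then show ?thesis by blast
qed

section \<open>Factorizations, pullbacks and pushouts in essentially algebraic categories\<close>

lemma transfer_setting_strong_epi_mono:
  assumes "category C"
    and "\<And>f. f \<in> Arr C \<Longrightarrow> \<exists>e\<in>strong_epis C. \<exists>m\<in>mono_arrs C. Cod C e = Dom C m \<and> f = Comp C m e"
    and "\<And>f g. f \<in> Arr C \<Longrightarrow> g \<in> Arr C \<Longrightarrow> Cod C f = Cod C g \<Longrightarrow> \<exists>p q. is_pullback C f g p q"
    and "\<And>f g. f \<in> Arr C \<Longrightarrow> g \<in> Arr C \<Longrightarrow> Dom C f = Dom C g \<Longrightarrow> \<exists>p q. is_pushout C f g p q"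
  shows "transfer_setting C (strong_epis C) (mono_arrs C)"
proof -
  interpret category_on C using assms(1) by unfold_locales
  show ?thesis
    unfolding transfer_setting_def
    using assms strong_epi_mono_proper strong_epis_Arr is_mono_Arr by (auto simp: mono_arrs_def)
qed

lemma pullbacks_Mod:
  assumes U: "universe TYPE('u)" and T: "wf_theory (T :: 'u ea_theory)"
    and fg: "f \<in> Arr (Mod T)" "g \<in> Arr (Mod T)" "Cod (Mod T) f = Cod (Mod T) g"
  shows "\<exists>p q. is_pullback (Mod T) f g p q"
proof -
  obtain A h D where f: "f = (A, h, D)" by (cases f)
  obtain B k where g: "g = (B, k, D)" using fg f by (cases g) auto
  have "is_model T A" "is_model T B" "is_model T D" "is_hom T A D h" "is_hom T B D k"
    using fg by (auto simp: f g)
  then show ?thesis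
    unfolding f g by (rule pullback_Mod[OF U T]) blast
qed

lemma transfer_setting_Mod:
  assumes "universe TYPE('u)" and "wf_theory (T :: 'u ea_theory)"
  shows "transfer_setting (Mod T) (strong_epis (Mod T)) (mono_arrs (Mod T))"
  using assms by (intro transfer_setting_strong_epi_mono category_Mod factorization_Mod pullbacks_Mod pushout_Mod)

text \<open>Besides being a category, this is all that is drawn from \<open>C\<close> being
  essentially algebraic. Each fact is proved for models and reflected along the equivalence.\<close>

lemma essentially_algebraic_constructions:
  assumes U: "universe TYPE('u)" and C: "essentially_algebraic TYPE('u) C"
  shows essentially_algebraic_factorization: "f \<in> Arr C \<Longrightarrow>
      \<exists>e\<in>strong_epis C. \<exists>m\<in>mono_arrs C. Cod C e = Dom C m \<and> f = Comp C m e"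
    and essentially_algebraic_pullbacks: "f \<in> Arr C \<Longrightarrow> g \<in> Arr C \<Longrightarrow> Cod C f = Cod C g \<Longrightarrow>
      \<exists>p q. is_pullback C f g p q"
    and essentially_algebraic_pushouts: "f \<in> Arr C \<Longrightarrow> g \<in> Arr C \<Longrightarrow> Dom C f = Dom C g \<Longrightarrow>
      \<exists>p q. is_pushout C f g p q"
proof -
  obtain T :: "'u ea_theory" and F where T: "wf_theory T" and F: "is_equivalence C (Mod T) F" and cat: "category C"
    using C by (auto simp: essentially_algebraic_def)
  interpret equivalence_on C "Mod T" F
    using cat category_Mod F by unfold_locales (auto simp: is_equivalence_def)
  show "\<exists>e\<in>strong_epis C. \<exists>m\<in>mono_arrs C. Cod C e = Dom C m \<and> f = Comp C m e" if "f \<in> Arr C"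
    using reflects_factorization[OF factorization_Mod[OF U T] that] .
  show "\<exists>p q. is_pullback C f g p q" if "f \<in> Arr C" "g \<in> Arr C" "Cod C f = Cod C g"
    using pullbacks_Mod[OF U T, of "FArr F f" "FArr F g"] that reflects_pullbacks[OF that] by auto
  show "\<exists>p q. is_pushout C f g p q" if "f \<in> Arr C" "g \<in> Arr C" "Dom C f = Dom C g"
    using pushout_Mod[OF U T, of "FArr F f" "FArr F g"] that reflects_pushouts[OF that] by auto
qed


section \<open>Finitary varieties\<close>

locale finitary_variety =
  fixes T :: "'u ea_theory"
  assumes U: "universe TYPE('u)" and fin: "finitary_equational_theory T"
begin

lemma wf: "wf_theory T"
  and all_total: "Total T = Ops T"
  and finite_Arity: "f \<in> Ops T \<Longrightarrow> finite (Arity T f)"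
  using fin by (auto simp: finitary_equational_theory_def)

lemma Op_defined:
  assumes "is_model T A" "f \<in> Ops T" "a \<in> args T A f"
  obtains b where "Op A f a = Some b" "b \<in> Carr A (ResSort T f)"
proof -
  have "Op A f a \<noteq> None" by (rule model_total) (use assms all_total in auto)
  then show ?thesis using that model_result[OF assms(1,2)] by blast
qed

lemma lift_args:
  assumes "a \<in> args T B f" "\<And>s. h s ` Carr A s = Carr B s"
  obtains a' where "a' \<in> args T A f" "map_args T h f a' = a"
proof -
  let ?a = "\<lambda>i\<in>Arity T f. inv_into (Carr A (ArgSort T f i)) (h (ArgSort T f i)) (a i)"
  have "a i \<in> h (ArgSort T f i) ` Carr A (ArgSort T f i)" if "i \<in> Arity T f" for i
    using assms that by (auto simp: args_def)
  then have "?a \<in> args T A f" "map_args T h f ?a = a"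
    using assms(1) by (auto simp: args_def inv_into_into f_inv_into_f PiE_iff extensional_def fun_eq_iff)
  then show thesis by (rule that)
qed

text \<open>Every finite or infinite tuple of \<open>B\<close> lifts along \<open>e\<close>, and
  totality makes the operation defined on the lifted tuple. With partial operations the lifted tuple
  could fall outside the domain.\<close>

lemma factor_through_surjective:
  assumes A: "is_model T A" and B: "is_model T B" and D: "is_model T D"
    and e: "is_hom T A B e" and surj: "\<And>s. e s ` Carr A s = Carr B s" and g: "is_hom T A D g"
    and ker: "\<And>s x y. x \<in> Carr A s \<Longrightarrow> y \<in> Carr A s \<Longrightarrow> e s x = e s y \<Longrightarrow> g s x = g s y"
  obtains k where "is_hom T B D k" "\<And>s x. x \<in> Carr A s \<Longrightarrow> k s (e s x) = g s x"
proof -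
  define k where "k s = (\<lambda>y\<in>Carr B s. g s (inv_into (Carr A s) (e s) y))" for s
  have ke: "k s (e s x) = g s x" if "x \<in> Carr A s" for s x
  proof -
    have "e s x \<in> e s ` Carr A s" using that by simp
    then have "inv_into (Carr A s) (e s) (e s x) \<in> Carr A s" "e s (inv_into (Carr A s) (e s) (e s x)) = e s x"
      by (rule inv_into_into, rule f_inv_into_f)
    then have "g s (inv_into (Carr A s) (e s) (e s x)) = g s x" using that by (intro ker)
    then show ?thesis using is_hom_mem[OF e that] by (simp add: k_def)
  qed
  have "is_hom T B D k"
    unfolding is_hom_def
  proof (intro conjI allI ballI impI)
    show "k s \<in> Carr B s \<rightarrow>\<^sub>E Carr D s" for s
    proof (rule PiE_I)
      fix y assume "y \<in> Carr B s"
      then obtain x where "x \<in> Carr A s" "y = e s x" using surj by blast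
      then show "k s y \<in> Carr D s" using ke is_hom_mem[OF g] by simp
    qed (simp add: k_def)
    fix f b c assume f: "f \<in> Ops T" "Op B f b = Some c"
    obtain a where a: "a \<in> args T A f" "map_args T e f a = b"
      using lift_args[of b B f e A, OF model_args[OF B f] surj] by metis
    obtain d where d: "Op A f a = Some d" "d \<in> Carr A (ResSort T f)" using Op_defined[OF A f(1) a(1)] .
    have "e (ResSort T f) d = c" using is_hom_Op[OF e f(1) d(1)] a f by simp
    then have "k (ResSort T f) c = g (ResSort T f) d" using ke[OF d(2)] by simp
    moreover have "map_args T k f b = map_args T g f a"
      using a(1) ke unfolding a(2)[symmetric] by (auto intro!: restrict_ext simp: args_def PiE_iff)
    ultimately show "Op D f (map_args T k f b) = Some (k (ResSort T f) c)"
      using is_hom_Op[OF g f(1) d(1)] by simp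
  qed
  then show thesis using ke by (rule that)
qed

section \<open>Monomorphisms and strong epimorphisms in a variety\<close>

lemma injective_homs_eq: "injective_homs T = mono_arrs (Mod T)"
proof -
  have "(A, h, B) \<in> injective_homs T \<longleftrightarrow> (A, h, B) \<in> mono_arrs (Mod T)" for A h B
    using model_sort[of T A] unfolding mono_arrs_def mem_Collect_eq is_mono_Mod_iff[OF U wf]
    by (auto simp: injective_homs_def inj_on_def) blast
  then show ?thesis by auto
qed

lemma surjective_homs_iff:
  "(A, h, B) \<in> surjective_homs T \<longleftrightarrow>
    is_model T A \<and> is_model T B \<and> is_hom T A B h \<and> (\<forall>s. h s ` Carr A s = Carr B s)"
proof
  assume *: "(A, h, B) \<in> surjective_homs T"
  then have A: "is_model T A" "is_model T B" "is_hom T A B h" by (auto simp: surjective_homs_def)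
  have "h s ` Carr A s = Carr B s" for s
  proof (cases "s \<in> Sorts T")
    case False
    then have "Carr A s = {}" "Carr B s = {}" using model_sort[OF A(1)] model_sort[OF A(2)] by auto
    then show ?thesis by simp
  qed (use * in \<open>simp add: surjective_homs_def\<close>)
  with A show "is_model T A \<and> is_model T B \<and> is_hom T A B h \<and> (\<forall>s. h s ` Carr A s = Carr B s)" by simp
qed (simp add: surjective_homs_def)

text \<open>Totality makes the image closed, so \<open>h\<close> factors through the mono inclusion
  of its image. Orthogonality, with the identity of \<open>B\<close> as lower side, then gives a
  section of that inclusion.\<close>

lemma strong_epi_surjective:
  assumes e: "(A, h, B) \<in> strong_epis (Mod T)"
  shows "h s ` Carr A s = Carr B s"
proof -
  have A: "is_model T A" and B: "is_model T B" and h: "is_hom T A B h"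
    using Mod.strong_epis_Arr[OF e] by auto
  let ?Z = "\<lambda>s. h s ` Carr A s"
  have Z: "closed_family T B ?Z"
    unfolding closed_family_def
  proof (intro conjI allI ballI impI)
    show "?Z s \<subseteq> Carr B s" for s using is_hom_mem[OF h] by auto
    fix f a b assume f: "f \<in> Ops T" "Op B f a = Some b" "\<forall>k\<in>Arity T f. a k \<in> ?Z (ArgSort T f k)"
    let ?a = "\<lambda>i\<in>Arity T f. inv_into (Carr A (ArgSort T f i)) (h (ArgSort T f i)) (a i)"
    have "?a \<in> args T A f" using f by (auto simp: args_def inv_into_into)
    then obtain c where c: "Op A f ?a = Some c" "c \<in> Carr A (ResSort T f)" 
      by (rule Op_defined[OF A f(1)])
    have "map_args T h f ?a = a"
      using f model_args[OF B f(1,2)] by (auto simp: args_def f_inv_into_f PiE_iff extensional_def fun_eq_iff)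
    then have "b = h (ResSort T f) c" using is_hom_Op[OF h f(1) c(1)] f by simp
    then show "b \<in> ?Z (ResSort T f)" using c by simp
  qed
  obtain S where S: "is_model T S" "Carr S = ?Z" "is_hom T S B (\<lambda>s. \<lambda>x\<in>?Z s. x)"
    and lift: "\<And>A h. is_model T A \<Longrightarrow> is_hom T A B h \<Longrightarrow> (\<And>s x. x \<in> Carr A s \<Longrightarrow> h s x \<in> ?Z s) \<Longrightarrow> is_hom T A S h"
    by (rule submodel[OF wf B Z], rule that) (assumption | blast)+
  let ?m = "(S, \<lambda>s. \<lambda>x\<in>?Z s. x, B)"
  have m: "is_mono (Mod T) ?m"
    unfolding is_mono_Mod_iff[OF U wf] using S B by (auto simp: inj_on_def)
  have hS: "is_hom T A S h" using lift[OF A h] by simp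
  have "Comp (Mod T) ?m (A, h, S) = Comp (Mod T) (Idn (Mod T) B) (A, h, B)"
    using is_hom_mem[OF h] by (auto simp: compose_def intro!: ext)
  then obtain d where d: "d \<in> Arr (Mod T)" "Dom (Mod T) d = B" "Cod (Mod T) d = S" "Comp (Mod T) ?m d = Idn (Mod T) B"
    by - (rule Mod.orthogonalE[OF Mod.strong_epis_orthogonal[OF e m], of "(A, h, S)" "Idn (Mod T) B"],
      use A B S hS is_hom_Idn in simp_all)
  obtain d' where d': "d = (B, d', S)" using d by (cases d) auto
  then have dh: "is_hom T B S d'" using d by simp
  have "y \<in> ?Z s" if y: "y \<in> Carr B s" for y
  proof -
    have "compose (Carr B s) (\<lambda>x\<in>?Z s. x) (d' s) = (\<lambda>x\<in>Carr B s. x)"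
      using d(4) by (simp add: d' fun_eq_iff)
    then have "(\<lambda>x\<in>?Z s. x) (d' s y) = y" using y by (metis compose_eq restrict_apply')
    moreover have "d' s y \<in> ?Z s" using is_hom_mem[OF dh y] S by simp
    ultimately show ?thesis by simp
  qed
  then show ?thesis using is_hom_mem[OF h] by blast
qed

text \<open>For surjections, the mono part of the strong epi-mono factorization is injective and
  surjective, hence invertible, and is absorbed into the strong epi part.\<close>

lemma surjective_homs_eq: "surjective_homs T = strong_epis (Mod T)"
proof -
  have "(A, h, B) \<in> strong_epis (Mod T)" if *: "(A, h, B) \<in> surjective_homs T" for A h B
  proof -
    have A: "is_model T A" and B: "is_model T B" and h: "is_hom T A B h" and surj: "\<And>s. h s ` Carr A s = Carr B s"
      using * by (auto simp: surjective_homs_iff)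
    obtain e m where e: "e \<in> strong_epis (Mod T)" and m: "is_mono (Mod T) m" and em: "Cod (Mod T) e = Dom (Mod T) m"
      "(A, h, B) = Comp (Mod T) m e"
      using factorization_Mod[OF U wf, of "(A, h, B)"] A B h by (auto simp: mono_arrs_def)
    obtain S m' where m': "m = (S, m', B)" using em by (cases m; cases e) auto
    obtain e' where e': "e = (A, e', S)" using em m' by (cases e) auto
    have S: "is_model T S" "is_hom T S B m'" "\<And>s. inj_on (m' s) (Carr S s)" "is_hom T A S e'"
      using m Mod.strong_epis_Arr[OF e] unfolding m' e' is_mono_Mod_iff[OF U wf] by auto
    have "Carr B s \<subseteq> m' s ` Carr S s" for s
    proof
      fix y assume "y \<in> Carr B s"
      then obtain x where x: "x \<in> Carr A s" "y = h s x" using surj by blast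
      have "h s = compose (Carr A s) (m' s) (e' s)" using em(2) by (simp add: m' e')
      then show "y \<in> m' s ` Carr S s" using x is_hom_mem[OF S(4) x(1)] by (simp add: compose_eq)
    qed
    then have "is_iso (Mod T) m"
      unfolding m' using S(3) is_hom_mem[OF S(2)]
      by (intro bij_hom_iso[OF wf S(1) B S(2)]) (auto simp: bij_betw_def)
    then show ?thesis
      unfolding em(2) by (intro Mod.strong_epis_Comp Mod.iso_strong_epi e em)
  qed
  moreover have "(A, h, B) \<in> surjective_homs T" if "(A, h, B) \<in> strong_epis (Mod T)" for A h B
    using Mod.strong_epis_Arr[OF that] strong_epi_surjective[OF that] by (simp add: surjective_homs_iff)
  ultimately show ?thesis by auto
qed

section \<open>Congruences, quotients and kernels of pushouts\<close>

text \<open>Carriers must lie in \<open>'u\<close>, so classes are replaced by chosen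
  representatives: \<open>q\<close> sends an element to its representative, and an operation of
  \<open>Q\<close> is that of \<open>A\<close> followed by \<open>q\<close>.\<close>

lemma quotient_model:
  assumes A: "is_model T A"
    and refl: "\<And>s x. x \<in> Carr A s \<Longrightarrow> \<theta> s x x"
    and sym: "\<And>s x y. \<theta> s x y \<Longrightarrow> \<theta> s y x"
    and trans: "\<And>s x y z. \<theta> s x y \<Longrightarrow> \<theta> s y z \<Longrightarrow> \<theta> s x z"
    and cong: "\<And>f a b x y. f \<in> Ops T \<Longrightarrow> Op A f a = Some x \<Longrightarrow> Op A f b = Some y \<Longrightarrow>
      (\<And>k. k \<in> Arity T f \<Longrightarrow> \<theta> (ArgSort T f k) (a k) (b k)) \<Longrightarrow> \<theta> (ResSort T f) x y"
  obtains Q q where "is_model T Q" "is_hom T A Q q" "\<And>s. q s ` Carr A s = Carr Q s"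
    "\<And>s x y. x \<in> Carr A s \<Longrightarrow> y \<in> Carr A s \<Longrightarrow> q s x = q s y \<longleftrightarrow> \<theta> s x y"
proof -
  define q where "q s = (\<lambda>x\<in>Carr A s. SOME y. y \<in> Carr A s \<and> \<theta> s x y)" for s
  have q: "q s x \<in> Carr A s" "\<theta> s x (q s x)" if "x \<in> Carr A s" for s x
    using someI[of "\<lambda>y. y \<in> Carr A s \<and> \<theta> s x y" x] refl[OF that] that by (auto simp: q_def)
  have q_eq: "q s x = q s y \<longleftrightarrow> \<theta> s x y" if "x \<in> Carr A s" "y \<in> Carr A s" for s x y
  proof
    assume "q s x = q s y"
    then show "\<theta> s x y" using q[OF that(1)] q[OF that(2)] sym trans by metis
  next
    assume "\<theta> s x y"
    \<comment> \<open>Equivalent elements give the same predicate, so \<open>SOME\<close> picks the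
      same representative for both.\<close>
    then have "(\<lambda>z. z \<in> Carr A s \<and> \<theta> s x z) = (\<lambda>z. z \<in> Carr A s \<and> \<theta> s y z)"
      using sym trans by blast
    then show "q s x = q s y" using that by (simp add: q_def)
  qed
  have q_idem: "q s x = x" if "x \<in> q s ` Carr A s" for s x
    using that q sym q_eq by auto
  define Q where "Q = \<lparr>Carr = (\<lambda>s. q s ` Carr A s),
    Op = (\<lambda>f a. if a \<in> (\<Pi>\<^sub>E k\<in>Arity T f. q (ArgSort T f k) ` Carr A (ArgSort T f k))
      then map_option (q (ResSort T f)) (Op A f a) else None)\<rparr>"
  have Carr_Q: "Carr Q s = q s ` Carr A s" for s by (simp add: Q_def)
  have args_sub: "a \<in> args T A f" if "a \<in> args T Q f" for a f
    using that q by (auto simp: args_def Carr_Q PiE_iff)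
  have Op_Q: "Op Q f a = map_option (q (ResSort T f)) (Op A f a)" if "a \<in> args T Q f" for f a
    using that by (simp add: Q_def args_def)
  have Op_Q_args: "a \<in> args T Q f" if "Op Q f a = Some b" for f a b
    using that by (auto simp: Q_def args_def split: if_splits)
  have hom: "is_hom T A Q q"
    unfolding is_hom_def
  proof (intro conjI allI ballI impI)
    show "q s \<in> Carr A s \<rightarrow>\<^sub>E Carr Q s" for s by (auto simp: Carr_Q q_def)
    fix f a b assume f: "f \<in> Ops T" "Op A f a = Some b"
    have a: "a \<in> args T A f" using model_args[OF A f] .
    then have qa: "map_args T q f a \<in> args T Q f" by (auto simp: args_def Carr_Q)
    then obtain c where c: "Op A f (map_args T q f a) = Some c" "c \<in> Carr A (ResSort T f)"
      by (rule Op_defined[OF A f(1) args_sub])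
    have "\<theta> (ArgSort T f k) (a k) (map_args T q f a k)" if "k \<in> Arity T f" for k
      using q(2)[of "a k"] a that by (auto simp: args_def PiE_iff)
    then have "\<theta> (ResSort T f) b c" by (rule cong[OF f c(1)])
    then have "q (ResSort T f) b = q (ResSort T f) c" using q_eq c model_result[OF A f] by blast
    then show "Op Q f (map_args T q f a) = Some (q (ResSort T f) b)" using Op_Q[OF qa] c by simp
  qed
  have "is_model T Q"
    unfolding is_model_def all_total
  proof (intro conjI ballI allI impI)
    show "small TYPE('u) (Carr Q s)" if "s \<in> Sorts T" for s
      using small_image[OF model_small[OF A that]] by (simp add: Carr_Q)
    show "Carr Q s = {}" if "s \<notin> Sorts T" for s using that model_sort[OF A] by (auto simp: Carr_Q)
    show "Op Q f a = None" if "f \<notin> Ops T" for f a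
      using that A by (auto simp: Q_def is_model_def)
    show "a \<in> args T Q f" if "Op Q f a = Some b" for f a b using Op_Q_args[OF that] .
    show "b \<in> Carr Q (ResSort T f)" if f: "f \<in> Ops T" "Op Q f a = Some b" for f a b
      using f Op_Q[OF Op_Q_args[OF f(2)]] model_result[OF A f(1)] by (auto simp: Carr_Q)
    show "Op Q f a \<noteq> None" if f: "f \<in> Ops T" "a \<in> args T Q f" for f a
      using Op_Q[OF f(2)] Op_defined[OF A f(1) args_sub[OF f(2)]] by (metis option.map_disc_iff option.distinct(1))
    show "(Op Q f a \<noteq> None) = (\<forall>(l, r)\<in>DomEqs T f. eval T Q a l = eval T Q a r)" if "f \<in> Ops T - Ops T" for f a
      using that by simp
    show "case e of (X, \<sigma>, l, r) \<Rightarrow> \<forall>v\<in>\<Pi>\<^sub>E x\<in>X. Carr Q (\<sigma> x). eval T Q v l = eval T Q v r" if e: "e \<in> Eqs T" for e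
    proof clarify
      fix X \<sigma> l r v assume e': "e = (X, \<sigma>, l, r)" and v: "v \<in> (\<Pi>\<^sub>E x\<in>X. Carr Q (\<sigma> x))"
      obtain s where l: "has_sort T (Total T) X \<sigma> l s" and r: "has_sort T (Total T) X \<sigma> r s"
        using wf_theoryD(7)[OF wf] e e' all_total by metis
      have vA: "v x \<in> Carr A (\<sigma> x)" if "x \<in> X" for x using v that q by (auto simp: Carr_Q PiE_iff)
      then have eq: "eval T A v l = eval T A v r"
        using v e e' by (intro model_equation[OF A, of X \<sigma>]) (simp_all add: PiE_iff)
      have ev: "eval T Q v t = map_option (q s) (eval T A v t)" if t: "has_sort T (Total T) X \<sigma> t s" for t
      proof -
        obtain b where b: "eval T A v t = Some b" using eval_total[OF t wf A vA] by blast
        \<comment> \<open>A valuation in \<open>Q\<close> takes representatives as values, so it is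
          fixed by \<open>q\<close> and is at the same time a valuation in \<open>A\<close>. Thus
          equations of \<open>A\<close> descend.\<close>
        have "eval T Q v t = eval T Q (\<lambda>x. q (\<sigma> x) (v x)) t"
          by (rule eval_cong[OF t], rule q_idem[symmetric]) (use v in \<open>simp add: Carr_Q PiE_iff\<close>)
        then show ?thesis using hom_eval[OF t _ hom b] b all_total by simp
      qed
      show "eval T Q v l = eval T Q v r" using ev[OF l] ev[OF r] eq by simp
    qed
  qed
  then show thesis using hom q_eq by (intro that[of Q q]) (auto simp: Carr_Q)
qed

text \<open>
  Finitary operations allow the arguments to be replaced one at a time, so that the transitive
  closure of the union of two congruences is a congruence.
\<close>

lemma pushout_kernel:
  assumes e: "(A, e, B) \<in> surjective_homs T" and g: "(A, g, D) \<in> surjective_homs T"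
    and po: "is_pushout (Mod T) (A, e, B) (A, g, D) (B, p, P) (D, r, P)"
    and x: "x \<in> Carr A s" and y: "y \<in> Carr A s" and xy: "p s (e s x) = p s (e s y)"
  shows "(\<lambda>u v. u \<in> Carr A s \<and> v \<in> Carr A s \<and> (e s u = e s v \<or> g s u = g s v))\<^sup>*\<^sup>* x y"
proof -
  define R where "R s = (\<lambda>u v. u \<in> Carr A s \<and> v \<in> Carr A s \<and> (e s u = e s v \<or> g s u = g s v))" for s
  have A: "is_model T A" and B: "is_model T B" and eh: "is_hom T A B e" and es: "\<And>s. e s ` Carr A s = Carr B s"
    and D: "is_model T D" and gh: "is_hom T A D g" and gs: "\<And>s. g s ` Carr A s = Carr D s"
    using e g by (auto simp: surjective_homs_iff)
  have R_Carr: "u \<in> Carr A s \<longleftrightarrow> v \<in> Carr A s" if "(R s)\<^sup>*\<^sup>* u v" for s u v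
    using that by (induction rule: rtranclp_induct) (auto simp: R_def)
  have R_op: "R (ResSort T f) w z"
    if f: "f \<in> Ops T" "Op A f (c(j := u)) = Some w" "Op A f (c(j := v)) = Some z" and j: "j \<in> Arity T f"
      and uv: "R (ArgSort T f j) u v" for f c j u v w z
  proof -
    have "h (ResSort T f) w = h (ResSort T f) z"
      if h: "is_hom T A X h" "h (ArgSort T f j) u = h (ArgSort T f j) v" for h X
    proof -
      have "map_args T h f (c(j := u)) = map_args T h f (c(j := v))" using h(2) by (auto intro!: restrict_ext)
      then show ?thesis using is_hom_Op[OF h(1) f(1,2)] is_hom_Op[OF h(1) f(1,3)] by simp
    qed
    then show ?thesis
      using eh gh uv model_result[OF A f(1,2)] model_result[OF A f(1,3)] unfolding R_def by blast
  qed
  have R_op_star: "(R (ResSort T f))\<^sup>*\<^sup>* w z"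
    if f: "f \<in> Ops T" and c: "c(j := u) \<in> args T A f" and j: "j \<in> Arity T f"
      and uv: "(R (ArgSort T f j))\<^sup>*\<^sup>* u v"
      and w: "Op A f (c(j := u)) = Some w" and z: "Op A f (c(j := v)) = Some z" for f c j u v w z
    using uv z
  proof (induction arbitrary: z rule: rtranclp_induct)
    case base
    then have "z = w" using w by (metis option.inject)
    then show ?case by simp
  next
    case (step v v')
    \<comment> \<open>A chain starting in the carrier stays in it, so by totality the operation is
      defined at every intermediate argument.\<close>
    have "u \<in> Carr A (ArgSort T f j)" using c j by (force simp: args_def PiE_iff)
    then have v: "v \<in> Carr A (ArgSort T f j)" using R_Carr step by blast
    have "(c(j := u))(j := v) \<in> args T A f" using c v j unfolding args_def by (auto simp: PiE_iff extensional_def)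
    then obtain z' where z': "Op A f (c(j := v)) = Some z'" using Op_defined[OF A f] by auto
    then have "(R (ResSort T f))\<^sup>*\<^sup>* w z'" by (rule step.IH)
    moreover have "R (ResSort T f) z' z" using R_op[OF f z' step.prems j step.hyps(2)] .
    ultimately show ?case by simp
  qed
  have R_cong: "(R (ResSort T f))\<^sup>*\<^sup>* w z"
    if f: "f \<in> Ops T" and w: "Op A f a = Some w" and z: "Op A f b = Some z"
      and ab: "\<And>k. k \<in> Arity T f \<Longrightarrow> (R (ArgSort T f k))\<^sup>*\<^sup>* (a k) (b k)" for f a b w z
  proof -
    \<comment> \<open>The hybrid tuple takes its arguments from \<open>b\<close> on \<open>K\<close>
      and from \<open>a\<close> elsewhere. Growing \<open>K\<close> by one position at a time leads
      from \<open>a\<close> to \<open>b\<close> in finitely many moves, which is where the finite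
      arity is used.\<close>
    define c where "c K = (\<lambda>k. if k \<in> K then b k else a k)" for K
    have a: "a \<in> args T A f" and b: "b \<in> args T A f" using model_args[OF A f w] model_args[OF A f z] .
    have c: "c K \<in> args T A f" if "K \<subseteq> Arity T f" for K
      using a b that by (auto simp: c_def args_def PiE_iff extensional_def)
    have "\<forall>z. Op A f (c K) = Some z \<longrightarrow> (R (ResSort T f))\<^sup>*\<^sup>* w z" if "finite K" "K \<subseteq> Arity T f" for K
      using that
    proof (induction rule: finite_induct)
      case empty
      then show ?case using w by (simp add: c_def)
    next
      case (insert j K)
      have cj: "(c K)(j := a j) = c K" "(c K)(j := b j) = c (insert j K)"
        using insert.hyps by (auto simp: c_def fun_eq_iff)
      obtain z' where z': "Op A f (c K) = Some z'" using Op_defined[OF A f c, of K] insert.prems by auto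
      have "(R (ResSort T f))\<^sup>*\<^sup>* z' z" if "Op A f (c (insert j K)) = Some z" for z
        using R_op_star[of f "c K" j "a j" "b j" z' z] insert.prems c f ab z' that by (simp add: cj)
      moreover have "(R (ResSort T f))\<^sup>*\<^sup>* w z'" using insert z' by simp
      ultimately show ?case by (meson rtranclp_trans)
    qed
    moreover have "c (Arity T f) = b"
      using a b by (auto simp: c_def args_def PiE_iff extensional_def fun_eq_iff)
    ultimately show ?thesis using z finite_Arity[OF f] by blast
  qed
  have R_sym: "(R s)\<^sup>*\<^sup>* v u" if "(R s)\<^sup>*\<^sup>* u v" for s u v
    using that by (induction rule: rtranclp_induct) (auto simp: R_def intro: converse_rtranclp_into_rtranclp)
  \<comment> \<open>The quotient of \<open>A\<close> by the chain relation receives a cocone from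
    \<open>B\<close> and \<open>D\<close>. Hence elements identified in the pushout are identified
    in \<open>Q\<close>, that is, joined by a chain.\<close>
  obtain Q q where Q: "is_model T Q" and q: "is_hom T A Q q"
    and ker: "\<And>s x y. x \<in> Carr A s \<Longrightarrow> y \<in> Carr A s \<Longrightarrow> q s x = q s y \<longleftrightarrow> (R s)\<^sup>*\<^sup>* x y"
    by (rule quotient_model[OF A, of "\<lambda>s. (R s)\<^sup>*\<^sup>*"])
      (use R_sym R_cong in \<open>blast intro: rtranclp_trans\<close>)+
  have "q s u = q s v" if "u \<in> Carr A s" "v \<in> Carr A s" "e s u = e s v \<or> g s u = g s v" for s u v
    using ker that by (auto simp: R_def)
  note qR = this
  obtain k where k: "is_hom T B Q k" "\<And>s x. x \<in> Carr A s \<Longrightarrow> k s (e s x) = q s x"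
    by (rule factor_through_surjective[OF A B Q eh es q]) (use qR in blast)+
  obtain l where l: "is_hom T D Q l" "\<And>s x. x \<in> Carr A s \<Longrightarrow> l s (g s x) = q s x"
    by (rule factor_through_surjective[OF A D Q gh gs q]) (use qR in blast)+
  have "compose (Carr A s) (k s) (e s) = compose (Carr A s) (l s) (g s)" for s
    using k(2) l(2) by (auto simp: compose_def intro!: ext)
  then obtain h where h: "h \<in> Arr (Mod T)" "Dom (Mod T) h = P" "Comp (Mod T) h (B, p, P) = (B, k, Q)"
    by - (rule Mod.is_pushoutE[OF po, of "(B, k, Q)" "(D, l, Q)"], use B D Q k l in simp_all)
  obtain h' where "h = (P, h', Q)" using h by (cases h) auto
  then have "(\<lambda>s. compose (Carr B s) (h' s) (p s)) = k" using h by simp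
  from fun_cong[OF this, of s] have "k s = compose (Carr B s) (h' s) (p s)" by simp
  then have "k s (e s x) = k s (e s y)"
    using xy is_hom_mem[OF eh x] is_hom_mem[OF eh y] by (simp add: compose_eq)
  then have "q s x = q s y" using k(2) x y by simp
  then show ?thesis using ker x y by (simp add: R_def)
qed

end


section \<open>Subgroups of free abelian groups\<close>

definition free :: "'a set \<Rightarrow> ('a \<Rightarrow>\<^sub>0 int) set" where
  "free W = {c. Poly_Mapping.keys c \<subseteq> W}"

definition subgroups :: "'a set \<Rightarrow> ('a \<Rightarrow>\<^sub>0 int) set set" where
  "subgroups W = {S. S \<subseteq> free W \<and> 0 \<in> S \<and> (\<forall>a\<in>S. \<forall>b\<in>S. a - b \<in> S)}"

definition frag_map :: "('a \<Rightarrow> 'b) \<Rightarrow> ('a \<Rightarrow>\<^sub>0 int) \<Rightarrow> ('b \<Rightarrow>\<^sub>0 int)" where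
  "frag_map f = frag_extend (frag_of \<circ> f)"

definition subgroup_sum :: "('a \<Rightarrow>\<^sub>0 int) set \<Rightarrow> ('a \<Rightarrow>\<^sub>0 int) set \<Rightarrow> ('a \<Rightarrow>\<^sub>0 int) set" where
  "subgroup_sum S T = {a + b |a b. a \<in> S \<and> b \<in> T}"

definition generated_subgroup :: "'a set \<Rightarrow> ('a \<Rightarrow>\<^sub>0 int) set \<Rightarrow> ('a \<Rightarrow>\<^sub>0 int) set" where
  "generated_subgroup W X = \<Inter>{S \<in> subgroups W. X \<subseteq> S}"

lemma frag_map_simps [simp]:
  "frag_map f 0 = 0" "frag_map f (frag_of x) = frag_of (f x)"
  "frag_map f (a - b) = frag_map f a - frag_map f b" "frag_map f (a + b) = frag_map f a + frag_map f b"
  by (simp_all add: frag_map_def frag_extend_diff frag_extend_add)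

lemma frag_map_comp: "frag_map g (frag_map f c) = frag_map (g \<circ> f) c"
  by (simp add: frag_map_def frag_extend_compose comp_assoc)

lemma frag_map_cong: "c \<in> free W \<Longrightarrow> (\<And>x. x \<in> W \<Longrightarrow> f x = g x) \<Longrightarrow> frag_map f c = frag_map g c"
  unfolding frag_map_def by (rule frag_extend_eq) (auto simp: free_def)

lemma frag_map_ident: "frag_map (\<lambda>x. x) c = c"
  using frag_expansion[of c] by (simp add: frag_map_def comp_def)

lemma frag_of_free [simp]: "frag_of x \<in> free W \<longleftrightarrow> x \<in> W"
  by (simp add: free_def)

lemma free_subgroup: "free W \<in> subgroups W"
  using keys_diff by (fastforce simp: subgroups_def free_def)

lemma subgroupsD:
  assumes "S \<in> subgroups W"
  shows subgroups_free: "a \<in> S \<Longrightarrow> a \<in> free W" and subgroups_zero: "0 \<in> S"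
    and subgroups_diff: "a \<in> S \<Longrightarrow> b \<in> S \<Longrightarrow> a - b \<in> S"
    and subgroups_add: "a \<in> S \<Longrightarrow> b \<in> S \<Longrightarrow> a + b \<in> S"
proof -
  show *: "0 \<in> S" "\<And>a b. a \<in> S \<Longrightarrow> b \<in> S \<Longrightarrow> a - b \<in> S" using assms by (auto simp: subgroups_def)
  show "a + b \<in> S" if "a \<in> S" "b \<in> S" using *(2)[OF that(1) *(2)[OF *(1) that(2)]] by simp
qed (use assms in \<open>auto simp: subgroups_def\<close>)

lemma free_induct [consumes 1, case_names zero one diff]:
  "c \<in> free W \<Longrightarrow> P 0 \<Longrightarrow> (\<And>x. x \<in> W \<Longrightarrow> P (frag_of x)) \<Longrightarrow> (\<And>a b. P a \<Longrightarrow> P b \<Longrightarrow> P (a - b)) \<Longrightarrow> P c"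
  unfolding free_def mem_Collect_eq by (rule frag_induction)

lemma frag_map_free: assumes "f \<in> W \<rightarrow> W'" "c \<in> free W" shows "frag_map f c \<in> free W'"
  using assms(2) subgroupsD[OF free_subgroup[of W']]
  by (induction c rule: free_induct) (use assms(1) in auto)

lemma subgroups_image:
  assumes "S \<in> subgroups W" "f \<in> W \<rightarrow> W'" shows "frag_map f ` S \<in> subgroups W'"
  unfolding subgroups_def
proof (intro CollectI conjI ballI)
  show "frag_map f ` S \<subseteq> free W'" using assms frag_map_free subgroups_free by blast
  show "0 \<in> frag_map f ` S" using subgroups_zero[OF assms(1)] by (auto intro!: image_eqI[of _ _ 0])
  fix a b assume "a \<in> frag_map f ` S" "b \<in> frag_map f ` S"
  then show "a - b \<in> frag_map f ` S"
    using subgroups_diff[OF assms(1)] by (auto simp flip: frag_map_simps(3))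
qed

lemma subgroups_preimage:
  assumes "S \<in> subgroups W'" shows "{c \<in> free W. frag_map f c \<in> S} \<in> subgroups W"
  using subgroupsD[OF assms] subgroupsD[OF free_subgroup[of W]] by (auto simp: subgroups_def)

lemma image_free: assumes "f \<in> W \<rightarrow> W'" shows "frag_map f ` free W = free (f ` W)"
proof (intro equalityI subsetI)
  fix c assume "c \<in> free (f ` W)"
  then show "c \<in> frag_map f ` free W"
    using subgroupsD[OF subgroups_image[OF free_subgroup assms]]
    by (induction c rule: free_induct) (auto intro!: rev_image_eqI[of "frag_of _"])
qed (use frag_map_free[of f W "f ` W"] in auto)

text \<open>
  With \<open>r\<close> choosing a representative in each fibre of \<open>f\<close>, every \<open>c\<close> is congruent to \<open>r\<^sub>*c\<close> modulo
  differences of generators, and \<open>r\<^sub>*c = 0\<close> because \<open>r\<close> factors through \<open>f\<close>.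
\<close>

lemma kernel_generated_by_differences:
  assumes S: "S \<in> subgroups W"
    and diff: "\<And>x y. x \<in> W \<Longrightarrow> y \<in> W \<Longrightarrow> f x = f y \<Longrightarrow> frag_of x - frag_of y \<in> S"
    and c: "c \<in> free W" "frag_map f c = 0"
  shows "c \<in> S"
proof -
  let ?r = "inv_into W f \<circ> f"
  have "d - frag_map ?r d \<in> S" if "d \<in> free W" for d
    using that
  proof (induction d rule: free_induct)
    case (one x)
    then have "f x \<in> f ` W" by simp
    then show ?case using one diff by (simp add: inv_into_into f_inv_into_f)
  next
    case (diff a b)
    have "a - b - frag_map ?r (a - b) = (a - frag_map ?r a) - (b - frag_map ?r b)" by simp
    then show ?case using subgroups_diff[OF S diff] by metis
  qed (use subgroups_zero[OF S] in simp)
  moreover have "frag_map ?r c = 0"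
    using c(2) by (simp add: frag_map_comp[symmetric])
  ultimately show ?thesis using c(1) by force
qed

section \<open>Sums and generated subgroups\<close>

lemma subgroup_sum_subgroup:
  assumes S: "S \<in> subgroups W" and T: "T \<in> subgroups W" shows "subgroup_sum S T \<in> subgroups W"
  unfolding subgroups_def
proof (intro CollectI conjI ballI)
  show "subgroup_sum S T \<subseteq> free W"
    using subgroups_free[OF S] subgroups_free[OF T] subgroups_add[OF free_subgroup[of W]]
    by (auto simp: subgroup_sum_def)
  show "0 \<in> subgroup_sum S T"
    using subgroups_zero[OF S] subgroups_zero[OF T] by (force simp: subgroup_sum_def)
  fix x y assume "x \<in> subgroup_sum S T" "y \<in> subgroup_sum S T"
  then obtain a b a' b' where "x = a + b" "y = a' + b'" "a \<in> S" "b \<in> T" "a' \<in> S" "b' \<in> T"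
    by (auto simp: subgroup_sum_def)
  then have "x - y = (a - a') + (b - b')" "a - a' \<in> S" "b - b' \<in> T"
    using subgroups_diff[OF S] subgroups_diff[OF T] by auto
  then show "x - y \<in> subgroup_sum S T" by (auto simp: subgroup_sum_def)
qed

lemma subgroup_sum_upper:
  assumes S: "S \<in> subgroups W" and T: "T \<in> subgroups W"
  shows "S \<subseteq> subgroup_sum S T" "T \<subseteq> subgroup_sum S T"
  using subgroups_zero[OF S] subgroups_zero[OF T] by (force simp: subgroup_sum_def)+

lemma subgroup_sum_least:
  "R \<in> subgroups W \<Longrightarrow> S \<subseteq> R \<Longrightarrow> T \<subseteq> R \<Longrightarrow> subgroup_sum S T \<subseteq> R"
  using subgroups_add[of R W] by (auto simp: subgroup_sum_def)

text \<open>Elements with equal images differ by an element of the kernel. This is the first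
  identity of (N1).\<close>

lemma preimage_image:
  assumes S: "S \<in> subgroups W" and f: "f \<in> W \<rightarrow> W'"
  shows "{c \<in> free W. frag_map f c \<in> frag_map f ` S} = subgroup_sum S {c \<in> free W. frag_map f c = 0}"
proof (intro equalityI subsetI)
  fix c assume "c \<in> {c \<in> free W. frag_map f c \<in> frag_map f ` S}"
  then obtain d where d: "d \<in> S" "frag_map f c = frag_map f d" "c \<in> free W" by auto
  then have "c = d + (c - d)" "c - d \<in> {c \<in> free W. frag_map f c = 0}"
    using subgroups_diff[OF free_subgroup] subgroups_free[OF S] by auto
  then show "c \<in> subgroup_sum S {c \<in> free W. frag_map f c = 0}" using d(1) unfolding subgroup_sum_def by blast
next
  fix c assume "c \<in> subgroup_sum S {c \<in> free W. frag_map f c = 0}"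
  then show "c \<in> {c \<in> free W. frag_map f c \<in> frag_map f ` S}"
    using subgroups_add[OF free_subgroup] subgroups_free[OF S] by (auto simp: subgroup_sum_def)
qed

lemma generated_subgroup_subgroup: "X \<subseteq> free W \<Longrightarrow> generated_subgroup W X \<in> subgroups W"
proof -
  assume X: "X \<subseteq> free W"
  have "generated_subgroup W X \<subseteq> free W" using free_subgroup X by (auto simp: generated_subgroup_def)
  then show ?thesis
    unfolding subgroups_def
    by (auto simp: generated_subgroup_def intro: subgroups_zero subgroups_diff)
qed

lemma generated_subgroup_upper: "X \<subseteq> generated_subgroup W X"
  by (auto simp: generated_subgroup_def)

lemma generated_subgroup_least: "S \<in> subgroups W \<Longrightarrow> X \<subseteq> S \<Longrightarrow> generated_subgroup W X \<subseteq> S"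
  by (auto simp: generated_subgroup_def)

text \<open>An element of \<open>free W\<close> is determined by the graph of its coefficients on
  \<open>W\<close>, and the integers are countable; two applications of power sets then bound the
  subgroups.\<close>

lemma small_subgroups:
  assumes U: "universe TYPE('u)" and W: "small TYPE('u) W"
  shows "small TYPE('u) (subgroups W)"
proof -
  let ?g = "\<lambda>c. {(x, Poly_Mapping.lookup c x) |x. x \<in> W}"
  have "small TYPE('u) (Pow (W \<times> (UNIV :: int set)))"
    by (intro small_Pow small_Times U W small_countable) simp
  then have "small TYPE('u) (?g ` free W)" by (rule small_subset[rotated]) auto
  moreover have "inj_on ?g (free W)"
  proof (rule inj_onI)
    fix c d assume c: "c \<in> free W" and d: "d \<in> free W" and eq: "?g c = ?g d"
    show "c = d"
    proof (rule poly_mapping_eqI)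
      fix x show "Poly_Mapping.lookup c x = Poly_Mapping.lookup d x"
      proof (cases "x \<in> W")
        case True
        then have "(x, Poly_Mapping.lookup c x) \<in> ?g d" unfolding eq[symmetric] by blast
        then show ?thesis by simp
      next
        case False
        then have "x \<notin> Poly_Mapping.keys c" "x \<notin> Poly_Mapping.keys d" using c d by (auto simp: free_def)
        then show ?thesis by (simp add: in_keys_iff)
      qed
    qed
  qed
  ultimately have "small TYPE('u) (free W)" by (rule small_inj[rotated])
  then have "small TYPE('u) (Pow (free W))" by (rule small_Pow[OF U])
  then show ?thesis by (rule small_subset[rotated]) (auto simp: subgroups_def)
qed

section \<open>The lattice of subgroups, coded in the universe\<close>

text \<open>Clusters of a form are elements of \<open>'u\<close>, so subgroups are renamed along an
  arbitrarily chosen map. It is known to be injective only when \<open>W\<close> is small, which is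
  the purpose of the locale \<open>small_basis\<close>.\<close>

definition encode :: "'a set \<Rightarrow> ('a \<Rightarrow>\<^sub>0 int) set \<Rightarrow> 'u" where
  "encode W = (SOME f. inj_on f (subgroups W))"

definition decode :: "'a set \<Rightarrow> 'u \<Rightarrow> ('a \<Rightarrow>\<^sub>0 int) set" where
  "decode W = inv_into (subgroups W) (encode W)"

definition subgroup_lattice :: "'a set \<Rightarrow> 'u gorder" where
  "subgroup_lattice W =
    \<lparr>carrier = encode W ` subgroups W, eq = (=), le = (\<lambda>x y. decode W x \<subseteq> decode W y)\<rparr>"

text \<open>The lattice is a parameter fixed by an equation, so that a fibre \<open>Fib F X\<close>
  can be put in its place directly.\<close>

locale small_basis =
  fixes W :: "'a set" and L :: "'u gorder"
  assumes U: "universe TYPE('u)" and W: "small TYPE('u) W" and L_def: "L = subgroup_lattice W"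
begin

abbreviation cd :: "('a \<Rightarrow>\<^sub>0 int) set \<Rightarrow> 'u" where "cd \<equiv> encode W"
abbreviation dc :: "'u \<Rightarrow> ('a \<Rightarrow>\<^sub>0 int) set" where "dc \<equiv> decode W"

lemma encode_inj: "inj_on cd (subgroups W)"
proof -
  have "\<exists>f :: ('a \<Rightarrow>\<^sub>0 int) set \<Rightarrow> 'u. inj_on f (subgroups W)"
    by (rule small_obtain_inj[OF small_subgroups[OF U W]]) blast
  then show ?thesis unfolding encode_def by (rule someI_ex)
qed

lemma dc_cd [simp]: "S \<in> subgroups W \<Longrightarrow> dc (cd S) = S"
  using encode_inj by (simp add: decode_def)

lemma carrier_L: "carrier L = cd ` subgroups W"
  by (simp add: L_def subgroup_lattice_def)

lemma cd_carrier [simp]: "S \<in> subgroups W \<Longrightarrow> cd S \<in> carrier L"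
  by (simp add: carrier_L)

lemma dc_subgroup [simp]: "x \<in> carrier L \<Longrightarrow> dc x \<in> subgroups W"
  by (auto simp: carrier_L)

lemma cd_dc [simp]: "x \<in> carrier L \<Longrightarrow> cd (dc x) = x"
  by (auto simp: carrier_L)

lemma le_L: "x \<sqsubseteq>\<^bsub>L\<^esub> y \<longleftrightarrow> dc x \<subseteq> dc y"
  by (simp add: L_def subgroup_lattice_def)

lemma eq_L: "(.=\<^bsub>L\<^esub>) = (=)"
  by (simp add: L_def subgroup_lattice_def)

lemma small_carrier: "small TYPE('u) (carrier L)"
  unfolding carrier_L by (rule small_image[OF small_subgroups[OF U W]])

lemma partial_order_L: "partial_order L"
proof
  show "x .=\<^bsub>L\<^esub> y" if "x \<sqsubseteq>\<^bsub>L\<^esub> y" "y \<sqsubseteq>\<^bsub>L\<^esub> x" "x \<in> carrier L" "y \<in> carrier L" for x y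
  proof -
    have "cd (dc x) = cd (dc y)" using that by (simp add: le_L subset_antisym)
    then show ?thesis using that by (simp add: eq_L)
  qed
qed (auto simp: le_L eq_L)

lemma Upper_L: "A \<subseteq> carrier L \<Longrightarrow> Upper L A = {u \<in> carrier L. \<forall>x\<in>A. dc x \<subseteq> dc u}"
  by (auto simp: Upper_def le_L)

lemma Lower_L: "A \<subseteq> carrier L \<Longrightarrow> Lower L A = {u \<in> carrier L. \<forall>x\<in>A. dc u \<subseteq> dc x}"
  by (auto simp: Lower_def le_L)

lemma Union_free: "A \<subseteq> carrier L \<Longrightarrow> (\<Union>x\<in>A. dc x) \<subseteq> free W"
  using subgroups_free dc_subgroup by blast

lemma sup_L_least: "A \<subseteq> carrier L \<Longrightarrow> least L (cd (generated_subgroup W (\<Union>x\<in>A. dc x))) (Upper L A)"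
proof -
  assume A: "A \<subseteq> carrier L"
  have S: "generated_subgroup W (\<Union>x\<in>A. dc x) \<in> subgroups W"
    by (rule generated_subgroup_subgroup[OF Union_free[OF A]])
  have "dc x \<subseteq> generated_subgroup W (\<Union>x\<in>A. dc x)" if "x \<in> A" for x
    using generated_subgroup_upper[of "\<Union>x\<in>A. dc x" W] that by blast
  moreover have "generated_subgroup W (\<Union>x\<in>A. dc x) \<subseteq> dc u" if "u \<in> carrier L" "\<forall>x\<in>A. dc x \<subseteq> dc u" for u
    using that by (intro generated_subgroup_least dc_subgroup) blast+
  ultimately show ?thesis
    unfolding least_def Upper_L[OF A] le_L using S by auto
qed

text \<open>The factor \<open>free W\<close> makes the formula correct for empty \<open>A\<close> as
  well, where the intersection alone would be the universal set.\<close>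

lemma inf_L_greatest: 
  assumes A: "A \<subseteq> carrier L"
  shows "greatest L (cd (free W \<inter> (\<Inter>x\<in>A. dc x))) (Lower L A)"
proof -
  have "dc x \<in> subgroups W" if "x \<in> A" for x using A that by auto
  then have "free W \<inter> (\<Inter>x\<in>A. dc x) \<in> subgroups W"
    using free_subgroup[of W] by (simp add: subgroups_def)
  then show ?thesis
    using A subgroups_free[OF dc_subgroup] unfolding greatest_def Lower_L[OF A] le_L by auto
qed

lemma complete_lattice_L: "complete_lattice L"
proof -
  interpret partial_order L by (rule partial_order_L)
  show ?thesis using sup_L_least inf_L_greatest by (intro complete_latticeI) blast+
qed

sublocale complete_lattice L by (rule complete_lattice_L)

lemma sup_L: "A \<subseteq> carrier L \<Longrightarrow> \<Squnion>\<^bsub>L\<^esub>A = cd (generated_subgroup W (\<Union>x\<in>A. dc x))"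
  unfolding sup_def by (intro some_equality) (auto intro: least_unique sup_L_least)

lemma join_L:
  assumes x: "x \<in> carrier L" and y: "y \<in> carrier L"
  shows "x \<squnion>\<^bsub>L\<^esub> y = cd (subgroup_sum (dc x) (dc y))"
proof -
  have S: "subgroup_sum (dc x) (dc y) \<in> subgroups W" using x y by (intro subgroup_sum_subgroup) auto
  have "generated_subgroup W (dc x \<union> dc y) = subgroup_sum (dc x) (dc y)"
  proof (rule antisym)
    show "generated_subgroup W (dc x \<union> dc y) \<subseteq> subgroup_sum (dc x) (dc y)"
      using S subgroup_sum_upper[of "dc x" W "dc y"] x y by (intro generated_subgroup_least) auto
    show "subgroup_sum (dc x) (dc y) \<subseteq> generated_subgroup W (dc x \<union> dc y)"
      using generated_subgroup_upper[of "dc x \<union> dc y" W] subgroups_free[OF dc_subgroup[OF x]]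
        subgroups_free[OF dc_subgroup[OF y]]
      by (intro subgroup_sum_least[OF generated_subgroup_subgroup]) auto
  qed
  then show ?thesis using x y by (simp add: join_def sup_L)
qed

lemma meet_subgroup: "x \<in> carrier L \<Longrightarrow> y \<in> carrier L \<Longrightarrow> dc x \<inter> dc y \<in> subgroups W"
  using subgroupsD[OF dc_subgroup[of x]] subgroupsD[OF dc_subgroup[of y]] by (auto simp: subgroups_def)

lemma meet_L:
  assumes x: "x \<in> carrier L" and y: "y \<in> carrier L"
  shows "x \<sqinter>\<^bsub>L\<^esub> y = cd (dc x \<inter> dc y)"
proof -
  have "greatest L (cd (free W \<inter> (dc x \<inter> dc y))) (Lower L {x, y})"
    using inf_L_greatest[of "{x, y}"] x y by simp
  moreover have "free W \<inter> (dc x \<inter> dc y) = dc x \<inter> dc y" using subgroups_free[OF dc_subgroup[OF x]] by blast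
  ultimately show ?thesis
    unfolding meet_def inf_def by (intro some_equality) (auto intro: greatest_unique)
qed

lemma zero_subgroup: "{0} \<in> subgroups W"
  using subgroups_zero[OF free_subgroup[of W]] by (simp add: subgroups_def)

lemma top_L: "\<top>\<^bsub>L\<^esub> = cd (free W)"
proof -
  have "greatest L (cd (free W)) (carrier L)"
    using subgroups_free[OF dc_subgroup] by (auto simp: greatest_def le_L free_subgroup)
  then show ?thesis unfolding top_def by (intro some_equality) (auto intro: greatest_unique)
qed

lemma bottom_L: "\<bottom>\<^bsub>L\<^esub> = cd {0}"
proof -
  have "least L (cd {0}) (carrier L)"
    using subgroups_zero[OF dc_subgroup] by (auto simp: least_def le_L zero_subgroup)
  then show ?thesis unfolding bottom_def by (intro some_equality) (auto intro: least_unique)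
qed

lemma bounded_lattice_L: "bounded_lattice L"
  by unfold_locales

text \<open>The essential inclusion: if \<open>a + b\<close> lies in \<open>z\<close> and
  \<open>a\<close> in \<open>x\<close>, hence in \<open>z\<close>, then \<open>b\<close> lies in
  \<open>z\<close> too, by subtraction.\<close>

lemma modular_lattice_L: "modular_lattice L"
  unfolding modular_lattice_def
proof (intro conjI ballI impI)
  show "lattice L" by unfold_locales
  fix x y z assume x: "x \<in> carrier L" and y: "y \<in> carrier L" and z: "z \<in> carrier L" and xz: "x \<sqsubseteq>\<^bsub>L\<^esub> z"
  note S = dc_subgroup[OF x] dc_subgroup[OF y] dc_subgroup[OF z]
  have "subgroup_sum (dc x) (dc y \<inter> dc z) = subgroup_sum (dc x) (dc y) \<inter> dc z"
  proof (intro equalityI subsetI)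
    fix c assume "c \<in> subgroup_sum (dc x) (dc y \<inter> dc z)"
    then show "c \<in> subgroup_sum (dc x) (dc y) \<inter> dc z"
      using xz subgroups_add[OF S(3)] by (auto simp: subgroup_sum_def le_L)
  next
    fix c assume "c \<in> subgroup_sum (dc x) (dc y) \<inter> dc z"
    then obtain a b where c: "c = a + b" "a \<in> dc x" "b \<in> dc y" "c \<in> dc z" by (auto simp: subgroup_sum_def)
    have "c - a \<in> dc z" using subgroups_diff[OF S(3) c(4)] c(2) xz by (auto simp: le_L)
    then show "c \<in> subgroup_sum (dc x) (dc y \<inter> dc z)" using c by (auto simp: subgroup_sum_def)
  qed
  then show "x \<squnion>\<^bsub>L\<^esub> (y \<sqinter>\<^bsub>L\<^esub> z) = (x \<squnion>\<^bsub>L\<^esub> y) \<sqinter>\<^bsub>L\<^esub> z"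
    using x y z S by (simp add: join_L meet_L subgroup_sum_subgroup meet_subgroup)
qed

text \<open>The joins of finite subfamilies are directed, so their union is already a subgroup and
  contains the full join. The single generator \<open>c\<close> therefore lies in one of
  them.\<close>

lemma cyclic_compact:
  assumes c: "c \<in> free W" shows "compact_element L (cd (generated_subgroup W {c}))"
  unfolding compact_element_def
proof (intro conjI allI impI)
  have S: "generated_subgroup W {c} \<in> subgroups W" using c by (intro generated_subgroup_subgroup) auto
  then show "cd (generated_subgroup W {c}) \<in> carrier L" by simp
  have le_iff: "cd (generated_subgroup W {c}) \<sqsubseteq>\<^bsub>L\<^esub> \<Squnion>\<^bsub>L\<^esub>A \<longleftrightarrow> c \<in> generated_subgroup W (\<Union>x\<in>A. dc x)"
    if "A \<subseteq> carrier L" for A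
    using that S generated_subgroup_subgroup[OF Union_free[OF that]] generated_subgroup_upper[of "{c}" W]
      generated_subgroup_least[of "generated_subgroup W (\<Union>x\<in>A. dc x)" W "{c}"]
    by (auto simp: le_L sup_L)
  fix A assume A: "A \<subseteq> carrier L" and "cd (generated_subgroup W {c}) \<sqsubseteq>\<^bsub>L\<^esub> \<Squnion>\<^bsub>L\<^esub>A"
  then have cA: "c \<in> generated_subgroup W (\<Union>x\<in>A. dc x)" using le_iff by simp
  let ?g = "\<lambda>B. generated_subgroup W (\<Union>x\<in>B. dc x)"
  let ?D = "\<Union>{?g B |B. B \<subseteq> A \<and> finite B}"
  have g: "?g B \<in> subgroups W" if "B \<subseteq> A" for B
    using generated_subgroup_subgroup[OF Union_free] that A by blast
  have mono: "?g B \<subseteq> ?g B'" if "B \<subseteq> B'" "B' \<subseteq> A" for B B'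
    using that generated_subgroup_upper[of "\<Union>x\<in>B'. dc x" W] by (intro generated_subgroup_least g) auto
  have "?D \<in> subgroups W"
    unfolding subgroups_def
  proof (intro CollectI conjI ballI)
    show "?D \<subseteq> free W" using subgroups_free[OF g] by blast
    show "0 \<in> ?D" using subgroups_zero[OF g[of "{}"]] by auto
    fix a b assume "a \<in> ?D" "b \<in> ?D"
    then obtain B B' where B: "B \<subseteq> A" "finite B" "a \<in> ?g B" "B' \<subseteq> A" "finite B'" "b \<in> ?g B'" by blast
    then have "a \<in> ?g (B \<union> B')" "b \<in> ?g (B \<union> B')" using mono[of B "B \<union> B'"] mono[of B' "B \<union> B'"] by auto
    then have "a - b \<in> ?g (B \<union> B')" using subgroups_diff[OF g[of "B \<union> B'"]] B by simp
    moreover have "B \<union> B' \<subseteq> A \<and> finite (B \<union> B')" using B by simp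
    ultimately show "a - b \<in> ?D" by (intro UnionI[of "?g (B \<union> B')"] CollectI exI[of _ "B \<union> B'"]) simp_all
  qed
  moreover have "(\<Union>x\<in>A. dc x) \<subseteq> ?D"
  proof
    fix d assume "d \<in> (\<Union>x\<in>A. dc x)"
    then obtain x where x: "x \<in> A" "d \<in> dc x" by blast
    then have "d \<in> ?g {x}" using generated_subgroup_upper[of "dc x" W] by auto
    then show "d \<in> ?D" using x by (intro UnionI[of "?g {x}"] CollectI exI[of _ "{x}"]) simp_all
  qed
  ultimately have "?g A \<subseteq> ?D" by (rule generated_subgroup_least)
  then have "c \<in> ?D" using cA by (rule subsetD)
  then obtain B where B: "B \<subseteq> A" "finite B" "c \<in> ?g B" by blast
  then have "cd (generated_subgroup W {c}) \<sqsubseteq>\<^bsub>L\<^esub> \<Squnion>\<^bsub>L\<^esub>B" using A by (simp add: le_iff)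
  then show "\<exists>B\<subseteq>A. finite B \<and> cd (generated_subgroup W {c}) \<sqsubseteq>\<^bsub>L\<^esub> \<Squnion>\<^bsub>L\<^esub>B"
    using B(1,2) by (intro exI[of _ B] conjI)
qed

text \<open>A subgroup is the union, and hence the join, of the cyclic subgroups of its
  elements.\<close>

lemma algebraic_lattice_L: "algebraic_lattice L"
  unfolding algebraic_lattice_def
proof (intro conjI ballI complete_lattice_L)
  fix x assume x: "x \<in> carrier L"
  let ?A = "(\<lambda>c. cd (generated_subgroup W {c})) ` dc x"
  have S: "generated_subgroup W {c} \<in> subgroups W" if "c \<in> dc x" for c
    using subgroups_free[OF dc_subgroup[OF x] that] by (intro generated_subgroup_subgroup) auto
  then have A: "?A \<subseteq> carrier L" by auto
  have g: "generated_subgroup W {c} \<subseteq> dc x" if "c \<in> dc x" for c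
    using that by (intro generated_subgroup_least dc_subgroup x) simp
  have "(\<Union>y\<in>?A. dc y) = dc x"
  proof
    show "(\<Union>y\<in>?A. dc y) \<subseteq> dc x"
      using S g by fastforce
    show "dc x \<subseteq> (\<Union>y\<in>?A. dc y)" using S generated_subgroup_upper[of "{_}" W] by auto
  qed
  moreover have "generated_subgroup W (dc x) = dc x"
    using generated_subgroup_upper[of "dc x" W] generated_subgroup_least[OF dc_subgroup[OF x]] by blast
  ultimately have "x = \<Squnion>\<^bsub>L\<^esub>?A" using sup_L[OF A] x by simp
  moreover have "?A \<subseteq> {k. compact_element L k}"
    using cyclic_compact subgroups_free[OF dc_subgroup[OF x]] by blast
  ultimately show "\<exists>A\<subseteq>{k. compact_element L k}. x = \<Squnion>\<^bsub>L\<^esub>A" by blast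
qed

end


section \<open>The noetherian form\<close>

definition subgroup_form ::
  "('o, 'm) cat \<Rightarrow> ('o \<Rightarrow> 'w set) \<Rightarrow> ('m \<Rightarrow> 'w \<Rightarrow> 'w) \<Rightarrow> ('o, 'm, 'u) form" where
  "subgroup_form C W w =
    \<lparr>Fib = (\<lambda>X. subgroup_lattice (W X)),
      dir = (\<lambda>f u. encode (W (Cod C f)) (frag_map (w f) ` decode (W (Dom C f)) u)),
      inv = (\<lambda>f u. encode (W (Dom C f)) {c \<in> free (W (Dom C f)). frag_map (w f) c \<in> decode (W (Cod C f)) u})\<rparr>"

text \<open>The facts about the set-valued functor of elements from which the form is built,
  separated from the variety. \<open>kernel_join\<close> and \<open>image_meet\<close> ask only for
  some arrow with the right kernel or image, because (N3) speaks of normality and conormality and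
  demands no universal property.\<close>

locale concrete_transfer = category_on C
  for C :: "('o, 'm) cat" +
  fixes W :: "'o \<Rightarrow> 'w set" and w :: "'m \<Rightarrow> 'w \<Rightarrow> 'w" and F :: "('o, 'm, 'u) form"
  assumes U: "universe TYPE('u)"
    and W_small: "X \<in> Obj C \<Longrightarrow> small TYPE('u) (W X)"
    and w: "f \<in> Arr C \<Longrightarrow> w f \<in> W (Dom C f) \<rightarrow> W (Cod C f)"
    and w_Idn: "X \<in> Obj C \<Longrightarrow> x \<in> W X \<Longrightarrow> w (Idn C X) x = x"
    and w_Comp: "f \<in> Arr C \<Longrightarrow> g \<in> Arr C \<Longrightarrow> Cod C f = Dom C g \<Longrightarrow> x \<in> W (Dom C f) \<Longrightarrow>
      w (Comp C g f) x = w g (w f x)"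
    and factorization: "f \<in> Arr C \<Longrightarrow> \<exists>e\<in>strong_epis C. \<exists>m\<in>mono_arrs C. Cod C e = Dom C m \<and> f = Comp C m e"
    and w_mono: "is_mono C m \<Longrightarrow> inj_on (w m) (W (Dom C m))"
    and w_strong_epi: "e \<in> strong_epis C \<Longrightarrow> w e ` W (Dom C e) = W (Cod C e)"
    and mono_factor: "is_mono C m \<Longrightarrow> is_mono C n \<Longrightarrow> Cod C m = Cod C n \<Longrightarrow>
      w n ` W (Dom C n) \<subseteq> w m ` W (Dom C m) \<Longrightarrow>
      \<exists>h\<in>Arr C. Dom C h = Dom C n \<and> Cod C h = Dom C m \<and> Comp C m h = n"
    and epi_factor: "e \<in> strong_epis C \<Longrightarrow> g \<in> strong_epis C \<Longrightarrow> Dom C e = Dom C g \<Longrightarrow>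
      (\<And>x y. x \<in> W (Dom C e) \<Longrightarrow> y \<in> W (Dom C e) \<Longrightarrow> w e x = w e y \<Longrightarrow> w g x = w g y) \<Longrightarrow>
      \<exists>h\<in>Arr C. Dom C h = Cod C e \<and> Cod C h = Cod C g \<and> Comp C h e = g"
    and kernel_join: "e \<in> strong_epis C \<Longrightarrow> g \<in> strong_epis C \<Longrightarrow> Dom C e = Dom C g \<Longrightarrow>
      \<exists>d\<in>Arr C. Dom C d = Dom C e \<and> (\<forall>x\<in>W (Dom C e). \<forall>y\<in>W (Dom C e). w d x = w d y \<longleftrightarrow>
        (\<lambda>u v. u \<in> W (Dom C e) \<and> v \<in> W (Dom C e) \<and> (w e u = w e v \<or> w g u = w g v))\<^sup>*\<^sup>* x y)"
    and image_meet: "is_mono C m \<Longrightarrow> is_mono C n \<Longrightarrow> Cod C m = Cod C n \<Longrightarrow>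
      \<exists>d\<in>Arr C. Cod C d = Cod C m \<and> w d ` W (Dom C d) = w m ` W (Dom C m) \<inter> w n ` W (Dom C n)"
    and F_def: "F = subgroup_form C W w"
begin

lemma small_basis_Fib: "X \<in> Obj C \<Longrightarrow> small_basis (W X) (Fib F X)"
  using U W_small by unfold_locales (auto simp: F_def subgroup_form_def)

definition ker :: "'m \<Rightarrow> ('w \<Rightarrow>\<^sub>0 int) set" where
  "ker f = {c \<in> free (W (Dom C f)). frag_map (w f) c = 0}"

lemma ker_subgroup: "f \<in> Arr C \<Longrightarrow> ker f \<in> subgroups (W (Dom C f))"
  unfolding ker_def
  using subgroups_preimage[OF small_basis.zero_subgroup[OF small_basis_Fib[OF Cod_Obj]]] by simp

lemma dir_encode:
  assumes f: "f \<in> Arr C" and S: "S \<in> subgroups (W (Dom C f))"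
  shows "dir F f (encode (W (Dom C f)) S) = encode (W (Cod C f)) (frag_map (w f) ` S)"
  using small_basis.dc_cd[OF small_basis_Fib[OF Dom_Obj[OF f]] S] by (simp add: F_def subgroup_form_def)

lemma inv_encode:
  assumes f: "f \<in> Arr C" and S: "S \<in> subgroups (W (Cod C f))"
  shows "inv F f (encode (W (Cod C f)) S) =
    encode (W (Dom C f)) {c \<in> free (W (Dom C f)). frag_map (w f) c \<in> S}"
  using small_basis.dc_cd[OF small_basis_Fib[OF Cod_Obj[OF f]] S] by (simp add: F_def subgroup_form_def)

lemma image_subgroup: "f \<in> Arr C \<Longrightarrow> S \<in> subgroups (W (Dom C f)) \<Longrightarrow> frag_map (w f) ` S \<in> subgroups (W (Cod C f))"
  by (rule subgroups_image[OF _ w])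

lemma carrier_FibE:
  assumes "X \<in> Obj C" "u \<in> carrier (Fib F X)"
  obtains S where "S \<in> subgroups (W X)" "u = encode (W X) S"
  using small_basis.carrier_L[OF small_basis_Fib[OF assms(1)]] assms(2) by auto

lemma encode_carrier: "X \<in> Obj C \<Longrightarrow> S \<in> subgroups (W X) \<Longrightarrow> encode (W X) S \<in> carrier (Fib F X)"
  using small_basis.cd_carrier[OF small_basis_Fib] .

lemma encode_le:
  "X \<in> Obj C \<Longrightarrow> S \<in> subgroups (W X) \<Longrightarrow> S' \<in> subgroups (W X) \<Longrightarrow>
    encode (W X) S \<sqsubseteq>\<^bsub>Fib F X\<^esub> encode (W X) S' \<longleftrightarrow> S \<subseteq> S'"
  using small_basis.le_L[OF small_basis_Fib] small_basis.dc_cd[OF small_basis_Fib] by metis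

lemma encode_join:
  "X \<in> Obj C \<Longrightarrow> S \<in> subgroups (W X) \<Longrightarrow> S' \<in> subgroups (W X) \<Longrightarrow>
    encode (W X) S \<squnion>\<^bsub>Fib F X\<^esub> encode (W X) S' = encode (W X) (subgroup_sum S S')"
  using small_basis.join_L[OF small_basis_Fib] small_basis.dc_cd[OF small_basis_Fib] encode_carrier by metis

lemma encode_meet:
  "X \<in> Obj C \<Longrightarrow> S \<in> subgroups (W X) \<Longrightarrow> S' \<in> subgroups (W X) \<Longrightarrow>
    encode (W X) S \<sqinter>\<^bsub>Fib F X\<^esub> encode (W X) S' = encode (W X) (S \<inter> S')"
  using small_basis.meet_L[OF small_basis_Fib] small_basis.dc_cd[OF small_basis_Fib] encode_carrier by metis

lemma preimage_subgroup:
  "f \<in> Arr C \<Longrightarrow> S \<in> subgroups (W (Cod C f)) \<Longrightarrow> {c \<in> free (W (Dom C f)). frag_map (w f) c \<in> S} \<in> subgroups (W (Dom C f))"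
  by (rule subgroups_preimage)

lemma form_Im_eq:
  assumes f: "f \<in> Arr C"
  shows "form_Im C F f = encode (W (Cod C f)) (free (w f ` W (Dom C f)))"
  using dir_encode[OF f free_subgroup] small_basis.top_L[OF small_basis_Fib[OF Dom_Obj[OF f]]]
    image_free[OF w[OF f]] by (simp add: form_Im_def)

lemma form_Ker_eq:
  assumes f: "f \<in> Arr C"
  shows "form_Ker C F f = encode (W (Dom C f)) (ker f)"
  using inv_encode[OF f small_basis.zero_subgroup[OF small_basis_Fib[OF Cod_Obj[OF f]]]]
    small_basis.bottom_L[OF small_basis_Fib[OF Cod_Obj[OF f]]] by (simp add: form_Ker_def ker_def)

lemma Im_subgroup: "f \<in> Arr C \<Longrightarrow> free (w f ` W (Dom C f)) \<in> subgroups (W (Cod C f))"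
  using image_subgroup[OF _ free_subgroup] image_free[OF w] by metis

text \<open>A set is recovered from its free group as the set of generators that belong to
  it.\<close>

lemma free_mono_iff: "free A \<subseteq> free B \<longleftrightarrow> A \<subseteq> B"
  by (auto simp: free_def) (metis frag_of_free free_def mem_Collect_eq subset_iff)

lemma form_Im_le:
  assumes "f \<in> Arr C" "g \<in> Arr C" "Cod C f = Cod C g"
  shows "form_Im C F f \<sqsubseteq>\<^bsub>Fib F (Cod C g)\<^esub> form_Im C F g \<longleftrightarrow> w f ` W (Dom C f) \<subseteq> w g ` W (Dom C g)"
  using assms Im_subgroup[of f] Im_subgroup[of g] by (simp add: form_Im_eq encode_le free_mono_iff)

lemma diff_free: "x \<in> A \<Longrightarrow> y \<in> A \<Longrightarrow> frag_of x - frag_of y \<in> free A"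
  by (rule subgroups_diff[OF free_subgroup]) simp_all

text \<open>The differences of identified generators generate \<open>ker f\<close>, so inclusion in
  any subgroup is tested on them. The generality in \<open>S\<close> matters: for (N3) it is a sum
  of two kernels.\<close>

lemma ker_le_iff:
  assumes f: "f \<in> Arr C" and S: "S \<in> subgroups (W (Dom C f))"
  shows "ker f \<subseteq> S \<longleftrightarrow>
    (\<forall>x\<in>W (Dom C f). \<forall>y\<in>W (Dom C f). w f x = w f y \<longrightarrow> frag_of x - frag_of y \<in> S)"
proof
  assume "ker f \<subseteq> S"
  moreover have "frag_of x - frag_of y \<in> ker f"
    if "x \<in> W (Dom C f)" "y \<in> W (Dom C f)" "w f x = w f y" for x y
    using that by (simp add: ker_def diff_free)
  ultimately show "\<forall>x\<in>W (Dom C f). \<forall>y\<in>W (Dom C f). w f x = w f y \<longrightarrow> frag_of x - frag_of y \<in> S" by blast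
next
  assume "\<forall>x\<in>W (Dom C f). \<forall>y\<in>W (Dom C f). w f x = w f y \<longrightarrow> frag_of x - frag_of y \<in> S"
  then show "ker f \<subseteq> S" using kernel_generated_by_differences[OF S, of "w f"] by (auto simp: ker_def)
qed

text \<open>Recovers the equivalence relation of \<open>f\<close> from the subgroup
  \<open>ker f\<close>, since distinct generators of a free group stay distinct.\<close>

lemma diff_mem_ker:
  "x \<in> W (Dom C f) \<Longrightarrow> y \<in> W (Dom C f) \<Longrightarrow> frag_of x - frag_of y \<in> ker f \<longleftrightarrow> w f x = w f y"
  by (simp add: ker_def frag_of_eq diff_free)

lemma form_Ker_le:
  assumes f: "f \<in> Arr C" "g \<in> Arr C" "Dom C f = Dom C g"
  shows "form_Ker C F f \<sqsubseteq>\<^bsub>Fib F (Dom C f)\<^esub> form_Ker C F g \<longleftrightarrow>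
    (\<forall>x\<in>W (Dom C f). \<forall>y\<in>W (Dom C f). w f x = w f y \<longrightarrow> w g x = w g y)"
  using f ker_subgroup[OF f(1)] ker_subgroup[OF f(2)] diff_mem_ker[of _ g]
  by (simp add: form_Ker_eq encode_le ker_le_iff)

section \<open>Embeddings and quotients of the form\<close>

text \<open>Removing a surjective first factor leaves the image unchanged, and removing an injective
  second factor leaves the kernel unchanged. So every conormal cluster comes from a monomorphism and
  every normal one from a strong epimorphism.\<close>

lemma factor:
  assumes f: "f \<in> Arr C"
  obtains e m where "e \<in> strong_epis C" "is_mono C m" "e \<in> Arr C" "m \<in> Arr C" "Cod C e = Dom C m" "f = Comp C m e"
    "Dom C e = Dom C f" "Cod C m = Cod C f" "form_Im C F m = form_Im C F f" "form_Ker C F e = form_Ker C F f"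
proof -
  obtain e m where em: "e \<in> strong_epis C" "is_mono C m" "Cod C e = Dom C m" "f = Comp C m e"
    using factorization[OF f] by (auto simp: mono_arrs_def)
  then have A: "e \<in> Arr C" "m \<in> Arr C" using strong_epis_Arr is_mono_Arr by auto
  have "w f ` W (Dom C f) = w m ` w e ` W (Dom C e)"
    unfolding em(4) image_image using A em(3) by (intro image_cong) (simp_all add: w_Comp)
  then have "w f ` W (Dom C f) = w m ` W (Dom C m)" using w_strong_epi[OF em(1)] em(3) by simp
  then have Im: "form_Im C F m = form_Im C F f" using A em f by (simp add: form_Im_eq)
  have "w f x = w f y \<longleftrightarrow> w e x = w e y" if "x \<in> W (Dom C e)" "y \<in> W (Dom C e)" for x y
  proof -
    have "w e x \<in> W (Dom C m)" "w e y \<in> W (Dom C m)" using w[OF A(1)] that em(3) by auto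
    then show ?thesis using that A em w_mono[OF em(2)] by (simp add: w_Comp inj_on_eq_iff)
  qed
  then have "ker e = ker f"
    using A em f ker_le_iff[OF A(1), of "ker f"] ker_le_iff[OF f, of "ker e"] ker_subgroup[OF A(1)] ker_subgroup[OF f]
    by (intro antisym) (simp_all add: diff_mem_ker)
  then have Ker: "form_Ker C F e = form_Ker C F f" using A em f by (simp add: form_Ker_eq)
  show thesis using that[OF em(1,2) A em(3,4) _ _ Im Ker] em A by simp
qed

text \<open>\<open>mono_factor\<close> compares monomorphisms only, so an arbitrary \<open>f\<close>
  below the image of \<open>m\<close> is replaced by its mono part, which has the same image; its
  strong epi part is composed on afterwards.\<close>

lemma embedding_mono:
  assumes m: "is_mono C m" shows "embedding_of C F (Cod C m) (form_Im C F m) m"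
proof -
  have mA: "m \<in> Arr C" using is_mono_Arr[OF m] .
  have "form_Im C F m \<in> carrier (Fib F (Cod C m))"
    using mA encode_carrier[OF _ Im_subgroup[OF mA]] by (simp add: form_Im_eq)
  moreover have "\<exists>!h. h \<in> Hom C (Dom C f) (Dom C m) \<and> f = Comp C m h"
    if f: "f \<in> Arr C" "Cod C f = Cod C m" "form_Im C F f \<sqsubseteq>\<^bsub>Fib F (Cod C m)\<^esub> form_Im C F m" for f
  proof -
    obtain e n where n: "is_mono C n" "e \<in> Arr C" "n \<in> Arr C" "Cod C e = Dom C n" "f = Comp C n e"
      "Dom C e = Dom C f" "Cod C n = Cod C f" "form_Im C F n = form_Im C F f"
      using factor[OF f(1)] .
    have "w n ` W (Dom C n) \<subseteq> w m ` W (Dom C m)"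
      using form_Im_le[OF n(3) mA] n(7,8) f(2,3) by simp
    then obtain h where h: "h \<in> Arr C" "Dom C h = Dom C n" "Cod C h = Dom C m" "Comp C m h = n"
      using mono_factor[OF m n(1)] n(7) f(2) by auto
    have "Comp C m (Comp C h e) = Comp C (Comp C m h) e"
      using h(1-3) n(2-4) mA by (simp add: Comp_assoc)
    then have he: "Comp C h e \<in> Hom C (Dom C f) (Dom C m)" "f = Comp C m (Comp C h e)"
      using h n(2,4,6) n(5)[symmetric] by (simp_all add: Hom_def)
    show ?thesis
    proof (rule ex1I[of _ "Comp C h e"])
      fix k assume k: "k \<in> Hom C (Dom C f) (Dom C m) \<and> f = Comp C m k"
      then have "Comp C m k = Comp C m (Comp C h e)" using he by simp
      then show "k = Comp C h e" by (rule mono_cancel[OF m]) (use k he in \<open>simp_all add: Hom_def\<close>)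
    qed (use he in simp)
  qed
  ultimately show ?thesis using mA unfolding embedding_of_def conormal_def by blast
qed

text \<open>Dually, \<open>f\<close> is replaced by its strong epi part, which has the same kernel
  and so can be compared with \<open>e\<close>.\<close>

lemma quotient_strong_epi:
  assumes e: "e \<in> strong_epis C" shows "quotient_of C F (Dom C e) (form_Ker C F e) e"
proof -
  have eA: "e \<in> Arr C" using strong_epis_Arr[OF e] .
  have "form_Ker C F e \<in> carrier (Fib F (Dom C e))"
    using eA encode_carrier[OF _ ker_subgroup[OF eA]] by (simp add: form_Ker_eq)
  moreover have "\<exists>!h. h \<in> Hom C (Cod C e) (Cod C f) \<and> f = Comp C h e"
    if f: "f \<in> Arr C" "Dom C f = Dom C e" "form_Ker C F e \<sqsubseteq>\<^bsub>Fib F (Dom C e)\<^esub> form_Ker C F f" for f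
  proof -
    obtain g n where n: "g \<in> strong_epis C" "is_mono C n" "g \<in> Arr C" "n \<in> Arr C" "Cod C g = Dom C n" "f = Comp C n g"
      "Dom C g = Dom C f" "Cod C n = Cod C f" and Ker: "form_Ker C F g = form_Ker C F f"
      using factor[OF f(1)] .
    have ker: "\<forall>x\<in>W (Dom C e). \<forall>y\<in>W (Dom C e). w e x = w e y \<longrightarrow> w g x = w g y"
      by (subst form_Ker_le[OF eA n(3), symmetric]) (use n(7) f(2,3) Ker in simp_all)
    have "\<exists>h\<in>Arr C. Dom C h = Cod C e \<and> Cod C h = Cod C g \<and> Comp C h e = g"
      using n(7) f(2) ker[rule_format] by (intro epi_factor[OF e n(1)]) (simp, assumption)
    then obtain h where h: "h \<in> Arr C" "Dom C h = Cod C e" "Cod C h = Cod C g" "Comp C h e = g" by blast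
    have "Comp C (Comp C n h) e = Comp C n (Comp C h e)"
      using h(1-3) n(3-5) eA by (simp add: Comp_assoc)
    then have nh: "Comp C n h \<in> Hom C (Cod C e) (Cod C f)" "f = Comp C (Comp C n h) e"
      using h n(4,5,8) n(6)[symmetric] by (simp_all add: Hom_def)
    show ?thesis
    proof (rule ex1I[of _ "Comp C n h"])
      fix k assume k: "k \<in> Hom C (Cod C e) (Cod C f) \<and> f = Comp C k e"
      then have "Comp C k e = Comp C (Comp C n h) e" using nh by simp
      then show "k = Comp C n h"
        by (rule epi_cancel[OF strong_epis_epi[OF e]]) (use k nh in \<open>simp_all add: Hom_def\<close>)
    qed (use nh in simp)
  qed
  ultimately show ?thesis using eA unfolding quotient_of_def normal_def by blast
qed

text \<open>The composite \<open>Comp C \<iota> f\<close> lies below the image of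
  \<open>\<iota>\<close>, and \<open>f\<close> and \<open>g\<close> are both factors of it, so the
  uniqueness in the universal property is left cancellation.\<close>

lemma embedding_is_mono:
  assumes \<iota>: "embedding_of C F X S \<iota>" shows "is_mono C \<iota>"
  unfolding is_mono_def
proof (intro conjI ballI impI; (elim conjE)?)
  have A: "\<iota> \<in> Arr C" "Cod C \<iota> = X" "form_Im C F \<iota> = S" using \<iota> by (auto simp: embedding_of_def)
  then show "\<iota> \<in> Arr C" by simp
  fix f g assume fg: "f \<in> Arr C" "g \<in> Arr C" "Dom C f = Dom C g" "Cod C f = Dom C \<iota>" "Cod C g = Dom C \<iota>"
    "Comp C \<iota> f = Comp C \<iota> g"
  let ?k = "Comp C \<iota> f"
  have k: "?k \<in> Arr C" "Cod C ?k = X" "Dom C ?k = Dom C f" using A fg by auto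
  have "w ?k ` W (Dom C ?k) \<subseteq> w \<iota> ` W (Dom C \<iota>)"
    using A fg(1,4) w[OF fg(1)] k(3) by (auto simp: w_Comp)
  then have "form_Im C F ?k \<sqsubseteq>\<^bsub>Fib F X\<^esub> S" using form_Im_le[of ?k \<iota>] A k by simp
  then have "\<exists>!h. h \<in> Hom C (Dom C ?k) (Dom C \<iota>) \<and> ?k = Comp C \<iota> h"
    using \<iota> k(1,2) unfolding embedding_of_def by blast
  then have "\<exists>!h. h \<in> Hom C (Dom C f) (Dom C \<iota>) \<and> ?k = Comp C \<iota> h" unfolding k(3) .
  moreover have "f \<in> Hom C (Dom C f) (Dom C \<iota>)" "g \<in> Hom C (Dom C f) (Dom C \<iota>)" using fg by (auto simp: Hom_def)
  ultimately show "f = g" using fg(6) by metis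
qed

text \<open>The strong epi part \<open>e\<close> of \<open>\<pi>\<close> has the same kernel, so
  \<open>\<pi>\<close> factors it. The factor \<open>h\<close> is inverse to the mono part: on one
  side by uniqueness for \<open>\<pi>\<close>, on the other because \<open>e\<close> is epi.\<close>

lemma quotient_is_strong_epi:
  assumes \<pi>: "quotient_of C F X K \<pi>" shows "\<pi> \<in> strong_epis C"
proof -
  have A: "\<pi> \<in> Arr C" "Dom C \<pi> = X" "form_Ker C F \<pi> = K" using \<pi> by (auto simp: quotient_of_def)
  obtain e m where em: "e \<in> strong_epis C" "is_mono C m" "e \<in> Arr C" "m \<in> Arr C" "Cod C e = Dom C m" "\<pi> = Comp C m e"
    "Dom C e = Dom C \<pi>" "Cod C m = Cod C \<pi>" and Ker: "form_Ker C F e = form_Ker C F \<pi>"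
    using factor[OF A(1)] .
  have univ: "\<exists>!h. h \<in> Hom C (Cod C \<pi>) (Cod C g) \<and> g = Comp C h \<pi>"
    if "g \<in> Arr C" "Dom C g = X" "K \<sqsubseteq>\<^bsub>Fib F X\<^esub> form_Ker C F g" for g
    using \<pi> that unfolding quotient_of_def by auto
  have K: "K \<sqsubseteq>\<^bsub>Fib F X\<^esub> K" using form_Ker_le[of \<pi> \<pi>] A by simp
  obtain h where h: "h \<in> Arr C" "Dom C h = Cod C \<pi>" "Cod C h = Cod C e" "e = Comp C h \<pi>"
    using univ[OF em(3)] em(7) A(2,3) K Ker by (auto simp: Hom_def)
  have "Comp C (Comp C m h) \<pi> = Comp C m (Comp C h \<pi>)" using h(1-3) em(4,5) A(1) by (simp add: Comp_assoc)
  then have "Comp C (Comp C m h) \<pi> = \<pi>" using h(4)[symmetric] em(6)[symmetric] by simp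
  moreover have "Comp C m h \<in> Hom C (Cod C \<pi>) (Cod C \<pi>)" using h(1-3) em(4,5,8) by (simp add: Hom_def)
  moreover have "Idn C (Cod C \<pi>) \<in> Hom C (Cod C \<pi>) (Cod C \<pi>)" "Comp C (Idn C (Cod C \<pi>)) \<pi> = \<pi>"
    using A by (auto simp: Hom_def)
  ultimately have mh: "Comp C m h = Idn C (Cod C \<pi>)" using univ[OF A(1,2)] K A(3) by metis
  have "Comp C (Comp C h m) e = Comp C (Idn C (Cod C e)) e"
    using h(1-3) em(3,4,5,8) h(4)[symmetric] em(6)[symmetric] by (simp add: Comp_assoc)
  then have "Comp C h m = Idn C (Cod C e)"
    by (rule epi_cancel[OF strong_epis_epi[OF em(1)]]) (use h(1-3) em(3,4,5,8) in simp_all)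
  then have "is_iso C m" using mh h(1-3) em(4,5,8) by (intro is_isoI[of m h]) simp_all
  then show ?thesis unfolding em(6) by (intro strong_epis_Comp iso_strong_epi em(1,5))
qed

section \<open>The axioms of a noetherian form\<close>

lemma is_form_F: "is_form C F"
  unfolding is_form_def
proof (intro conjI ballI impI)
  fix X assume X: "X \<in> Obj C"
  show "bounded_lattice (Fib F X)" by (rule small_basis.bounded_lattice_L[OF small_basis_Fib[OF X]])
  show "small TYPE('u) (carrier (Fib F X))" by (rule small_basis.small_carrier[OF small_basis_Fib[OF X]])
  fix S assume "S \<in> carrier (Fib F X)"
  then obtain A where A: "A \<in> subgroups (W X)" "S = encode (W X) A" by (rule carrier_FibE[OF X])
  have id: "frag_map (w (Idn C X)) c = c" if "c \<in> free (W X)" for c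
    using frag_map_cong[OF that, of "w (Idn C X)" "\<lambda>x. x"] w_Idn[OF X] by (simp add: frag_map_ident)
  have "frag_map (w (Idn C X)) ` A = A" using id subgroups_free[OF A(1)] by force
  then show "dir F (Idn C X) S = S" using dir_encode[of "Idn C X" A] A X by simp
  have "{c \<in> free (W X). frag_map (w (Idn C X)) c \<in> A} = A" using id subgroups_free[OF A(1)] by auto
  then show "inv F (Idn C X) S = S" using inv_encode[of "Idn C X" A] A X by simp
next
  fix f assume f: "f \<in> Arr C"
  note X = Dom_Obj[OF f] and Y = Cod_Obj[OF f]
  have wpo: "weak_partial_order (Fib F X)" if "X \<in> Obj C" for X
    using small_basis.partial_order_L[OF small_basis_Fib[OF that]] partial_order_def by blast
  show "dir F f \<in> carrier (Fib F (Dom C f)) \<rightarrow> carrier (Fib F (Cod C f))"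
    by (auto elim!: carrier_FibE[OF X] simp: dir_encode[OF f] image_subgroup[OF f] encode_carrier[OF Y])
  show "inv F f \<in> carrier (Fib F (Cod C f)) \<rightarrow> carrier (Fib F (Dom C f))"
    by (auto elim!: carrier_FibE[OF Y] simp: inv_encode[OF f] preimage_subgroup[OF f] encode_carrier[OF X])
  show "isotone (Fib F (Dom C f)) (Fib F (Cod C f)) (dir F f)"
    by (rule isotoneI[OF wpo[OF X] wpo[OF Y]])
      (auto elim!: carrier_FibE[OF X] simp: dir_encode[OF f] encode_le[OF X] encode_le[OF Y] image_subgroup[OF f] image_mono)
  show "isotone (Fib F (Cod C f)) (Fib F (Dom C f)) (inv F f)"
    by (rule isotoneI[OF wpo[OF Y] wpo[OF X]])
      (auto elim!: carrier_FibE[OF Y] simp: inv_encode[OF f] encode_le[OF X] encode_le[OF Y] preimage_subgroup[OF f])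
  fix S T assume "S \<in> carrier (Fib F (Dom C f))" "T \<in> carrier (Fib F (Cod C f))"
  then obtain A B where "A \<in> subgroups (W (Dom C f))" "S = encode (W (Dom C f)) A"
      "B \<in> subgroups (W (Cod C f))" "T = encode (W (Cod C f)) B"
    using carrier_FibE[OF X] carrier_FibE[OF Y] by metis
  then show "dir F f S \<sqsubseteq>\<^bsub>Fib F (Cod C f)\<^esub> T \<longleftrightarrow> S \<sqsubseteq>\<^bsub>Fib F (Dom C f)\<^esub> inv F f T"
    using subgroups_free
    by (auto simp: dir_encode[OF f] inv_encode[OF f] encode_le[OF X] encode_le[OF Y] image_subgroup[OF f]
        preimage_subgroup[OF f])
next
  fix f g assume f: "f \<in> Arr C" and g: "g \<in> Arr C" and fg: "Cod C f = Dom C g"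
  have gf: "Comp C g f \<in> Arr C" "Dom C (Comp C g f) = Dom C f" "Cod C (Comp C g f) = Cod C g" using f g fg by auto
  have comp: "frag_map (w (Comp C g f)) c = frag_map (w g) (frag_map (w f) c)" if "c \<in> free (W (Dom C f))" for c
    unfolding frag_map_comp by (rule frag_map_cong[OF that]) (simp add: w_Comp[OF f g fg])
  show "dir F (Comp C g f) S = dir F g (dir F f S)" if "S \<in> carrier (Fib F (Dom C f))" for S
    using that
  proof (rule carrier_FibE[OF Dom_Obj[OF f]])
    fix A assume A: "A \<in> subgroups (W (Dom C f))" "S = encode (W (Dom C f)) A"
    have "frag_map (w (Comp C g f)) ` A = frag_map (w g) ` frag_map (w f) ` A"
      unfolding image_image using comp subgroups_free[OF A(1)] by (intro image_cong) auto
    then show ?thesis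
      using dir_encode[OF gf(1)] dir_encode[OF f A(1)] dir_encode[OF g] image_subgroup[OF f A(1)] A gf fg by simp
  qed
  show "inv F (Comp C g f) S = inv F f (inv F g S)" if "S \<in> carrier (Fib F (Cod C g))" for S
    using that
  proof (rule carrier_FibE[OF Cod_Obj[OF g]])
    fix A assume A: "A \<in> subgroups (W (Cod C g))" "S = encode (W (Cod C g)) A"
    have "{c \<in> free (W (Dom C f)). frag_map (w (Comp C g f)) c \<in> A} =
        {c \<in> free (W (Dom C f)). frag_map (w f) c \<in> {c \<in> free (W (Dom C g)). frag_map (w g) c \<in> A}}"
      using comp frag_map_free[OF w[OF f]] fg by auto
    then show ?thesis
      using inv_encode[OF gf(1)] inv_encode[OF g A(1)] inv_encode[OF f] preimage_subgroup[OF g A(1)] A gf fg by simp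
  qed
qed

lemma noetherian_form_F: "noetherian_form C F"
  unfolding noetherian_form_def
proof (intro conjI ballI allI impI is_form_F; (elim conjE)?)
  fix f assume f: "f \<in> Arr C"
  note X = Dom_Obj[OF f] and Y = Cod_Obj[OF f]
  show "inv F f (dir F f S) = S \<squnion>\<^bsub>Fib F (Dom C f)\<^esub> form_Ker C F f" if "S \<in> carrier (Fib F (Dom C f))" for S
    using that
  proof (rule carrier_FibE[OF X])
    fix A assume A: "A \<in> subgroups (W (Dom C f))" "S = encode (W (Dom C f)) A"
    then show ?thesis
      using preimage_image[OF A(1) w[OF f]] ker_subgroup[OF f]
      by (simp add: dir_encode[OF f] inv_encode[OF f] image_subgroup[OF f] form_Ker_eq[OF f] encode_join[OF X])
        (simp add: ker_def)
  qed
  show "dir F f (inv F f S) = S \<sqinter>\<^bsub>Fib F (Cod C f)\<^esub> form_Im C F f" if "S \<in> carrier (Fib F (Cod C f))" for S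
    using that
  proof (rule carrier_FibE[OF Y])
    fix A assume A: "A \<in> subgroups (W (Cod C f))" "S = encode (W (Cod C f)) A"
    have "frag_map (w f) ` {c \<in> free (W (Dom C f)). frag_map (w f) c \<in> A} = A \<inter> free (w f ` W (Dom C f))"
      unfolding image_free[OF w[OF f], symmetric] by auto
    then show ?thesis
      using A Im_subgroup[OF f] preimage_subgroup[OF f A(1)]
      by (simp add: dir_encode[OF f] inv_encode[OF f] form_Im_eq[OF f] encode_meet[OF Y])
  qed
  show "\<exists>e\<in>Arr C. \<exists>m\<in>Arr C. Cod C e = Dom C m \<and> f = Comp C m e \<and>
      quotient_of C F (Dom C f) (form_Ker C F f) e \<and> embedding_of C F (Cod C f) (form_Im C F f) m"
    using factor[OF f] embedding_mono quotient_strong_epi by metis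
next
  fix X K K' assume X: "X \<in> Obj C" and K: "normal C F X K" "normal C F X K'"
  obtain f f' where f: "f \<in> Arr C" "Dom C f = X" "form_Ker C F f = K"
    and f': "f' \<in> Arr C" "Dom C f' = X" "form_Ker C F f' = K'"
    using K by (auto simp: normal_def)
  \<comment> \<open>\<open>kernel_join\<close> is available for strong epimorphisms only, so the
    representing arrows are exchanged for their strong epi parts, which have the same
    kernels.\<close>
  obtain e where e: "e \<in> strong_epis C" "e \<in> Arr C" "Dom C e = X" "form_Ker C F e = K"
    using factor[OF f(1)] f by metis
  obtain g where g: "g \<in> strong_epis C" "g \<in> Arr C" "Dom C g = X" "form_Ker C F g = K'"
    using factor[OF f'(1)] f' by metis
  define R where "R = (\<lambda>u v. u \<in> W X \<and> v \<in> W X \<and> (w e u = w e v \<or> w g u = w g v))"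
  obtain d where d: "d \<in> Arr C" "Dom C d = X"
    and dR: "\<And>x y. x \<in> W X \<Longrightarrow> y \<in> W X \<Longrightarrow> w d x = w d y \<longleftrightarrow> R\<^sup>*\<^sup>* x y"
    using kernel_join[OF e(1) g(1)] e g by (auto simp: R_def)
  let ?S = "subgroup_sum (ker e) (ker g)"
  have ke: "ker e \<in> subgroups (W X)" and kg: "ker g \<in> subgroups (W X)" and kd: "ker d \<in> subgroups (W X)"
    using ker_subgroup[OF e(2)] ker_subgroup[OF g(2)] ker_subgroup[OF d(1)] e(3) g(3) d(2) by auto
  have S: "?S \<in> subgroups (W X)" by (rule subgroup_sum_subgroup[OF ke kg])
  \<comment> \<open>Along a chain the difference of the endpoints telescopes into differences that
    lie in one of the two kernels.\<close>
  have "frag_of x - frag_of y \<in> ?S" if "R\<^sup>*\<^sup>* x y" for x y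
    using that
  proof (induction rule: rtranclp_induct)
    case base
    then show ?case using subgroups_zero[OF S] by simp
  next
    case (step y z)
    then have "frag_of y - frag_of z \<in> ker e \<or> frag_of y - frag_of z \<in> ker g"
      using e g by (auto simp: R_def diff_mem_ker)
    then have "frag_of y - frag_of z \<in> ?S" using subgroup_sum_upper[OF ke kg] by blast
    then have "(frag_of x - frag_of y) + (frag_of y - frag_of z) \<in> ?S" using subgroups_add[OF S step.IH] by blast
    then show ?case by simp
  qed
  then have "ker d \<subseteq> ?S" using ker_le_iff[OF d(1), of ?S] d S dR by simp
  moreover have "?S \<subseteq> ker d"
  proof (rule subgroup_sum_least[OF kd])
    have "R\<^sup>*\<^sup>* x y" if "x \<in> W X" "y \<in> W X" "w e x = w e y \<or> w g x = w g y" for x y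
      using that by (auto simp: R_def)
    then show "ker e \<subseteq> ker d" "ker g \<subseteq> ker d"
      using e g d kd dR by (auto simp: ker_le_iff diff_mem_ker)
  qed
  ultimately have "form_Ker C F d = K \<squnion>\<^bsub>Fib F X\<^esub> K'"
    using e g d X ke kg form_Ker_eq[OF d(1)] form_Ker_eq[OF e(2)] form_Ker_eq[OF g(2)] by (metis encode_join antisym)
  moreover have "form_Ker C F d \<in> carrier (Fib F X)"
    using form_Ker_eq[OF d(1)] d encode_carrier[OF X kd] by simp
  ultimately show "normal C F X (K \<squnion>\<^bsub>Fib F X\<^esub> K')" using d by (auto simp: normal_def)
next
  fix X S S' assume X: "X \<in> Obj C" and S: "conormal C F X S" "conormal C F X S'"
  obtain f f' where f: "f \<in> Arr C" "Cod C f = X" "form_Im C F f = S"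
    and f': "f' \<in> Arr C" "Cod C f' = X" "form_Im C F f' = S'"
    using S by (auto simp: conormal_def)
  obtain m where m: "is_mono C m" "m \<in> Arr C" "Cod C m = X" "form_Im C F m = S"
    using factor[OF f(1)] f by metis
  obtain n where n: "is_mono C n" "n \<in> Arr C" "Cod C n = X" "form_Im C F n = S'"
    using factor[OF f'(1)] f' by metis
  obtain d where d: "d \<in> Arr C" "Cod C d = X" "w d ` W (Dom C d) = w m ` W (Dom C m) \<inter> w n ` W (Dom C n)"
    using image_meet[OF m(1) n(1)] m n by auto
  have I: "free (w m ` W (Dom C m)) \<in> subgroups (W X)" "free (w n ` W (Dom C n)) \<in> subgroups (W X)"
    "free (w d ` W (Dom C d)) \<in> subgroups (W X)"
    using Im_subgroup[OF m(2)] Im_subgroup[OF n(2)] Im_subgroup[OF d(1)] m(3) n(3) d(2) by simp_all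
  have "free (w m ` W (Dom C m)) \<inter> free (w n ` W (Dom C n)) = free (w d ` W (Dom C d))"
    unfolding d(3) by (auto simp: free_def)
  then have "form_Im C F d = S \<sqinter>\<^bsub>Fib F X\<^esub> S'"
    using encode_meet[OF X I(1,2)] form_Im_eq[OF d(1)] form_Im_eq[OF m(2)] form_Im_eq[OF n(2)] m n d by simp
  moreover have "form_Im C F d \<in> carrier (Fib F X)"
    using form_Im_eq[OF d(1)] d encode_carrier[OF X I(3)] by simp
  ultimately show "conormal C F X (S \<sqinter>\<^bsub>Fib F X\<^esub> S')" using d by (auto simp: conormal_def)
qed

lemma form_quotients_F: "form_quotients C F = strong_epis C"
proof (intro equalityI subsetI)
  fix e assume "e \<in> strong_epis C"
  then show "e \<in> form_quotients C F"
    unfolding form_quotients_def mem_Collect_eq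
    by (intro bexI[of _ "Dom C e"] exI[of _ "form_Ker C F e"] quotient_strong_epi) (simp_all add: strong_epis_Arr)
qed (auto simp: form_quotients_def quotient_is_strong_epi)

lemma form_embeddings_F: "form_embeddings C F = mono_arrs C"
proof (intro equalityI subsetI)
  fix m assume "m \<in> mono_arrs C"
  then have "is_mono C m" by (simp add: mono_arrs_def)
  then show "m \<in> form_embeddings C F"
    unfolding form_embeddings_def mem_Collect_eq
    by (intro bexI[of _ "Cod C m"] exI[of _ "form_Im C F m"] embedding_mono) (simp_all add: is_mono_Arr)
qed (auto simp: form_embeddings_def mono_arrs_def embedding_is_mono)

lemma Fib_lattices:
  assumes "X \<in> Obj C"
  shows "complete_lattice (Fib F X)" "algebraic_lattice (Fib F X)" "modular_lattice (Fib F X)"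
  using small_basis.complete_lattice_L small_basis.algebraic_lattice_L small_basis.modular_lattice_L
    small_basis_Fib[OF assms] by blast+

end


section \<open>The transfer functor\<close>

locale transfer_to_variety = finitary_variety T + adjunction_on C "Mod T" L R \<phi>
  for C :: "('o, 'm) cat" and T :: "'u ea_theory" and L R \<phi> +
  assumes ea: "essentially_algebraic TYPE('u) C"
    and reflects: "reflects_isos C (Mod T) L"
    and pres_monos: "preserves_monos C (Mod T) L"
    and pres_pullbacks: "preserves_pullbacks_of (mono_arrs C) C (Mod T) L"
begin

abbreviation car :: "'o \<Rightarrow> 'u \<Rightarrow> 'u set" where "car X \<equiv> Carr (FObj L X)"

definition hm :: "'m \<Rightarrow> 'u \<Rightarrow> 'u \<Rightarrow> 'u" where
  "hm f = fst (snd (FArr L f))"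

text \<open>Tagging with the sort keeps the carriers apart, even where they overlap as subsets of
  \<open>'u\<close>; identifications therefore happen only within one sort.\<close>

definition elements :: "'o \<Rightarrow> ('u \<times> 'u) set" where
  "elements X = {(s, x). x \<in> car X s}"

definition on_elements :: "'m \<Rightarrow> 'u \<times> 'u \<Rightarrow> 'u \<times> 'u" where
  "on_elements f = (\<lambda>(s, x). (s, hm f s x))"

lemma FArr_eq: assumes "f \<in> Arr C" shows "FArr L f = (FObj L (Dom C f), hm f, FObj L (Cod C f))"
  using L.Dom_FArr[OF assms] L.Cod_FArr[OF assms] by (cases "FArr L f") (simp add: hm_def)

lemma model: "X \<in> Obj C \<Longrightarrow> is_model T (FObj L X)"
  using L.FObj_Obj by simp

lemma hom: "f \<in> Arr C \<Longrightarrow> is_hom T (FObj L (Dom C f)) (FObj L (Cod C f)) (hm f)"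
  using L.FArr_Arr[of f] by (simp add: FArr_eq)

lemma hm_mem: "f \<in> Arr C \<Longrightarrow> x \<in> car (Dom C f) s \<Longrightarrow> hm f s x \<in> car (Cod C f) s"
  by (rule is_hom_mem[OF hom])

lemma hm_Comp:
  assumes "f \<in> Arr C" "g \<in> Arr C" "Cod C f = Dom C g" "x \<in> car (Dom C f) s"
  shows "hm (Comp C g f) s x = hm g s (hm f s x)"
proof -
  have "FArr L (Comp C g f) = Comp (Mod T) (FArr L g) (FArr L f)" using assms by simp
  then have "hm (Comp C g f) = (\<lambda>s. compose (car (Dom C f) s) (hm g s) (hm f s))"
    using assms by (simp add: FArr_eq)
  then show ?thesis using assms by (simp add: compose_eq)
qed

lemma hm_Idn: "X \<in> Obj C \<Longrightarrow> x \<in> car X s \<Longrightarrow> hm (Idn C X) s x = x"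
  using L.FArr_Idn[of X] by (simp add: FArr_eq)

lemma hm_inj: assumes m: "is_mono C m" shows "inj_on (hm m s) (car (Dom C m) s)"
proof -
  have "is_mono (Mod T) (FArr L m)" using pres_monos m by (simp add: preserves_monos_def)
  then show ?thesis
    using L.C.is_mono_Arr[OF m] is_mono_Mod_iff[OF U wf] by (simp add: FArr_eq)
qed

lemma hm_surj: "e \<in> strong_epis C \<Longrightarrow> hm e s ` car (Dom C e) s = car (Cod C e) s"
  using strong_epi_surjective left_adjoint_preserves_strong_epi[of e] L.C.strong_epis_Arr[of e]
  by (simp add: FArr_eq)

lemma reflects_iso: "f \<in> Arr C \<Longrightarrow> is_iso (Mod T) (FArr L f) \<Longrightarrow> is_iso C f"
  using reflects by (simp add: reflects_isos_def)

section \<open>Factorizations, kernels and images reflected by the functor\<close>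

text \<open>The image of a pullback under \<open>L\<close> is known only through its universal
  property. The comparison arrow from the explicit pullback of models carries the element over
  \<open>x\<close> and \<open>y\<close> into it.\<close>

lemma pullback_elements:
  assumes m: "is_mono C m" and n: "is_mono C n" and pb: "is_pullback C m n p q"
    and x: "x \<in> car (Dom C m) s" and y: "y \<in> car (Dom C n) s" and xy: "hm m s x = hm n s y"
  obtains z where "z \<in> car (Dom C p) s" "hm p s z = x" "hm q s z = y"
proof -
  have A: "m \<in> Arr C" "n \<in> Arr C" "Cod C m = Cod C n" "p \<in> Arr C" "q \<in> Arr C" "Dom C p = Dom C q"
    "Cod C p = Dom C m" "Cod C q = Dom C n"
    using pb by (auto simp: is_pullback_def)
  note O = model[OF L.C.Dom_Obj[OF A(1)]] model[OF L.C.Dom_Obj[OF A(2)]] model[OF L.C.Cod_Obj[OF A(1)]]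
  have hn: "is_hom T (FObj L (Dom C n)) (FObj L (Cod C m)) (hm n)" using hom[OF A(2)] A(3) by simp
  have Lpb: "is_pullback (Mod T) (FArr L m) (FArr L n) (FArr L p) (FArr L q)"
    using pres_pullbacks pb m n by (simp add: preserves_pullbacks_of_def mono_arrs_def)
  obtain P p' q' where pb': "is_pullback (Mod T) (FObj L (Dom C m), hm m, FObj L (Cod C m))
      (FObj L (Dom C n), hm n, FObj L (Cod C m)) (P, p', FObj L (Dom C m)) (P, q', FObj L (Dom C n))"
    and pairs: "\<And>s x y. x \<in> car (Dom C m) s \<Longrightarrow> y \<in> car (Dom C n) s \<Longrightarrow> hm m s x = hm n s y \<Longrightarrow>
      \<exists>z\<in>Carr P s. p' s z = x \<and> q' s z = y"
    by (rule pullback_Mod[OF U wf O hom[OF A(1)] hn], rule that)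
  obtain z where z: "z \<in> Carr P s" "p' s z = x" "q' s z = y" using pairs[OF x y xy] by blast
  obtain h where h: "h \<in> Arr (Mod T)" "Dom (Mod T) h = P" "Cod (Mod T) h = FObj L (Dom C p)"
    "Comp (Mod T) (FArr L p) h = (P, p', FObj L (Dom C m))" "Comp (Mod T) (FArr L q) h = (P, q', FObj L (Dom C n))"
    by (rule Mod.is_pullbackE[OF Lpb, of "(P, p', FObj L (Dom C m))" "(P, q', FObj L (Dom C n))"])
      (use pb' A in \<open>auto simp: is_pullback_def FArr_eq\<close>)
  obtain h' where h': "h = (P, h', FObj L (Dom C p))" using h by (cases h) auto
  have "(\<lambda>s. compose (Carr P s) (hm p s) (h' s)) = p'" "(\<lambda>s. compose (Carr P s) (hm q s) (h' s)) = q'"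
    using h(4,5) A by (simp_all add: h' FArr_eq)
  then have "compose (Carr P s) (hm p s) (h' s) = p' s" "compose (Carr P s) (hm q s) (h' s) = q' s"
    by (simp_all add: fun_eq_iff)
  then have "hm p s (h' s z) = x" "hm q s (h' s z) = y" using z by (metis compose_eq)+
  moreover have "h' s z \<in> car (Dom C p) s" using h(1) z is_hom_mem[of T P _ h'] by (simp add: h')
  ultimately show thesis using that by blast
qed

text \<open>Under \<open>L\<close>, the projection \<open>q\<close> onto the domain of
  \<open>n\<close> is injective, being a pullback of the mono \<open>m\<close>, and inclusion of
  images makes it surjective. Hence \<open>q\<close> is invertible, and its inverse \<open>j\<close>
  followed by the other projection is the factor.\<close>

lemma mono_factor:
  assumes m: "is_mono C m" and n: "is_mono C n" and mn: "Cod C m = Cod C n"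
    and sub: "\<And>s. hm n s ` car (Dom C n) s \<subseteq> hm m s ` car (Dom C m) s"
  shows "\<exists>h\<in>Arr C. Dom C h = Dom C n \<and> Cod C h = Dom C m \<and> Comp C m h = n"
proof -
  obtain p q where pb: "is_pullback C m n p q"
    using essentially_algebraic_pullbacks[OF U ea, of m n] L.C.is_mono_Arr m n mn by blast
  then have A: "m \<in> Arr C" "n \<in> Arr C" "p \<in> Arr C" "q \<in> Arr C" "Dom C p = Dom C q"
    "Cod C p = Dom C m" "Cod C q = Dom C n" "Comp C m p = Comp C n q"
    by (auto simp: is_pullback_def)
  have "bij_betw (hm q s) (car (Dom C q) s) (car (Cod C q) s)" for s
    unfolding bij_betw_def
  proof (intro conjI equalityI subsetI)
    show "inj_on (hm q s) (car (Dom C q) s)" by (rule hm_inj[OF L.C.pullback_of_mono[OF m pb]])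
    show "y \<in> car (Cod C q) s" if "y \<in> hm q s ` car (Dom C q) s" for y using that hm_mem[OF A(4)] by auto
    fix y assume "y \<in> car (Cod C q) s"
    then have y: "y \<in> car (Dom C n) s" using A by simp
    then obtain x where x: "x \<in> car (Dom C m) s" "hm m s x = hm n s y" using sub[of s] by force
    obtain z where "z \<in> car (Dom C p) s" "hm q s z = y" by (rule pullback_elements[OF m n pb x(1) y x(2)])
    then show "y \<in> hm q s ` car (Dom C q) s" using A by auto
  qed
  then have "is_iso (Mod T) (FArr L q)"
    unfolding FArr_eq[OF A(4)] by (intro bij_hom_iso wf model hom A L.C.Dom_Obj L.C.Cod_Obj)
  then have "is_iso C q" by (rule reflects_iso[OF A(4)])
  then obtain j where j: "j \<in> Arr C" "Dom C j = Cod C q" "Cod C j = Dom C q" "Comp C q j = Idn C (Cod C q)"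
    by (rule L.C.is_isoE)
  have "Comp C m (Comp C p j) = Comp C n (Comp C q j)"
    using A j(1-3) by (simp flip: L.C.Comp_assoc)
  then have "Comp C m (Comp C p j) = n" using A j(4) by simp
  then show ?thesis using A j by (intro bexI[of _ "Comp C p j"]) simp_all
qed

text \<open>Inclusion of kernels gives the factor in the variety, namely \<open>?k\<close>, and the
  pushout serves to bring it back to \<open>C\<close>. Together with the identity, \<open>?k\<close>
  forms a cocone, and the induced \<open>h\<close> is an inverse of the leg \<open>FArr L q\<close>.
  So \<open>q\<close> itself is invertible, and \<open>p\<close> followed by its inverse is the
  factor.\<close>

lemma epi_factor:
  assumes e: "e \<in> strong_epis C" and g: "g \<in> strong_epis C" and eg: "Dom C e = Dom C g"
    and ker: "\<And>s x y. x \<in> car (Dom C e) s \<Longrightarrow> y \<in> car (Dom C e) s \<Longrightarrow> hm e s x = hm e s y \<Longrightarrow> hm g s x = hm g s y"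
  shows "\<exists>h\<in>Arr C. Dom C h = Cod C e \<and> Cod C h = Cod C g \<and> Comp C h e = g"
proof -
  obtain p q where po: "is_pushout C e g p q"
    using essentially_algebraic_pushouts[OF U ea, of e g] L.C.strong_epis_Arr e g eg by blast
  then have A: "e \<in> Arr C" "g \<in> Arr C" "p \<in> Arr C" "q \<in> Arr C" "Cod C p = Cod C q"
    "Dom C p = Cod C e" "Dom C q = Cod C g" "Comp C p e = Comp C q g"
    by (auto simp: is_pushout_def)
  have Lpo: "is_pushout (Mod T) (FArr L e) (FArr L g) (FArr L p) (FArr L q)"
    by (rule left_adjoint_preserves_pushout[OF po])
  have hg: "is_hom T (FObj L (Dom C e)) (FObj L (Cod C g)) (hm g)" using hom[OF A(2)] eg by simp
  have M: "is_model T (FObj L (Dom C e))" "is_model T (FObj L (Cod C e))" "is_model T (FObj L (Cod C g))"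
    using model A by auto
  obtain k' where k': "is_hom T (FObj L (Cod C e)) (FObj L (Cod C g)) k'"
    "\<And>s x. x \<in> car (Dom C e) s \<Longrightarrow> k' s (hm e s x) = hm g s x"
    by (rule factor_through_surjective[OF M hom[OF A(1)] hm_surj[OF e] hg ker], assumption+, rule that)
  let ?k = "(FObj L (Cod C e), k', FObj L (Cod C g))"
  have k: "?k \<in> Arr (Mod T)" using k' M by simp
  have "compose (car (Dom C e) s) (k' s) (hm e s) = hm g s" for s
    using k'(2) is_hom_funcset[OF hg, of s] by (auto simp: compose_def PiE_iff extensional_def fun_eq_iff)
  then have ke: "Comp (Mod T) ?k (FArr L e) = FArr L g" using A eg by (simp add: FArr_eq)
  let ?id = "Idn (Mod T) (FObj L (Cod C g))"
  have LA: "FArr L e \<in> Arr (Mod T)" "FArr L g \<in> Arr (Mod T)" "FArr L p \<in> Arr (Mod T)" "FArr L q \<in> Arr (Mod T)"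
    using A by simp_all
  have id: "?id \<in> Arr (Mod T)" "Dom (Mod T) ?id = FObj L (Cod C g)" "Cod (Mod T) ?id = FObj L (Cod C g)"
    "Comp (Mod T) ?id (FArr L g) = FArr L g"
    using A L.FObj_Obj by (simp_all del: Mod_simps(5))
  obtain h where h: "h \<in> Arr (Mod T)" "Dom (Mod T) h = FObj L (Cod C p)" "Cod (Mod T) h = FObj L (Cod C g)"
    "Comp (Mod T) h (FArr L p) = ?k" "Comp (Mod T) h (FArr L q) = ?id"
    by (rule Mod.is_pushoutE[OF Lpo k id(1)])
      (use ke id A in \<open>simp_all del: Mod_simps(5) add: L.Dom_FArr L.Cod_FArr\<close>)
  have pk: "Comp (Mod T) (FArr L q) ?k = FArr L p"
  proof (rule Mod.epi_cancel[OF left_adjoint_preserves_epi[OF L.C.strong_epis_epi[OF e]]])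
    have "Comp (Mod T) (Comp (Mod T) (FArr L q) ?k) (FArr L e) = Comp (Mod T) (FArr L q) (FArr L g)"
      using k LA A by (subst Mod.Comp_assoc) (simp_all add: ke)
    also have "\<dots> = Comp (Mod T) (FArr L p) (FArr L e)"
      using A eg by (simp flip: L.FArr_Comp)
    finally show "Comp (Mod T) (Comp (Mod T) (FArr L q) ?k) (FArr L e) = Comp (Mod T) (FArr L p) (FArr L e)" .
  qed (use k LA A in \<open>simp_all del: Mod_simps(6)\<close>)
  have "Comp (Mod T) (FArr L q) h = Idn (Mod T) (FObj L (Cod C p))"
  proof (rule Mod.is_pushout_unique[OF Lpo])
    have "Comp (Mod T) (Comp (Mod T) (FArr L q) h) (FArr L p) = FArr L p"
      using h LA A pk by (subst Mod.Comp_assoc) simp_all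
    then show "Comp (Mod T) (Comp (Mod T) (FArr L q) h) (FArr L p) =
        Comp (Mod T) (Idn (Mod T) (FObj L (Cod C p))) (FArr L p)"
      using A LA by (simp del: Mod_simps(5))
    have "Comp (Mod T) (Comp (Mod T) (FArr L q) h) (FArr L q) = FArr L q"
      using h LA A by (subst Mod.Comp_assoc) (simp_all del: Mod_simps(5))
    then show "Comp (Mod T) (Comp (Mod T) (FArr L q) h) (FArr L q) =
        Comp (Mod T) (Idn (Mod T) (FObj L (Cod C p))) (FArr L q)"
      using A LA by (simp del: Mod_simps(5))
  qed (use h LA A L.FObj_Obj in \<open>simp_all del: Mod_simps(5)\<close>)
  then have "is_iso (Mod T) (FArr L q)"
    using h LA A by (intro Mod.is_isoI[of "FArr L q" _ h]) (simp_all del: Mod_simps(5))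
  then have "is_iso C q" by (rule reflects_iso[OF A(4)])
  then obtain j where j: "j \<in> Arr C" "Dom C j = Cod C q" "Cod C j = Dom C q" "Comp C j q = Idn C (Dom C q)"
    by (rule L.C.is_isoE)
  have "Comp C (Comp C j p) e = Comp C (Comp C j q) g"
    using A(1-7) eg j(1-3) by (simp add: L.C.Comp_assoc A(8))
  then have "Comp C (Comp C j p) e = g" using A j(4) by simp
  then show ?thesis using A j by (intro bexI[of _ "Comp C j p"]) simp_all
qed

text \<open>The witness is the diagonal \<open>Comp C p e\<close> of the pushout square. Since
  \<open>L\<close> preserves the pushout, \<open>pushout_kernel\<close> describes its kernel sort by
  sort, and chains of tagged elements never leave their sort.\<close>

lemma kernel_join:
  assumes e: "e \<in> strong_epis C" and g: "g \<in> strong_epis C" and eg: "Dom C e = Dom C g"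
  shows "\<exists>d\<in>Arr C. Dom C d = Dom C e \<and> (\<forall>x\<in>elements (Dom C e). \<forall>y\<in>elements (Dom C e).
    on_elements d x = on_elements d y \<longleftrightarrow>
    (\<lambda>u v. u \<in> elements (Dom C e) \<and> v \<in> elements (Dom C e) \<and>
      (on_elements e u = on_elements e v \<or> on_elements g u = on_elements g v))\<^sup>*\<^sup>* x y)"
proof -
  obtain p q where po: "is_pushout C e g p q"
    using essentially_algebraic_pushouts[OF U ea, of e g] L.C.strong_epis_Arr e g eg by blast
  then have A: "e \<in> Arr C" "g \<in> Arr C" "p \<in> Arr C" "q \<in> Arr C" "Cod C p = Cod C q"
    "Dom C p = Cod C e" "Dom C q = Cod C g" "Comp C p e = Comp C q g"
    by (auto simp: is_pushout_def)
  have Lpo: "is_pushout (Mod T) (FArr L e) (FArr L g) (FArr L p) (FArr L q)"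
    by (rule left_adjoint_preserves_pushout[OF po])
  have sur: "FArr L e \<in> surjective_homs T" "FArr L g \<in> surjective_homs T"
    unfolding surjective_homs_eq using e g left_adjoint_preserves_strong_epi by auto
  have sur': "(FObj L (Dom C e), hm e, FObj L (Cod C e)) \<in> surjective_homs T"
      "(FObj L (Dom C e), hm g, FObj L (Cod C g)) \<in> surjective_homs T"
    and Lpo': "is_pushout (Mod T) (FObj L (Dom C e), hm e, FObj L (Cod C e)) (FObj L (Dom C e), hm g, FObj L (Cod C g))
      (FObj L (Cod C e), hm p, FObj L (Cod C p)) (FObj L (Cod C g), hm q, FObj L (Cod C p))"
    using sur Lpo A eg by (simp_all add: FArr_eq)
  define R where "R = (\<lambda>u v. u \<in> elements (Dom C e) \<and> v \<in> elements (Dom C e) \<and>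
      (on_elements e u = on_elements e v \<or> on_elements g u = on_elements g v))"
  let ?d = "Comp C p e"
  have d: "?d \<in> Arr C" "Dom C ?d = Dom C e" using A(1-7) by simp_all
  have d_e: "hm ?d s x = hm p s (hm e s x)" if "x \<in> car (Dom C e) s" for s x
    using A(1-7) that by (simp add: hm_Comp)
  have d_g: "hm ?d s x = hm q s (hm g s x)" if "x \<in> car (Dom C e) s" for s x
    unfolding A(8) using A(1-7) eg that by (simp add: hm_Comp)
  have "R\<^sup>*\<^sup>* x y" if x: "x \<in> elements (Dom C e)" and y: "y \<in> elements (Dom C e)"
    and xy: "on_elements ?d x = on_elements ?d y" for x y
  proof -
    obtain s a b where ab: "x = (s, a)" "y = (s, b)" "a \<in> car (Dom C e) s" "b \<in> car (Dom C e) s" "hm ?d s a = hm ?d s b"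
      using x y xy by (auto simp: elements_def on_elements_def)
    have "hm p s (hm e s a) = hm p s (hm e s b)" using ab d_e by simp
    then have "(\<lambda>u v. u \<in> car (Dom C e) s \<and> v \<in> car (Dom C e) s \<and> (hm e s u = hm e s v \<or> hm g s u = hm g s v))\<^sup>*\<^sup>* a b"
      by (rule pushout_kernel[OF sur' Lpo' ab(3,4)])
    then have "R\<^sup>*\<^sup>* (s, a) (s, b)"
    proof (induction rule: rtranclp_induct)
      case (step b c)
      then have "R (s, b) (s, c)" by (auto simp: R_def elements_def on_elements_def)
      with step.IH show ?case by simp
    qed simp
    then show ?thesis using ab by simp
  qed
  moreover have "on_elements ?d x = on_elements ?d y" if "R\<^sup>*\<^sup>* x y" for x y
    using that
  proof (induction rule: rtranclp_induct)
    case (step y z)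
    then obtain s a b where ab: "y = (s, a)" "z = (s, b)" "a \<in> car (Dom C e) s" "b \<in> car (Dom C e) s"
      "hm e s a = hm e s b \<or> hm g s a = hm g s b"
      by (auto simp: R_def elements_def on_elements_def)
    then have "hm ?d s a = hm ?d s b" using d_e d_g by metis
    then have "on_elements ?d y = on_elements ?d z" using ab by (simp add: on_elements_def)
    with step.IH show ?case by simp
  qed simp
  ultimately show ?thesis using d unfolding R_def by blast
qed

text \<open>The witness is the diagonal of the pullback square; an element in both images lifts to
  the pullback by \<open>pullback_elements\<close>.\<close>

lemma image_meet:
  assumes m: "is_mono C m" and n: "is_mono C n" and mn: "Cod C m = Cod C n"
  shows "\<exists>d\<in>Arr C. Cod C d = Cod C m \<and> on_elements d ` elements (Dom C d) =
    on_elements m ` elements (Dom C m) \<inter> on_elements n ` elements (Dom C n)"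
proof -
  obtain p q where pb: "is_pullback C m n p q"
    using essentially_algebraic_pullbacks[OF U ea, of m n] L.C.is_mono_Arr m n mn by blast
  then have A: "m \<in> Arr C" "n \<in> Arr C" "p \<in> Arr C" "q \<in> Arr C" "Dom C p = Dom C q"
    "Cod C p = Dom C m" "Cod C q = Dom C n" "Comp C m p = Comp C n q"
    by (auto simp: is_pullback_def)
  let ?d = "Comp C m p"
  have d_m: "hm ?d s x = hm m s (hm p s x)" if "x \<in> car (Dom C p) s" for s x
    using A(1-7) that by (simp add: hm_Comp)
  have d_n: "hm ?d s x = hm n s (hm q s x)" if "x \<in> car (Dom C p) s" for s x
    unfolding A(8) using A(1-7) that by (simp add: hm_Comp)
  have mem: "hm p s x \<in> car (Dom C m) s" "hm q s x \<in> car (Dom C n) s" if "x \<in> car (Dom C p) s" for s x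
    using hm_mem[OF A(3), of x s] hm_mem[OF A(4), of x s] A that by simp_all
  have "on_elements ?d ` elements (Dom C ?d) = on_elements m ` elements (Dom C m) \<inter> on_elements n ` elements (Dom C n)"
  proof (intro equalityI subsetI)
    fix u assume "u \<in> on_elements ?d ` elements (Dom C ?d)"
    then obtain s x where x: "x \<in> car (Dom C p) s" "u = (s, hm ?d s x)"
      using A by (auto simp: elements_def on_elements_def)
    then have "u = on_elements m (s, hm p s x)" "u = on_elements n (s, hm q s x)"
      by (simp_all only: on_elements_def prod.case d_m[OF x(1)]) (simp only: d_m[OF x(1), symmetric] d_n[OF x(1)])
    moreover have "(s, hm p s x) \<in> elements (Dom C m)" "(s, hm q s x) \<in> elements (Dom C n)"
      using mem[OF x(1)] by (simp_all add: elements_def)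
    ultimately show "u \<in> on_elements m ` elements (Dom C m) \<inter> on_elements n ` elements (Dom C n)" by blast
  next
    fix u assume "u \<in> on_elements m ` elements (Dom C m) \<inter> on_elements n ` elements (Dom C n)"
    then obtain s x y where u: "x \<in> car (Dom C m) s" "y \<in> car (Dom C n) s" "hm m s x = hm n s y" "u = (s, hm m s x)"
      by (auto simp: elements_def on_elements_def)
    obtain z where z: "z \<in> car (Dom C p) s" "hm p s z = x" by (rule pullback_elements[OF m n pb u(1-3)])
    then have "u = on_elements ?d (s, z)" using u d_m by (simp add: on_elements_def)
    moreover have "(s, z) \<in> elements (Dom C ?d)" using z A by (simp add: elements_def)
    ultimately show "u \<in> on_elements ?d ` elements (Dom C ?d)" by blast
  qed
  then show ?thesis using A(1-7) by (intro bexI[of _ ?d]) simp_all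
qed

section \<open>The assembled form and the transfer functor\<close>

lemma concrete_transfer_elements:
  "concrete_transfer C elements on_elements (subgroup_form C elements on_elements :: ('o, 'm, 'u) form)"
proof
  show "small TYPE('u) (elements X)" if X: "X \<in> Obj C" for X
  proof (rule small_subset)
    show "elements X \<subseteq> Sigma (Sorts T) (car X)" using model_sort[OF model[OF X]] by (auto simp: elements_def)
    show "small TYPE('u) (Sigma (Sorts T) (car X))"
      by (intro small_Sigma U wf_theoryD(1)[OF wf] model_small[OF model[OF X]])
  qed
  show "on_elements f \<in> elements (Dom C f) \<rightarrow> elements (Cod C f)" if "f \<in> Arr C" for f
    using hm_mem[OF that] by (auto simp: elements_def on_elements_def)
  show "on_elements (Idn C X) x = x" if "X \<in> Obj C" "x \<in> elements X" for X x
    using that by (auto simp: elements_def on_elements_def hm_Idn)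
  show "on_elements (Comp C g f) x = on_elements g (on_elements f x)"
    if "f \<in> Arr C" "g \<in> Arr C" "Cod C f = Dom C g" "x \<in> elements (Dom C f)" for f g x
    using that by (auto simp: elements_def on_elements_def hm_Comp)
  show "inj_on (on_elements m) (elements (Dom C m))" if "is_mono C m" for m
    using hm_inj[OF that] by (auto simp: elements_def on_elements_def inj_on_def)
  show "on_elements e ` elements (Dom C e) = elements (Cod C e)" if "e \<in> strong_epis C" for e
    using hm_surj[OF that] by (auto simp: elements_def on_elements_def image_iff set_eq_iff)
  show "\<exists>h\<in>Arr C. Dom C h = Dom C n \<and> Cod C h = Dom C m \<and> Comp C m h = n"
    if "is_mono C m" "is_mono C n" "Cod C m = Cod C n"
      "on_elements n ` elements (Dom C n) \<subseteq> on_elements m ` elements (Dom C m)" for m n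
  proof (rule mono_factor[OF that(1-3)])
    show "hm n s ` car (Dom C n) s \<subseteq> hm m s ` car (Dom C m) s" for s
      using that(4) by (force simp: elements_def on_elements_def image_subset_iff)
  qed
  show "\<exists>h\<in>Arr C. Dom C h = Cod C e \<and> Cod C h = Cod C g \<and> Comp C h e = g"
    if "e \<in> strong_epis C" "g \<in> strong_epis C" "Dom C e = Dom C g"
      and ker: "\<And>x y. x \<in> elements (Dom C e) \<Longrightarrow> y \<in> elements (Dom C e) \<Longrightarrow>
        on_elements e x = on_elements e y \<Longrightarrow> on_elements g x = on_elements g y" for e g
  proof (rule epi_factor[OF that(1-3)])
    fix s x y assume "x \<in> car (Dom C e) s" "y \<in> car (Dom C e) s" "hm e s x = hm e s y"
    then show "hm g s x = hm g s y" using ker[of "(s, x)" "(s, y)"] by (simp add: elements_def on_elements_def)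
  qed
qed (rule U essentially_algebraic_factorization[OF U ea] kernel_join image_meet refl; assumption)+

text \<open>Preservation of the left class and of pushouts comes from the right adjoint. Rewriting
  the surjective and injective homomorphisms as strong epimorphisms and monomorphisms puts both
  sides in the same terms.\<close>

lemma transfer_functor_L:
  "transfer_functor C (strong_epis C) (mono_arrs C) (Mod T) (surjective_homs T) (injective_homs T) L"
  unfolding transfer_functor_def surjective_homs_eq injective_homs_eq
proof (intro conjI L.functorial reflects pres_pullbacks transfer_setting_Mod U wf)
  show "transfer_setting C (strong_epis C) (mono_arrs C)"
    by (intro transfer_setting_strong_epi_mono L.C.category essentially_algebraic_factorization[OF U ea]
        essentially_algebraic_pullbacks[OF U ea] essentially_algebraic_pushouts[OF U ea])
  show "FArr L ` strong_epis C \<subseteq> strong_epis (Mod T)" using left_adjoint_preserves_strong_epi by auto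
  show "FArr L ` mono_arrs C \<subseteq> mono_arrs (Mod T)" using pres_monos by (auto simp: mono_arrs_def preserves_monos_def)
  show "preserves_pushouts_of (strong_epis C) C (Mod T) L"
    using left_adjoint_preserves_pushout by (simp add: preserves_pushouts_of_def)
qed

end

theorem theorem3p26:
  fixes C :: "('o, 'm) cat"
    and T :: "'u ea_theory"
    and L :: "('o, 'm, 'u model, 'u model_arr) functr"
  assumes "universe TYPE('u)"
    and "essentially_algebraic TYPE('u) C"
    and "finitary_equational_theory T"
    and "is_functor C (Mod T) L"
    and "has_right_adjoint C (Mod T) L"
    and "reflects_isos C (Mod T) L"
    and "preserves_monos C (Mod T) L"
    and "preserves_pullbacks_of (mono_arrs C) C (Mod T) L"
  shows "transfer_functor C (strong_epis C) (mono_arrs C)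
           (Mod T) (surjective_homs T) (injective_homs T) L \<and>
         (\<exists>F :: ('o, 'm, 'u) form.
            noetherian_form C F \<and>
            form_quotients C F = strong_epis C \<and>
            form_embeddings C F = mono_arrs C \<and>
            (\<forall>X \<in> Obj C. complete_lattice (Fib F X) \<and> algebraic_lattice (Fib F X) \<and>
               modular_lattice (Fib F X)))"
proof -
  obtain R \<phi> where "is_adjunction C (Mod T) L R \<phi>"
    using assms(5) by (auto simp: has_right_adjoint_def)
  then interpret transfer_to_variety C T L R \<phi>
    using assms category_Mod
    by unfold_locales (auto simp: is_adjunction_def essentially_algebraic_def)
  interpret concrete_transfer C elements on_elements "subgroup_form C elements on_elements :: ('o, 'm, 'u) form"
    by (rule concrete_transfer_elements)
  show ?thesis
    using transfer_functor_L noetherian_form_F form_quotients_F form_embeddings_F Fib_lattices by blast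
qed

end
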